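(* Let $p>2$ be a prime and let $n\ge m\ge 1$ be integers. Let $G$ be a finite $p$-group given by a central extension $$1\longrightarrow N\longrightarrow G\longrightarrow \mathbb{Z}_p\times\cdots\times\mathbb{Z}_p\longrightarrow 1,\qquad N\cong\mathbb{Z}_{p^n}\times\mathbb{Z}_{p^m},$$ (so $N$ is a central subgroup of $G$ and $G/N$ is elementary abelian), with $G'=\langle c\rangle\cong\mathbb{Z}_p$. Let $|G/\zeta G|=p^{2k}$ and $d(\zeta G)=r$. Write $\mathbb{Z}_p^{\,s}$ for the direct product of $s$ copies of $\mathbb{Z}_p$, and $M_p(1,1,1)^{\mathsf{Y} s}$ for the central product of $s$ copies of $M_p(1,1,1)$. Then: (1) One can write $\zeta G=\langle z_1\rangle\times\langle z_2\rangle\times\cdots\times\langle z_r\rangle$ such that one of the following four types holds (in each case $\langle z_1\rangle,\langle z_2\rangle$ are the first two listed cyclic factors and $\langle z_3\rangle,\dots,\langle z_r\rangle$ have order $p$): (i) type $A_1$: $\zeta G\cong \mathbb{Z}_{p^n}\times\mathbb{Z}_{p^m}\times\mathbb{Z}_p^{\,r-2}$ and $N=\langle z_1\rangle\times\langle z_2\rangle$; (ii) type $A_2$: $\zeta G\cong \mathbb{Z}_{p^{n+1}}\times\mathbb{Z}_{p^m}\times\mathbb{Z}_p^{\,r-2}$ and $N=\langle z_1^p\rangle\times\langle z_2\rangle$; (iii) type $A_3$: $\zeta G\cong \mathbb{Z}_{p^n}\times\mathbb{Z}_{p^{m+1}}\times\mathbb{Z}_p^{\,r-2}$ and $N=\langle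 z_1\rangle\times\langle z_2^p\rangle$; (iv) type $A_4$: $\zeta G\cong \mathbb{Z}_{p^{n+1}}\times\mathbb{Z}_{p^{m+1}}\times\mathbb{Z}_p^{\,r-2}$ and $N=\langle z_1^p\rangle\times\langle z_2^p\rangle$. (2) For type $A_1$ with $c\in\langle z_1\rangle$, the isomorphism types of $G$ are (i.e. $G$ is isomorphic to one of): - $M_p(n+1,m+1)\,\mathsf{Y}\, M_p(1,1,1)^{\mathsf{Y}(k-1)}\times\mathbb{Z}_p^{\,r-2}$; - $M_p(n+1,1)\,\mathsf{Y}\, M_p(m+1,1,1)\,\mathsf{Y}\, M_p(1,1,1)^{\mathsf{Y}(k-2)}\times\mathbb{Z}_p^{\,r-2}$ (with $k\ge 2$); - $M_p(n+1,1)\,\mathsf{Y}\, M_p(1,1,1)^{\mathsf{Y}(k-1)}\times\mathbb{Z}_{p^m}\times\mathbb{Z}_p^{\,r-2}$; - $M_p(m+1,1,1)\,\mathsf{Y}\, M_p(1,1,1)^{\mathsf{Y}(k-1)}\,\mathsf{Y}\,\mathbb{Z}_{p^n}\times\mathbb{Z}_p^{\,r-2}$; - $M_p(1,1,1)^{\mathsf{Y}k}\,\mathsf{Y}\,\mathbb{Z}_{p^n}\times\mathbb{Z}_{p^m}\times\mathbb{Z}_p^{\,r-2}$. (3) For type $A_1$ with $c\in\langle z_2\rangle$, the isomorphism types of $G$ are: - $M_p(m+1,n+1)\,\mathsf{Y}\, M_p(1,1,1)^{\mathsf{Y}(k-1)}\times\mathbb{Z}_p^{\,r-2}$; - $M_p(m+1,1)\,\mathsf{Y}\,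 M_p(n+1,1,1)\,\mathsf{Y}\, M_p(1,1,1)^{\mathsf{Y}(k-2)}\times\mathbb{Z}_p^{\,r-2}$ (with $k\ge 2$); - $M_p(m+1,1)\,\mathsf{Y}\, M_p(1,1,1)^{\mathsf{Y}(k-1)}\times\mathbb{Z}_{p^n}\times\mathbb{Z}_p^{\,r-2}$; - $M_p(n+1,1,1)\,\mathsf{Y}\, M_p(1,1,1)^{\mathsf{Y}(k-1)}\,\mathsf{Y}\,\mathbb{Z}_{p^m}\times\mathbb{Z}_p^{\,r-2}$; - $M_p(1,1,1)^{\mathsf{Y}k}\,\mathsf{Y}\,\mathbb{Z}_{p^m}\times\mathbb{Z}_{p^n}\times\mathbb{Z}_p^{\,r-2}$. (4) For type $A_2$ with $c\in\langle z_1\rangle$, the isomorphism types of $G$ are: - $M_p(m+1,1,1)\,\mathsf{Y}\, M_p(1,1,1)^{\mathsf{Y}(k-1)}\,\mathsf{Y}\,\mathbb{Z}_{p^{n+1}}\times\mathbb{Z}_p^{\,r-2}$; - $M_p(1,1,1)^{\mathsf{Y}k}\,\mathsf{Y}\,\mathbb{Z}_{p^{n+1}}\times\mathbb{Z}_{p^m}\times\mathbb{Z}_p^{\,r-2}$. (5) For type $A_2$ with $c\in\langle z_2\rangle$, the isomorphism types of $G$ are: - $M_p(m+1,1)\,\mathsf{Y}\, M_p(1,1,1)^{\mathsf{Y}(k-1)}\times\mathbb{Z}_{p^{n+1}}\times\mathbb{Z}_p^{\,r-2}$; - $M_p(1,1,1)^{\mathsf{Y}k}\,\mathsf{Y}\,\mathbb{Z}_{p^m}\times\mathbb{Z}_{p^{n+1}}\times\mathbb{Z}_p^{\,r-2}$.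 (6) For type $A_3$ with $c\in\langle z_1\rangle$, the isomorphism types of $G$ are: - $M_p(n+1,1)\,\mathsf{Y}\, M_p(1,1,1)^{\mathsf{Y}(k-1)}\times\mathbb{Z}_{p^{m+1}}\times\mathbb{Z}_p^{\,r-2}$; - $M_p(1,1,1)^{\mathsf{Y}k}\,\mathsf{Y}\,\mathbb{Z}_{p^n}\times\mathbb{Z}_{p^{m+1}}\times\mathbb{Z}_p^{\,r-2}$. (7) For type $A_3$ with $c\in\langle z_2\rangle$, the isomorphism types of $G$ are: - $M_p(n+1,1,1)\,\mathsf{Y}\, M_p(1,1,1)^{\mathsf{Y}(k-1)}\,\mathsf{Y}\,\mathbb{Z}_{p^{m+1}}\times\mathbb{Z}_p^{\,r-2}$; - $M_p(1,1,1)^{\mathsf{Y}k}\,\mathsf{Y}\,\mathbb{Z}_{p^{m+1}}\times\mathbb{Z}_{p^n}\times\mathbb{Z}_p^{\,r-2}$. (8) For type $A_4$, the isomorphism type of $G$ is $$M_p(1,1,1)^{\mathsf{Y}k}\,\mathsf{Y}\,(\mathbb{Z}_{p^{n+1}}\times\mathbb{Z}_{p^{m+1}})\times\mathbb{Z}_p^{\,r-2}.$$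
   Context: $\zeta G$ is the center and $G'$ the derived subgroup of $G$; $d(H)$ is the minimal number of generators of $H$; $\mathbb{Z}_q$ is the cyclic group of order $q$. $M_p(u,v)=\langle a,b\mid a^{p^u}=b^{p^v}=1,\ a^b=a^{1+p^{u-1}}\rangle$ for $u\ge2,\ v\ge1$. $M_p(u,v,1)=\langle a,b,c\mid a^{p^u}=b^{p^v}=c^p=1,\ [a,b]=c,\ [c,a]=[c,b]=1\rangle$ for $u\ge v\ge1$. Central product: $G=H\,\mathsf{Y}\,K$ means $H,K\le G$, $G=HK$ and $[H,K]=1$. In the listed isomorphism types the central products are those in which the amalgamated subgroup has order exactly $p$: the derived subgroups (of order $p$) of all nonabelian factors are identified with one another, and if an abelian factor $\mathbb{Z}_{p^a}$ (respectively $\mathbb{Z}_{p^{n+1}}\times\mathbb{Z}_{p^{m+1}}$) is joined by $\mathsf{Y}$, its subgroup of order $p$ (respectively a subgroup of order $p$ of it) is identified with this common derived subgroup. An empty central or direct product is omitted. Expressions are read from left to right, so e.g. $X\,\mathsf{Y}\,\mathbb{Z}_{p^a}\times\mathbb{Z}_{p^b}$ means $(X\,\mathsf{Y}\,\mathbb{Z}_{p^a})\times\mathbb{Z}_{p^b}$. *)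

theory Defs
  imports "HOL-Algebra.Algebra" "HOL-Computational_Algebra.Primes"
begin

section \<open>Groups given by generators and relations\<close>

text \<open>Words over a type of generators: the letter \<open>(x, True)\<close> stands for \<open>x\<close>, the letter
  \<open>(x, False)\<close> for its formal inverse.\<close>

type_synonym 'x word = "('x \<times> bool) list"

definition gen :: "'x \<Rightarrow> 'x word" where
  "gen x = [(x, True)]"

definition word_inv :: "'x word \<Rightarrow> 'x word" where
  "word_inv w = rev (map (\<lambda>(x, e). (x, \<not> e)) w)"

definition word_pow :: "'x word \<Rightarrow> nat \<Rightarrow> 'x word" where
  "word_pow w n = concat (replicate n w)"

definition word_conj :: "'x word \<Rightarrow> 'x word \<Rightarrow> 'x word" where
  "word_conj u v = word_inv v @ u @ v"

definition word_comm :: "'x word \<Rightarrow> 'x word \<Rightarrow> 'x word" where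
  "word_comm u v = word_inv u @ word_inv v @ u @ v"

inductive word_eq :: "('x word \<times> 'x word) set \<Rightarrow> 'x word \<Rightarrow> 'x word \<Rightarrow> bool"
  for R where
  refl: "word_eq R w w"
| sym: "word_eq R u v \<Longrightarrow> word_eq R v u"
| trans: "word_eq R u v \<Longrightarrow> word_eq R v w \<Longrightarrow> word_eq R u w"
| app: "word_eq R u u' \<Longrightarrow> word_eq R v v' \<Longrightarrow> word_eq R (u @ v) (u' @ v')"
| cancel: "word_eq R [(x, e), (x, \<not> e)] []"
| rel: "(u, v) \<in> R \<Longrightarrow> word_eq R u v"

definition word_class :: "('x word \<times> 'x word) set \<Rightarrow> 'x word \<Rightarrow> 'x word set" where
  "word_class R w = {v. word_eq R w v}"

text \<open>The group whose generators are all elements of the type \<open>'x\<close>, subject to the relations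
  \<open>u = v\<close> for \<open>(u, v) \<in> R\<close>.\<close>

definition presented_group :: "('x word \<times> 'x word) set \<Rightarrow> 'x word set monoid" where
  "presented_group R =
     \<lparr>carrier = range (word_class R),
      monoid.mult = (\<lambda>A B. {w. \<exists>u\<in>A. \<exists>v\<in>B. word_eq R (u @ v) w}),
      monoid.one = word_class R []\<rparr>"

lemma word_class_eq_iff: "word_class R u = word_class R v \<longleftrightarrow> word_eq R u v"
  unfolding word_class_def using word_eq.refl word_eq.sym word_eq.trans by blast

lemma mult_presented_group:
  "word_class R u \<otimes>\<^bsub>presented_group R\<^esub> word_class R v = word_class R (u @ v)"
  unfolding presented_group_def word_class_def
  by (auto intro: word_eq.refl word_eq.trans word_eq.app word_eq.sym)

lemma word_eq_inv_left: "word_eq R (word_inv w @ w) []"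
proof (induction w)
  case Nil
  then show ?case by (simp add: word_inv_def word_eq.refl)
next
  case (Cons l w)
  obtain x e where l: "l = (x, e)" by force
  have "word_eq R [(x, \<not> e), (x, e)] []"
    using word_eq.cancel[of R x "\<not> e"] by simp
  then have "word_eq R (word_inv w @ [(x, \<not> e), (x, e)] @ w) (word_inv w @ [] @ w)"
    by (intro word_eq.app word_eq.refl)
  then show ?case
    using Cons by (auto simp: l word_inv_def intro: word_eq.trans)
qed

lemma group_presented_group: "group (presented_group R)"
proof (rule groupI)
  fix x assume "x \<in> carrier (presented_group R)"
  then obtain w where w: "x = word_class R w"
    by (auto simp: presented_group_def)
  have one: "\<one>\<^bsub>presented_group R\<^esub> = word_class R []"
    by (simp add: presented_group_def)
  show "\<one>\<^bsub>presented_group R\<^esub> \<otimes>\<^bsub>presented_group R\<^esub> x = x"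
    by (simp add: w one mult_presented_group)
  have "word_class R (word_inv w) \<otimes>\<^bsub>presented_group R\<^esub> x = \<one>\<^bsub>presented_group R\<^esub>"
    by (simp add: w one mult_presented_group word_class_eq_iff word_eq_inv_left)
  moreover have "word_class R (word_inv w) \<in> carrier (presented_group R)"
    by (simp add: presented_group_def)
  ultimately show "\<exists>y\<in>carrier (presented_group R).
      y \<otimes>\<^bsub>presented_group R\<^esub> x = \<one>\<^bsub>presented_group R\<^esub>" by blast
next
  fix x y assume "x \<in> carrier (presented_group R)" "y \<in> carrier (presented_group R)"
  then obtain u v where "x = word_class R u" "y = word_class R v"
    by (auto simp: presented_group_def)
  then have "x \<otimes>\<^bsub>presented_group R\<^esub> y = word_class R (u @ v)"
    by (simp add: mult_presented_group)
  then show "x \<otimes>\<^bsub>presented_group R\<^esub> y \<in> carrier (presented_group R)"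
    by (simp add: presented_group_def)
next
  fix x y z
  assume "x \<in> carrier (presented_group R)" "y \<in> carrier (presented_group R)"
    "z \<in> carrier (presented_group R)"
  then obtain u v w where "x = word_class R u" "y = word_class R v" "z = word_class R w"
    by (auto simp: presented_group_def)
  then show "x \<otimes>\<^bsub>presented_group R\<^esub> y \<otimes>\<^bsub>presented_group R\<^esub> z =
      x \<otimes>\<^bsub>presented_group R\<^esub> (y \<otimes>\<^bsub>presented_group R\<^esub> z)"
    by (simp add: mult_presented_group)
qed (simp add: presented_group_def)

text \<open>Two generator types are needed, since every element of the type becomes a generator.\<close>

datatype two_gens = Ga | Gb
datatype three_gens = Ha | Hb | Hc

text \<open>\<open>M\<^sub>p(u,v) = \<langle>a, b | a^(p^u) = b^(p^v) = 1, a^b = a^(1 + p^(u-1))\<rangle>\<close>, meant for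
  \<open>u \<ge> 2\<close>, \<open>v \<ge> 1\<close>.\<close>

definition M2 :: "nat \<Rightarrow> nat \<Rightarrow> nat \<Rightarrow> two_gens word set monoid" where
  "M2 p u v = presented_group
     {(word_pow (gen Ga) (p ^ u), []),
      (word_pow (gen Gb) (p ^ v), []),
      (word_conj (gen Ga) (gen Gb), word_pow (gen Ga) (1 + p ^ (u - 1)))}"

text \<open>\<open>M\<^sub>p(u,v,1) = \<langle>a, b, c | a^(p^u) = b^(p^v) = c^p = 1, [a,b] = c, [c,a] = [c,b] = 1\<rangle>\<close>,
  meant for \<open>u \<ge> v \<ge> 1\<close>.\<close>

definition M3 :: "nat \<Rightarrow> nat \<Rightarrow> nat \<Rightarrow> three_gens word set monoid" where
  "M3 p u v = presented_group
     {(word_pow (gen Ha) (p ^ u), []),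
      (word_pow (gen Hb) (p ^ v), []),
      (word_pow (gen Hc) p, []),
      (word_comm (gen Ha) (gen Hb), gen Hc),
      (word_comm (gen Hc) (gen Ha), []),
      (word_comm (gen Hc) (gen Hb), [])}"


section \<open>Center, generator rank, internal products\<close>

definition center :: "('a, 'b) monoid_scheme \<Rightarrow> 'a set" where
  "center G = {z \<in> carrier G. \<forall>g\<in>carrier G. z \<otimes>\<^bsub>G\<^esub> g = g \<otimes>\<^bsub>G\<^esub> z}"

text \<open>The minimal number of generators (of a finitely generated group).\<close>

definition min_gens :: "('a, 'b) monoid_scheme \<Rightarrow> nat" where
  "min_gens G = (LEAST d. \<exists>S. S \<subseteq> carrier G \<and> finite S \<and> card S = d \<and> generate G S = carrier G)"

definition elem_abelian :: "nat \<Rightarrow> nat \<Rightarrow> (nat \<Rightarrow> int) monoid" where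
  "elem_abelian p s = product_group {..<s} (\<lambda>_. integer_mod_group p)"

text \<open>The subgroup \<open>A\<close> of \<open>G\<close> is the internal direct product of the family \<open>H\<close>,
  respectively of the two subgroups \<open>H\<close> and \<open>K\<close>.\<close>

definition internal_direct_product ::
  "('a, 'b) monoid_scheme \<Rightarrow> 'a set \<Rightarrow> 'i set \<Rightarrow> ('i \<Rightarrow> 'a set) \<Rightarrow> bool" where
  "internal_direct_product G A I H \<longleftrightarrow>
     subgroup A G \<and>
     (\<forall>i\<in>I. H i \<lhd> (G\<lparr>carrier := A\<rparr>)) \<and>
     generate G (\<Union>i\<in>I. H i) = A \<and>
     (\<forall>i\<in>I. H i \<inter> generate G (\<Union>j\<in>I - {i}. H j) = {\<one>\<^bsub>G\<^esub>})"

definition is_direct_product ::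
  "('a, 'b) monoid_scheme \<Rightarrow> 'a set \<Rightarrow> 'a set \<Rightarrow> 'a set \<Rightarrow> bool" where
  "is_direct_product G A H K \<longleftrightarrow>
     subgroup A G \<and> H \<lhd> (G\<lparr>carrier := A\<rparr>) \<and> K \<lhd> (G\<lparr>carrier := A\<rparr>) \<and>
     H <#>\<^bsub>G\<^esub> K = A \<and> H \<inter> K = {\<one>\<^bsub>G\<^esub>}"

definition is_central_product ::
  "('a, 'b) monoid_scheme \<Rightarrow> 'a set \<Rightarrow> 'a set \<Rightarrow> bool" where
  "is_central_product G H K \<longleftrightarrow>
     subgroup H G \<and> subgroup K G \<and> H <#>\<^bsub>G\<^esub> K = carrier G \<and>
     (\<forall>h\<in>H. \<forall>k\<in>K. h \<otimes>\<^bsub>G\<^esub> k = k \<otimes>\<^bsub>G\<^esub> h)"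

text \<open>The amalgamated subgroup \<open>H \<inter> K\<close> has order exactly \<open>p\<close>, and it is the derived subgroup
  of each nonabelian factor.\<close>

definition amalgamated :: "nat \<Rightarrow> ('a, 'b) monoid_scheme \<Rightarrow> 'a set \<Rightarrow> 'a set \<Rightarrow> bool" where
  "amalgamated p G H K \<longleftrightarrow>
     card (H \<inter> K) = p \<and>
     (\<forall>L\<in>{H, K}. derived G L \<noteq> {\<one>\<^bsub>G\<^esub>} \<longrightarrow> derived G L = H \<inter> K)"


section \<open>Isomorphism types built from central and direct products\<close>

text \<open>A central product does not determine a group from its factors alone, so an expression such as
  \<open>X Y Z \<times> W\<close> is rendered as the isomorphism-invariant property of being an internal product
  (with the stipulated amalgamation) of subgroups isomorphic to the factors.\<close>

type_synonym ('a, 'b) group_type = "('a, 'b) monoid_scheme \<Rightarrow> bool"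

definition iso_to :: "('c, 'd) monoid_scheme \<Rightarrow> ('a, 'b) group_type" where
  "iso_to K = (\<lambda>G. G \<cong> K)"

definition central_prod ::
  "nat \<Rightarrow> ('a, 'b) group_type \<Rightarrow> ('a, 'b) group_type \<Rightarrow> ('a, 'b) group_type" where
  "central_prod p P Q = (\<lambda>G. \<exists>H K. is_central_product G H K \<and> amalgamated p G H K \<and>
     P (G\<lparr>carrier := H\<rparr>) \<and> Q (G\<lparr>carrier := K\<rparr>))"

definition direct_prod ::
  "('a, 'b) group_type \<Rightarrow> ('a, 'b) group_type \<Rightarrow> ('a, 'b) group_type" where
  "direct_prod P Q = (\<lambda>G. \<exists>H K. is_direct_product G (carrier G) H K \<and>
     P (G\<lparr>carrier := H\<rparr>) \<and> Q (G\<lparr>carrier := K\<rparr>))"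

text \<open>Products of lists of factors, read from left to right; the empty product is trivial.\<close>

fun central_products :: "nat \<Rightarrow> ('a, 'b) group_type list \<Rightarrow> ('a, 'b) group_type" where
  "central_products p [] = trivial_group"
| "central_products p (P # Ps) = foldl (central_prod p) P Ps"

fun direct_products :: "('a, 'b) group_type list \<Rightarrow> ('a, 'b) group_type" where
  "direct_products [] = trivial_group"
| "direct_products (P # Ps) = foldl direct_prod P Ps"

text \<open>The factors \<open>M\<^sub>p(u,v)\<close>, \<open>M\<^sub>p(u,v,1)\<close>, \<open>\<int>\<^bsub>q\<^esub>\<close>, \<open>\<int>\<^bsub>p\<^esub>\<^bsup>s\<^esup>\<close> as isomorphism types.\<close>

definition Mp2 :: "nat \<Rightarrow> nat \<Rightarrow> nat \<Rightarrow> ('a, 'b) group_type" where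
  "Mp2 p u v = iso_to (M2 p u v)"

definition Mp3 :: "nat \<Rightarrow> nat \<Rightarrow> nat \<Rightarrow> ('a, 'b) group_type" where
  "Mp3 p u v = iso_to (M3 p u v)"

definition Cyc :: "nat \<Rightarrow> ('a, 'b) group_type" where
  "Cyc q = iso_to (integer_mod_group q)"

definition Elem :: "nat \<Rightarrow> nat \<Rightarrow> ('a, 'b) group_type" where
  "Elem p s = iso_to (elem_abelian p s)"


section \<open>The four types of the pair (center, N)\<close>

text \<open>\<open>\<zeta>G = \<langle>z\<^sub>1\<rangle> \<times> \<dots> \<times> \<langle>z\<^sub>r\<rangle> \<cong> \<int>\<^bsub>p^e\<^esub> \<times> \<int>\<^bsub>p^f\<^esub> \<times> \<int>\<^bsub>p\<^esub>\<^bsup>r-2\<^esup>\<close>, the cyclic factors being listed in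
  this order.\<close>

definition center_decomp ::
  "('a, 'b) monoid_scheme \<Rightarrow> nat \<Rightarrow> nat \<Rightarrow> nat \<Rightarrow> nat \<Rightarrow> (nat \<Rightarrow> 'a) \<Rightarrow> bool" where
  "center_decomp G p r e f z \<longleftrightarrow>
     2 \<le> r \<and> (\<forall>i\<in>{1..r}. z i \<in> carrier G) \<and>
     internal_direct_product G (center G) {1..r} (\<lambda>i. generate G {z i}) \<and>
     (G\<lparr>carrier := generate G {z 1}\<rparr>) \<cong> integer_mod_group (p ^ e) \<and>
     (G\<lparr>carrier := generate G {z 2}\<rparr>) \<cong> integer_mod_group (p ^ f) \<and>
     (\<forall>i\<in>{3..r}. (G\<lparr>carrier := generate G {z i}\<rparr>) \<cong> integer_mod_group p) \<and>
     (G\<lparr>carrier := center G\<rparr>) \<cong>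
       integer_mod_group (p ^ e) \<times>\<times> integer_mod_group (p ^ f) \<times>\<times> elem_abelian p (r - 2)"

definition type_A1 ::
  "('a, 'b) monoid_scheme \<Rightarrow> 'a set \<Rightarrow> nat \<Rightarrow> nat \<Rightarrow> nat \<Rightarrow> nat \<Rightarrow> (nat \<Rightarrow> 'a) \<Rightarrow> bool" where
  "type_A1 G N p n m r z \<longleftrightarrow> center_decomp G p r n m z \<and>
     is_direct_product G N (generate G {z 1}) (generate G {z 2})"

definition type_A2 ::
  "('a, 'b) monoid_scheme \<Rightarrow> 'a set \<Rightarrow> nat \<Rightarrow> nat \<Rightarrow> nat \<Rightarrow> nat \<Rightarrow> (nat \<Rightarrow> 'a) \<Rightarrow> bool" where
  "type_A2 G N p n m r z \<longleftrightarrow> center_decomp G p r (n + 1) m z \<and>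
     is_direct_product G N (generate G {z 1 [^]\<^bsub>G\<^esub> p}) (generate G {z 2})"

definition type_A3 ::
  "('a, 'b) monoid_scheme \<Rightarrow> 'a set \<Rightarrow> nat \<Rightarrow> nat \<Rightarrow> nat \<Rightarrow> nat \<Rightarrow> (nat \<Rightarrow> 'a) \<Rightarrow> bool" where
  "type_A3 G N p n m r z \<longleftrightarrow> center_decomp G p r n (m + 1) z \<and>
     is_direct_product G N (generate G {z 1}) (generate G {z 2 [^]\<^bsub>G\<^esub> p})"

definition type_A4 ::
  "('a, 'b) monoid_scheme \<Rightarrow> 'a set \<Rightarrow> nat \<Rightarrow> nat \<Rightarrow> nat \<Rightarrow> nat \<Rightarrow> (nat \<Rightarrow> 'a) \<Rightarrow> bool" where
  "type_A4 G N p n m r z \<longleftrightarrow> center_decomp G p r (n + 1) (m + 1) z \<and>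
     is_direct_product G N (generate G {z 1 [^]\<^bsub>G\<^esub> p}) (generate G {z 2 [^]\<^bsub>G\<^esub> p})"

end

theory Submission
  imports Defs
begin

text \<open>Since \<open>p\<close> is odd and \<open>G'\<close> is central of order \<open>p\<close>, commutators give a nondegenerate alternating form on
  \<open>V = G/Z(G)\<close> and \<open>g \<mapsto> g^p\<close> is a homomorphism into \<open>N\<close>. Modulo \<open>p\<close>-th powers of central elements it becomes
  a pair of linear functionals \<open>f\<^sub>1, f\<^sub>2\<close> on \<open>V\<close>, the exponents of \<open>z\<^sub>1\<close> and \<open>z\<^sub>2\<close>. By duality \<open>f\<^sub>i\<close> is the
  commutator with some \<open>u\<^sub>i\<close>, and the shape of \<open>G\<close> depends only on which \<open>f\<^sub>i\<close> vanish, whether they are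
  proportional (then a change of the basis \<open>z\<^sub>1, z\<^sub>2\<close> makes one of them vanish), and whether \<open>[u\<^sub>1, u\<^sub>2] = 1\<close>.
  The elements with \<open>f\<^sub>i \<noteq> 0\<close> and the \<open>u\<^sub>i\<close> generate one or two noncommuting pairs, which give the
  exceptional factors; both functionals vanish on the centralizer of these pairs, which
  therefore splits into pairs generating copies of \<open>M\<^sub>p(1,1,1)\<close>.\<close>

section \<open>Presented groups\<close>

text \<open>Which exceptional factor a pair produces depends on where \<open>c\<close> lies. If
  \<open>c\<close> is in \<open><z_1>\<close> and f_1 does not vanish at \<open>a\<close>, a central
  correction makes \<open>a^p\<close> generate \<open><z_1>\<close>; a partner of \<open>a\<close>
  can then be scaled until the commutator equals \<open>a^(p^e)\<close>, the relation of
  \<open>M_p(e+1,v)\<close>. If \<open>a^p\<close> generates \<open><z_2>\<close> instead, the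
  commutator is independent of \<open>a\<close> and the pair gives \<open>M_p(f+1,1,1)\<close>.
  Exchanging \<open>z_1\<close> and \<open>z_2\<close> handles \<open>c\<close> in
  \<open><z_2>\<close>.

  The factors do not determine a central product, so everything is built from subgroups of
  \<open>G\<close>. The construction maintains commuting subgroups \<open>S\<close>,
  \<open>K\<close> with \<open>S K = G\<close> and Z(K) = Z(G), and it tracks the part of Z(G) that
  \<open>S\<close> has absorbed. That part decides which central factors are still missing and
  whether they are joined through \<open>C\<close> or directly.

  The four types concern the center alone: they record which generators of \<open>N\<close> have
  central \<open>p\<close>-th roots once \<open>u\<close> is chosen well. The number
  \<open>r\<close> is controlled by the index of the group of \<open>p\<close>-th powers in the
  center.\<close>

definition word_eval :: "('a, 'b) monoid_scheme \<Rightarrow> ('x \<Rightarrow> 'a) \<Rightarrow> 'x word \<Rightarrow> 'a" where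
  "word_eval G v w = foldr (\<lambda>(x, e) g. (if e then v x else inv\<^bsub>G\<^esub> v x) \<otimes>\<^bsub>G\<^esub> g) w \<one>\<^bsub>G\<^esub>"

context group
begin

lemma word_eval_closed: "range v \<subseteq> carrier G \<Longrightarrow> word_eval G v w \<in> carrier G"
  by (induction w) (auto simp: word_eval_def image_subset_iff)

lemma word_eval_append:
  assumes "range v \<subseteq> carrier G"
  shows "word_eval G v (u @ w) = word_eval G v u \<otimes> word_eval G v w"
proof (induction u)
  case Nil
  then show ?case using word_eval_closed[OF assms] by (simp add: word_eval_def)
next
  case (Cons l u)
  have [simp]: "v x \<in> carrier G" for x using assms by auto
  show ?case using Cons word_eval_closed[OF assms]
    by (cases l) (auto simp: word_eval_def m_assoc)
qed

lemma word_eval_gen: "range v \<subseteq> carrier G \<Longrightarrow> word_eval G v (gen x) = v x"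
  by (simp add: word_eval_def gen_def image_subset_iff)

lemma word_eval_pow:
  assumes "range v \<subseteq> carrier G"
  shows "word_eval G v (word_pow w n) = word_eval G v w [^] n"
proof (induction n)
  case 0
  then show ?case by (simp add: word_pow_def word_eval_def)
next
  case (Suc n)
  have "word_pow w (Suc n) = word_pow w n @ w"
    by (simp only: word_pow_def replicate_Suc replicate_append_same[symmetric] concat_append) simp
  then show ?case using Suc word_eval_append[OF assms] by simp
qed

lemma word_eval_inv:
  assumes "range v \<subseteq> carrier G"
  shows "word_eval G v (word_inv w) = inv (word_eval G v w)"
proof (induction w)
  case Nil
  then show ?case by (simp add: word_inv_def word_eval_def)
next
  case (Cons l w)
  obtain x e where l: "l = (x, e)" by force
  have [simp]: "v x \<in> carrier G" for x using assms by auto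
  note cl = word_eval_closed[OF assms]
  have 1: "word_eval G v [(x, \<not> e)] = inv (word_eval G v [(x, e)])"
    by (simp add: word_eval_def)
  have "word_eval G v (word_inv (l # w)) = word_eval G v (word_inv w) \<otimes> word_eval G v [(x, \<not> e)]"
    by (simp add: word_inv_def l flip: word_eval_append[OF assms])
  also have "\<dots> = inv (word_eval G v [(x, e)] \<otimes> word_eval G v w)"
    unfolding 1 Cons by (simp add: inv_mult_group cl)
  finally show ?case by (simp add: l flip: word_eval_append[OF assms])
qed

lemma word_eval_cong:
  assumes "word_eq R u w" "range v \<subseteq> carrier G"
    and "\<And>l r. (l, r) \<in> R \<Longrightarrow> word_eval G v l = word_eval G v r"
  shows "word_eval G v u = word_eval G v w"
  using assms(1)
proof induction
  case (app u u' w w')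
  then show ?case by (simp add: word_eval_append[OF assms(2)])
next
  case (cancel x e)
  have [simp]: "v x \<in> carrier G" for x using assms by auto
  show ?case by (simp add: word_eval_def)
qed (use assms(3) in auto)

text \<open>The last hypothesis is triviality of the kernel of the induced map: a word that dies in
  \<open>G\<close> is already killed by the relations. Normal forms of words supply it for the two
  families of presentations.\<close>

lemma iso_presented_group:
  assumes v: "range v \<subseteq> carrier G" and gen: "carrier G = generate G (range v)"
    and rel: "\<And>l r. (l, r) \<in> R \<Longrightarrow> word_eval G v l = word_eval G v r"
    and inj: "\<And>w. word_eval G v w = \<one> \<Longrightarrow> word_eq R w []"
  shows "G \<cong> presented_group R"
proof -
  interpret P: group "presented_group R" by (rule group_presented_group)
  define f where "f A = word_eval G v (SOME w. w \<in> A)" for A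
  have f: "f (word_class R w) = word_eval G v w" for w
  proof -
    have "(SOME u. u \<in> word_class R w) \<in> word_class R w"
      by (rule someI[of _ w]) (simp add: word_class_def word_eq.refl)
    then have "word_eq R w (SOME u. u \<in> word_class R w)" by (simp add: word_class_def)
    from word_eval_cong[OF this v rel] show ?thesis by (simp add: f_def)
  qed
  have car: "carrier (presented_group R) = range (word_class R)"
    by (simp add: presented_group_def)
  have hom: "f \<in> hom (presented_group R) G"
    by (rule homI) (auto simp: car f word_eval_closed[OF v] mult_presented_group
        word_eval_append[OF v])
  interpret f: group_hom "presented_group R" G f
    by unfold_locales (rule hom)
  have "v x \<in> f ` carrier (presented_group R)" for x
    by (auto simp: car image_image f intro!: image_eqI[of _ _ "gen x"] word_eval_gen[OF v, symmetric])
  then have "generate G (range v) \<subseteq> f ` carrier (presented_group R)"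
    by (intro generate_subgroup_incl f.img_is_subgroup) auto
  then have surj: "f ` carrier (presented_group R) = carrier G"
    using gen f.img_is_subgroup subgroup.subset by blast
  have one: "\<one>\<^bsub>presented_group R\<^esub> = word_class R []"
    by (simp add: presented_group_def)
  have "inj_on f (carrier (presented_group R))"
    unfolding f.inj_on_one_iff
  proof (intro allI impI)
    fix x assume "x \<in> carrier (presented_group R)" "f x = \<one>"
    then obtain w where "x = word_class R w" "word_eval G v w = \<one>" by (auto simp: car f)
    then show "x = \<one>\<^bsub>presented_group R\<^esub>" using inj[of w] by (simp only: one word_class_eq_iff)
  qed
  then have "f \<in> iso (presented_group R) G"
    using hom surj by (simp add: iso_def bij_betw_def)
  then show ?thesis using P.iso_sym is_isoI by blast
qed

lemma pow_mult_swap: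
  fixes t :: nat
  assumes [simp]: "a \<in> carrier G" "b \<in> carrier G" and "a \<otimes> b = b \<otimes> a [^] t"
  shows "a [^] (i::nat) \<otimes> b = b \<otimes> a [^] (t * i)"
proof (induction i)
  case (Suc i)
  have "a [^] Suc i \<otimes> b = a [^] i \<otimes> (a \<otimes> b)" by (simp add: m_assoc)
  also have "\<dots> = (a [^] i \<otimes> b) \<otimes> a [^] t" by (simp add: assms m_assoc)
  also have "\<dots> = b \<otimes> a [^] (t * Suc i)" by (simp add: Suc m_assoc nat_pow_mult add.commute)
  finally show ?case .
qed simp

lemma inv_eq_pow:
  assumes "a \<in> carrier G" "a [^] n = \<one>" "n > (0::nat)"
  shows "inv a = a [^] (n - 1)"
proof (rule inv_equality)
  show "a [^] (n - 1) \<otimes> a = \<one>" using assms(2,3) nat_pow_Suc[of a "n - 1"] by simp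
qed (use assms(1) in auto)

end

section \<open>Computing in presented groups: normal forms of words and recognition of
  \<open>M2\<close> and \<open>M3\<close>\<close>

lemma word_class_append:
  "word_class R (u @ w) = word_class R u \<otimes>\<^bsub>presented_group R\<^esub> word_class R w"
  by (simp add: mult_presented_group)

text \<open>Turns equality of words modulo \<open>R\<close> into computation inside the group
  \<open>presented_group R\<close>, which replaces explicit derivations in
  \<open>word_eq\<close>.\<close>

lemma word_class_eval: "word_class R w = word_eval (presented_group R) (\<lambda>x. word_class R (gen x)) w"
proof (induction w)
  case Nil
  then show ?case by (simp add: word_eval_def presented_group_def)
next
  case (Cons l w)
  interpret P: group "presented_group R" by (rule group_presented_group)
  have car: "carrier (presented_group R) = range (word_class R)"
    by (simp add: presented_group_def)
  obtain x e where l: "l = (x, e)" by force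
  have one: "\<one>\<^bsub>presented_group R\<^esub> = word_class R []"
    by (simp add: presented_group_def)
  have "word_class R [(x, False)] = inv\<^bsub>presented_group R\<^esub> word_class R (gen x)"
    by (rule P.inv_equality[symmetric])
      (simp_all add: car rangeI gen_def one mult_presented_group word_class_eq_iff
        word_eq.cancel[of R x False, simplified])
  then have "word_class R [l] = (if e then word_class R (gen x) else inv\<^bsub>presented_group R\<^esub> word_class R (gen x))"
    by (simp add: l gen_def)
  then show ?case
    using word_class_append[of R "[l]" w] Cons by (simp add: word_eval_def l)
qed

lemma word_eval_relation:
  assumes "(l, r) \<in> R"
  shows "word_eval (presented_group R) (\<lambda>x. word_class R (gen x)) l =
    word_eval (presented_group R) (\<lambda>x. word_class R (gen x)) r"
  unfolding word_class_eval[symmetric] word_class_eq_iff using assms by (rule word_eq.rel)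

lemma range_word_class: "range (\<lambda>x. word_class R (gen x)) \<subseteq> carrier (presented_group R)"
  by (auto simp: presented_group_def)

text \<open>Each new letter is absorbed at the right end: a power of \<open>v Ga\<close> joins the
  last block, and a \<open>v Gb\<close> moves left past that block at the cost of multiplying its
  exponent by \<open>q\<close>. Positivity of \<open>s\<close> and \<open>t\<close> allows an
  inverse letter to be rewritten as a nonnegative power.\<close>

lemma (in group) word_eval_normal_form2:
  fixes v :: "two_gens \<Rightarrow> 'a" and s t :: nat
  assumes v: "range v \<subseteq> carrier G" and "s > 0" "t > 0"
    and ab: "v Ga [^] s = \<one>" "v Gb [^] t = \<one>" "v Ga \<otimes> v Gb = v Gb \<otimes> v Ga [^] (q::nat)"
  shows "\<exists>(j::nat) i::nat. word_eval G v w = v Gb [^] j \<otimes> v Ga [^] i"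
proof (induction w rule: rev_induct)
  case Nil
  show ?case by (intro exI[of _ 0]) (simp add: word_eval_def)
next
  case (snoc l w)
  have [simp]: "v x \<in> carrier G" for x using v by auto
  define NF where "NF = {v Gb [^] j \<otimes> v Ga [^] i | (j::nat) i::nat. True}"
  have a: "x \<otimes> v Ga [^] (k::nat) \<in> NF" if "x \<in> NF" for x k
    using that by (force simp: NF_def m_assoc nat_pow_mult)
  have b1: "x \<otimes> v Gb \<in> NF" if x: "x \<in> NF" for x
  proof -
    obtain j i :: nat where "x = v Gb [^] j \<otimes> v Ga [^] i" using x by (auto simp: NF_def)
    then have "x \<otimes> v Gb = v Gb [^] j \<otimes> (v Gb \<otimes> v Ga [^] (q * i))"
      by (simp add: m_assoc pow_mult_swap[OF _ _ ab(3)])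
    also have "\<dots> = v Gb [^] Suc j \<otimes> v Ga [^] (q * i)" by (simp add: m_assoc)
    finally show ?thesis unfolding NF_def by blast
  qed
  have b: "x \<otimes> v Gb [^] (k::nat) \<in> NF" if x: "x \<in> NF" for x k
  proof (induction k)
    case 0
    have "x \<in> carrier G" using x by (auto simp: NF_def)
    then show ?case using x by simp
  next
    case (Suc k)
    have "x \<in> carrier G" using x by (auto simp: NF_def)
    then show ?case using b1[OF Suc] by (simp add: m_assoc)
  qed
  have "word_eval G v w \<in> NF" using snoc by (auto simp: NF_def)
  moreover have "\<exists>g k. word_eval G v [l] = v g [^] (k::nat)"
  proof -
    obtain g e where l: "l = (g, e)" by force
    have "\<exists>k::nat. inv (v g) = v g [^] k"
      using inv_eq_pow[of "v Ga", OF _ ab(1) \<open>s > 0\<close>] inv_eq_pow[of "v Gb", OF _ ab(2) \<open>t > 0\<close>]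
      by (cases g) auto
    then obtain k :: nat where k: "inv (v g) = v g [^] k" by blast
    have "word_eval G v [l] = v g [^] (if e then 1 else k)" by (simp add: l word_eval_def k)
    then show ?thesis by blast
  qed
  then obtain g k where "word_eval G v [l] = v g [^] (k::nat)" by blast
  ultimately have "word_eval G v (w @ [l]) \<in> NF"
    using a b by (cases g) (auto simp: word_eval_append[OF v])
  then show ?case by (auto simp: NF_def)
qed

text \<open>The same absorption with three blocks. Moving \<open>v Hb\<close> left past the
  \<open>i\<close>-th power of \<open>v Ha\<close> leaves the \<open>i\<close>-th power of
  \<open>v Hc\<close> behind, and \<open>v Hc\<close> commutes with both other generators.\<close>

lemma (in group) word_eval_normal_form3:
  fixes v :: "three_gens \<Rightarrow> 'a" and s t r :: nat
  assumes v: "range v \<subseteq> carrier G" and "s > 0" "t > 0" "r > 0"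
    and ab: "v Ha [^] s = \<one>" "v Hb [^] t = \<one>" "v Hc [^] r = \<one>"
      "v Ha \<otimes> v Hb = v Hb \<otimes> v Ha \<otimes> v Hc"
      "v Hc \<otimes> v Ha = v Ha \<otimes> v Hc" "v Hc \<otimes> v Hb = v Hb \<otimes> v Hc"
  shows "\<exists>(j::nat) (i::nat) k::nat. word_eval G v w = v Hb [^] j \<otimes> v Ha [^] i \<otimes> v Hc [^] k"
proof (induction w rule: rev_induct)
  case Nil
  show ?case by (intro exI[of _ 0]) (simp add: word_eval_def)
next
  case (snoc l w)
  have [simp]: "v x \<in> carrier G" for x using v by auto
  define NF where "NF = {v Hb [^] j \<otimes> v Ha [^] i \<otimes> v Hc [^] k | (j::nat) (i::nat) k::nat. True}"
  have NFc: "x \<in> carrier G" if "x \<in> NF" for x using that by (auto simp: NF_def)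
  have ca: "v Hc [^] (k::nat) \<otimes> v Ha = v Ha \<otimes> v Hc [^] k" for k
    using pow_mult_swap[of "v Hc" "v Ha" 1 k] ab(5) by simp
  have cb: "v Hc [^] (k::nat) \<otimes> v Hb = v Hb \<otimes> v Hc [^] k" for k
    using pow_mult_swap[of "v Hc" "v Hb" 1 k] ab(6) by simp
  have bswap: "v Ha [^] (i::nat) \<otimes> v Hb = v Hb \<otimes> v Ha [^] i \<otimes> v Hc [^] i" for i
  proof (induction i)
    case (Suc i)
    have "v Ha [^] Suc i \<otimes> v Hb = v Ha [^] i \<otimes> v Hb \<otimes> v Ha \<otimes> v Hc"
      by (simp add: m_assoc ab(4))
    also have "\<dots> = v Hb \<otimes> v Ha [^] i \<otimes> (v Hc [^] i \<otimes> v Ha) \<otimes> v Hc"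
      by (simp add: Suc m_assoc)
    also have "\<dots> = v Hb \<otimes> v Ha [^] Suc i \<otimes> v Hc [^] Suc i" by (simp add: ca m_assoc)
    finally show ?case .
  qed simp
  have step: "x \<otimes> v g \<in> NF" if x: "x \<in> NF" for x g
  proof -
    obtain j i k :: nat where x: "x = v Hb [^] j \<otimes> v Ha [^] i \<otimes> v Hc [^] k"
      using x by (auto simp: NF_def)
    show ?thesis
    proof (cases g)
      case Ha
      then have "x \<otimes> v g = v Hb [^] j \<otimes> v Ha [^] Suc i \<otimes> v Hc [^] k"
        by (simp add: x m_assoc ca)
      then show ?thesis unfolding NF_def by blast
    next
      case Hc
      then have "x \<otimes> v g = v Hb [^] j \<otimes> v Ha [^] i \<otimes> v Hc [^] Suc k"
        by (simp add: x m_assoc)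
      then show ?thesis unfolding NF_def by blast
    next
      case Hb
      then have "x \<otimes> v g = v Hb [^] j \<otimes> (v Ha [^] i \<otimes> v Hb) \<otimes> v Hc [^] k"
        by (simp add: x m_assoc cb)
      also have "\<dots> = v Hb [^] Suc j \<otimes> v Ha [^] i \<otimes> v Hc [^] (i + k)"
        by (simp add: bswap m_assoc nat_pow_mult)
      finally show ?thesis unfolding NF_def by blast
    qed
  qed
  have steps: "x \<otimes> v g [^] (k::nat) \<in> NF" if x: "x \<in> NF" for x g k
  proof (induction k)
    case 0
    then show ?case using x NFc[OF x] by simp
  next
    case (Suc k)
    then show ?case using step[OF Suc, of g] NFc[OF x] by (simp add: m_assoc)
  qed
  have "word_eval G v w \<in> NF" using snoc by (auto simp: NF_def)
  moreover have "\<exists>g k. word_eval G v [l] = v g [^] (k::nat)"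
  proof -
    obtain g e where l: "l = (g, e)" by force
    have "\<exists>k::nat. inv (v g) = v g [^] k"
      using inv_eq_pow[of "v Ha", OF _ ab(1) \<open>s > 0\<close>] inv_eq_pow[of "v Hb", OF _ ab(2) \<open>t > 0\<close>]
        inv_eq_pow[of "v Hc", OF _ ab(3) \<open>r > 0\<close>]
      by (cases g) auto
    then obtain k :: nat where k: "inv (v g) = v g [^] k" by blast
    have "word_eval G v [l] = v g [^] (if e then 1 else k)" by (simp add: l word_eval_def k)
    then show ?thesis by blast
  qed
  then obtain g k where "word_eval G v [l] = v g [^] (k::nat)" by blast
  ultimately have "word_eval G v (w @ [l]) \<in> NF"
    using steps by (simp add: word_eval_append[OF v])
  then show ?case by (auto simp: NF_def)
qed

text \<open>Every word equals some \<open>b^j a^i\<close> in the presented group. If its value in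
  \<open>G\<close> is trivial, \<open>indep\<close> makes both exponents multiples of the orders
  imposed by the relations, so the word is trivial in the presented group as well. The order of
  \<open>M2 p u v\<close> is never computed.\<close>

lemma (in group) iso_M2:
  assumes "p > 0" and [simp]: "a \<in> carrier G" "b \<in> carrier G"
    and gen: "carrier G = generate G {a, b}"
    and "a [^] (p ^ u) = \<one>" "b [^] (p ^ v) = \<one>" "a \<otimes> b = b \<otimes> a [^] (1 + p ^ (u - 1))"
    and indep: "\<And>i j. b [^] (j::nat) \<otimes> a [^] (i::nat) = \<one> \<Longrightarrow> p ^ u dvd i \<and> p ^ v dvd j"
  shows "G \<cong> M2 p u v"
proof -
  define R where "R = {(word_pow (gen Ga) (p ^ u), []), (word_pow (gen Gb) (p ^ v), []),
      (word_conj (gen Ga) (gen Gb), word_pow (gen Ga) (1 + p ^ (u - 1)))}"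
  define h where "h x = (case x of Ga \<Rightarrow> a | Gb \<Rightarrow> b)" for x
  have h[simp]: "h Ga = a" "h Gb = b" by (simp_all add: h_def)
  have v: "range h \<subseteq> carrier G" by (auto simp: h_def split: two_gens.split)
  have "UNIV = {Ga, Gb}" using two_gens.exhaust by auto
  then have rh: "range h = {a, b}" by (metis h image_insert image_empty)
  interpret P: group "presented_group R" by (rule group_presented_group)
  let ?P = "presented_group R"
  let ?v = "\<lambda>x. word_class R (gen x)"
  note pv = range_word_class[of R]
  have e1: "word_eval ?P ?v [] = \<one>\<^bsub>?P\<^esub>" by (simp add: word_eval_def)
  note ev = P.word_eval_append[OF pv] P.word_eval_inv[OF pv]
      P.word_eval_gen[OF pv] P.word_eval_pow[OF pv] e1
  note relR = word_eval_relation[of _ _ R]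
  have Rm: "(word_pow (gen Ga) (p ^ u), []) \<in> R" "(word_pow (gen Gb) (p ^ v), []) \<in> R"
    "(word_conj (gen Ga) (gen Gb), word_pow (gen Ga) (1 + p ^ (u - 1))) \<in> R"
    by (simp_all add: R_def)
  have [simp]: "?v x \<in> carrier ?P" for x using pv by auto
  have conj: "inv\<^bsub>?P\<^esub> ?v Gb \<otimes>\<^bsub>?P\<^esub> (?v Ga \<otimes>\<^bsub>?P\<^esub> ?v Gb) = ?v Ga [^]\<^bsub>?P\<^esub> (1 + p ^ (u - 1))"
    using relR[OF Rm(3)] unfolding word_conj_def ev by (simp add: P.m_assoc)
  have r1: "?v Ga [^]\<^bsub>?P\<^esub> (p ^ u) = \<one>\<^bsub>?P\<^esub>"
    using relR[OF Rm(1)]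
    unfolding ev by simp
  have r2: "?v Gb [^]\<^bsub>?P\<^esub> (p ^ v) = \<one>\<^bsub>?P\<^esub>"
    using relR[OF Rm(2)]
    unfolding ev by simp
  have r3: "?v Ga \<otimes>\<^bsub>?P\<^esub> ?v Gb = ?v Gb \<otimes>\<^bsub>?P\<^esub> ?v Ga [^]\<^bsub>?P\<^esub> (1 + p ^ (u - 1))"
    by (subst conj[symmetric]) (simp add: P.m_assoc[symmetric])
  have rel: "word_eval G h l = word_eval G h r" if "(l, r) \<in> R" for l r
  proof -
    have 1: "word_eval G h [] = \<one>" by (simp add: word_eval_def)
    have "inv b \<otimes> (a \<otimes> b) = a [^] (1 + p ^ (u - 1))"
      unfolding assms(7) by (simp add: m_assoc[symmetric])
    then show ?thesis using that unfolding R_def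
      by (auto simp: word_eval_pow[OF v] word_eval_gen[OF v] 1 assms(5,6) word_conj_def
          word_eval_append[OF v] word_eval_inv[OF v])
  qed
  have "G \<cong> presented_group R"
  proof (rule iso_presented_group[OF v])
    show "carrier G = generate G (range h)" by (simp add: gen rh)
    show "word_eval G h l = word_eval G h r" if "(l, r) \<in> R" for l r using rel that .
    show "word_eq R w []" if w: "word_eval G h w = \<one>" for w
    proof -
      obtain i j :: nat where "word_eval ?P ?v w = ?v Gb [^]\<^bsub>?P\<^esub> j \<otimes>\<^bsub>?P\<^esub> ?v Ga [^]\<^bsub>?P\<^esub> i"
        using P.word_eval_normal_form2[OF pv _ _ r1 r2 r3, of w] \<open>p > 0\<close> by auto
      also have "\<dots> = word_eval ?P ?v (word_pow (gen Gb) j @ word_pow (gen Ga) i)"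
        by (simp only: P.word_eval_append[OF pv] P.word_eval_pow[OF pv] P.word_eval_gen[OF pv])
      finally have eq: "word_eq R w (word_pow (gen Gb) j @ word_pow (gen Ga) i)"
        unfolding word_class_eval[symmetric] word_class_eq_iff .
      have "b [^] j \<otimes> a [^] i = \<one>"
        using word_eval_cong[OF eq v rel] w
        by (simp add: word_eval_append[OF v] word_eval_pow[OF v] word_eval_gen[OF v])
      then obtain i' j' where "i = p ^ u * i'" "j = p ^ v * j'" using indep by (meson dvdE)
      then have "word_eval ?P ?v (word_pow (gen Gb) j @ word_pow (gen Ga) i) = word_eval ?P ?v []"
        by (simp add: P.word_eval_append[OF pv] P.word_eval_pow[OF pv] P.word_eval_gen[OF pv] e1
            P.nat_pow_pow[symmetric] r1 r2)
      then show ?thesis using eq unfolding word_class_eval[symmetric] word_class_eq_iff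
        by (rule word_eq.trans[rotated])
    qed
  qed
  then show ?thesis unfolding M2_def R_def .
qed

lemma (in group) iso_M3:
  assumes "p > 0" and [simp]: "a \<in> carrier G" "b \<in> carrier G" "c \<in> carrier G"
    and gen: "carrier G = generate G {a, b, c}"
    and rels: "a [^] (p ^ u) = \<one>" "b [^] (p ^ v) = \<one>" "c [^] p = \<one>"
      "a \<otimes> b = b \<otimes> a \<otimes> c" "c \<otimes> a = a \<otimes> c" "c \<otimes> b = b \<otimes> c"
    and indep: "\<And>i j k. b [^] (j::nat) \<otimes> a [^] (i::nat) \<otimes> c [^] (k::nat) = \<one> \<Longrightarrow>
      p ^ u dvd i \<and> p ^ v dvd j \<and> p dvd k"
  shows "G \<cong> M3 p u v"
proof -
  define R where "R = {(word_pow (gen Ha) (p ^ u), []), (word_pow (gen Hb) (p ^ v), []),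
      (word_pow (gen Hc) p, []), (word_comm (gen Ha) (gen Hb), gen Hc),
      (word_comm (gen Hc) (gen Ha), []), (word_comm (gen Hc) (gen Hb), [])}"
  define h where "h x = (case x of Ha \<Rightarrow> a | Hb \<Rightarrow> b | Hc \<Rightarrow> c)" for x
  have h[simp]: "h Ha = a" "h Hb = b" "h Hc = c" by (simp_all add: h_def)
  have v: "range h \<subseteq> carrier G" by (auto simp: h_def split: three_gens.split)
  have "UNIV = {Ha, Hb, Hc}" using three_gens.exhaust by auto
  then have rh: "range h = {a, b, c}" by (metis h image_insert image_empty)
  interpret P: group "presented_group R" by (rule group_presented_group)
  let ?P = "presented_group R"
  let ?v = "\<lambda>x. word_class R (gen x)"
  note pv = range_word_class[of R]
  have e1: "word_eval ?P ?v [] = \<one>\<^bsub>?P\<^esub>" by (simp add: word_eval_def)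
  note ev = P.word_eval_append[OF pv] P.word_eval_inv[OF pv]
      P.word_eval_gen[OF pv] P.word_eval_pow[OF pv] e1
  note relR = word_eval_relation[of _ _ R]
  have Rm: "(word_pow (gen Ha) (p ^ u), []) \<in> R" "(word_pow (gen Hb) (p ^ v), []) \<in> R"
    "(word_pow (gen Hc) p, []) \<in> R" "(word_comm (gen Ha) (gen Hb), gen Hc) \<in> R"
    "(word_comm (gen Hc) (gen Ha), []) \<in> R" "(word_comm (gen Hc) (gen Hb), []) \<in> R"
    by (simp_all add: R_def)
  have [simp]: "?v x \<in> carrier ?P" for x using pv by auto
  \<comment> \<open>Turns a relator of the form x^-1 y^-1 x y = z into the rewriting rule x y = y x
    z that the normal form requires.\<close>
  have comm: "x \<otimes>\<^bsub>?P\<^esub> y = y \<otimes>\<^bsub>?P\<^esub> (x \<otimes>\<^bsub>?P\<^esub> z)"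
    if "inv\<^bsub>?P\<^esub> x \<otimes>\<^bsub>?P\<^esub> (inv\<^bsub>?P\<^esub> y \<otimes>\<^bsub>?P\<^esub> (x \<otimes>\<^bsub>?P\<^esub> y)) = z"
      "x \<in> carrier ?P" "y \<in> carrier ?P" for x y z
    using that by (auto simp: P.inv_solve_left' P.m_assoc[symmetric])
  have r1: "?v Ha [^]\<^bsub>?P\<^esub> (p ^ u) = \<one>\<^bsub>?P\<^esub>"
    using relR[OF Rm(1)]
    unfolding ev by simp
  have r2: "?v Hb [^]\<^bsub>?P\<^esub> (p ^ v) = \<one>\<^bsub>?P\<^esub>"
    using relR[OF Rm(2)]
    unfolding ev by simp
  have r3: "?v Hc [^]\<^bsub>?P\<^esub> p = \<one>\<^bsub>?P\<^esub>"
    using relR[OF Rm(3)]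
    unfolding ev by simp
  have r4: "?v Ha \<otimes>\<^bsub>?P\<^esub> ?v Hb = ?v Hb \<otimes>\<^bsub>?P\<^esub> ?v Ha \<otimes>\<^bsub>?P\<^esub> ?v Hc"
    using comm[of "?v Ha" "?v Hb" "?v Hc"]
      relR[OF Rm(4)]
    unfolding ev word_comm_def by (simp add: P.m_assoc)
  have r5: "?v Hc \<otimes>\<^bsub>?P\<^esub> ?v Ha = ?v Ha \<otimes>\<^bsub>?P\<^esub> ?v Hc"
    using comm[of "?v Hc" "?v Ha" "\<one>\<^bsub>?P\<^esub>"]
      relR[OF Rm(5)]
    unfolding ev word_comm_def by (simp add: P.m_assoc)
  have r6: "?v Hc \<otimes>\<^bsub>?P\<^esub> ?v Hb = ?v Hb \<otimes>\<^bsub>?P\<^esub> ?v Hc"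
    using comm[of "?v Hc" "?v Hb" "\<one>\<^bsub>?P\<^esub>"]
      relR[OF Rm(6)]
    unfolding ev word_comm_def by (simp add: P.m_assoc)
  have rel: "word_eval G h l = word_eval G h r" if "(l, r) \<in> R" for l r
  proof -
    have 1: "word_eval G h [] = \<one>" by (simp add: word_eval_def)
    have comm: "inv x \<otimes> (inv y \<otimes> (x \<otimes> y)) = z"
      if "x \<otimes> y = y \<otimes> (x \<otimes> z)" "x \<in> carrier G" "y \<in> carrier G" "z \<in> carrier G" for x y z
      using that by (simp add: inv_solve_left')
    show ?thesis using that rels comm[of a b c] comm[of c a \<one>] comm[of c b \<one>] unfolding R_def
      by (auto simp: word_eval_pow[OF v] word_eval_gen[OF v] 1 word_comm_def
          word_eval_append[OF v] word_eval_inv[OF v] m_assoc)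
  qed
  have "G \<cong> presented_group R"
  proof (rule iso_presented_group[OF v])
    show "carrier G = generate G (range h)" by (simp add: gen rh)
    show "word_eval G h l = word_eval G h r" if "(l, r) \<in> R" for l r using rel that .
    show "word_eq R w []" if w: "word_eval G h w = \<one>" for w
    proof -
      obtain i j k :: nat where "word_eval ?P ?v w =
          ?v Hb [^]\<^bsub>?P\<^esub> j \<otimes>\<^bsub>?P\<^esub> ?v Ha [^]\<^bsub>?P\<^esub> i \<otimes>\<^bsub>?P\<^esub> ?v Hc [^]\<^bsub>?P\<^esub> k"
        using P.word_eval_normal_form3[OF pv _ _ _ r1 r2 r3 r4 r5 r6, of w] \<open>p > 0\<close> by auto
      also have "\<dots> = word_eval ?P ?v (word_pow (gen Hb) j @ word_pow (gen Ha) i @ word_pow (gen Hc) k)"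
        by (simp add: P.word_eval_append[OF pv] P.word_eval_pow[OF pv] P.word_eval_gen[OF pv]
            P.m_assoc)
      finally have eq: "word_eq R w (word_pow (gen Hb) j @ word_pow (gen Ha) i @ word_pow (gen Hc) k)"
        unfolding word_class_eval[symmetric] word_class_eq_iff .
      have "b [^] j \<otimes> a [^] i \<otimes> c [^] k = \<one>"
        using word_eval_cong[OF eq v rel] w
        by (simp add: word_eval_append[OF v] word_eval_pow[OF v] word_eval_gen[OF v] m_assoc)
      then obtain i' j' k' where "i = p ^ u * i'" "j = p ^ v * j'" "k = p * k'"
        using indep by (meson dvdE)
      then have "word_eval ?P ?v (word_pow (gen Hb) j @ word_pow (gen Ha) i @ word_pow (gen Hc) k)
          = word_eval ?P ?v []"
        by (simp add: P.word_eval_append[OF pv] P.word_eval_pow[OF pv] P.word_eval_gen[OF pv] e1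
            P.nat_pow_pow[symmetric] r1 r2 r3)
      then show ?thesis using eq unfolding word_class_eval[symmetric] word_class_eq_iff
        by (rule word_eq.trans[rotated])
    qed
  qed
  then show ?thesis unfolding M3_def R_def .
qed

section \<open>Internal products\<close>

lemma central_products_append:
  "L \<noteq> [] \<Longrightarrow> central_products p (L @ [Q]) = central_prod p (central_products p L) Q"
  by (cases L) auto

lemma direct_products_append:
  "L \<noteq> [] \<Longrightarrow> direct_products (L @ [Q]) = direct_prod (direct_products L) Q"
  by (cases L) auto

context group
begin

lemma mult_inv_cancel:
  assumes "x \<in> carrier G" "y \<in> carrier G"
  shows "x \<otimes> (inv x \<otimes> y) = y" "inv x \<otimes> (x \<otimes> y) = y"
  using assms by (simp_all add: m_assoc[symmetric])

lemma mem_set_mult: "x \<in> H <#> K \<longleftrightarrow> (\<exists>h\<in>H. \<exists>k\<in>K. x = h \<otimes> k)"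
  by (auto simp: set_mult_def)

lemma subgroup_commuting_set_mult:
  assumes H: "subgroup H G" and K: "subgroup K G"
    and comm: "\<And>h k. h \<in> H \<Longrightarrow> k \<in> K \<Longrightarrow> h \<otimes> k = k \<otimes> h"
  shows "subgroup (H <#> K) G"
proof (rule subgroupI)
  note [simp] = subgroup.mem_carrier[OF H] subgroup.mem_carrier[OF K]
    subgroup.m_closed[OF H] subgroup.m_closed[OF K]
    subgroup.m_inv_closed[OF H] subgroup.m_inv_closed[OF K]
  show "H <#> K \<subseteq> carrier G" by (auto simp: mem_set_mult)
  show "H <#> K \<noteq> {}" using subgroup.one_closed[OF H] subgroup.one_closed[OF K]
    by (auto simp: set_mult_def)
  fix x assume "x \<in> H <#> K"
  then obtain h k where x: "h \<in> H" "k \<in> K" "x = h \<otimes> k" by (auto simp: mem_set_mult)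
  then show "inv x \<in> H <#> K"
    using comm[of "inv h" "inv k"] unfolding mem_set_mult
    by (intro bexI[of _ "inv h"] bexI[of _ "inv k"]) (simp_all add: inv_mult_group)
  fix y assume "y \<in> H <#> K"
  then obtain h' k' where y: "h' \<in> H" "k' \<in> K" "y = h' \<otimes> k'" by (auto simp: mem_set_mult)
  have "x \<otimes> y = h \<otimes> (k \<otimes> h') \<otimes> k'" using x y by (simp add: m_assoc)
  also have "\<dots> = h \<otimes> (h' \<otimes> k) \<otimes> k'" using x y comm[of h' k] by simp
  also have "\<dots> = (h \<otimes> h') \<otimes> (k \<otimes> k')" using x y by (simp add: m_assoc)
  finally show "x \<otimes> y \<in> H <#> K" using x y unfolding mem_set_mult
    by (intro bexI[of _ "h \<otimes> h'"] bexI[of _ "k \<otimes> k'"]) simp_all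
qed

lemma set_mult_upper:
  assumes "subgroup H G" "subgroup K G"
  shows "H \<subseteq> H <#> K" "K \<subseteq> H <#> K"
  using subgroup.one_closed[OF assms(1)] subgroup.one_closed[OF assms(2)]
    subgroup.mem_carrier[OF assms(1)] subgroup.mem_carrier[OF assms(2)]
  by (force simp: mem_set_mult)+

lemma derived_commuting:
  assumes K: "subgroup K G" and comm: "\<And>x y. x \<in> K \<Longrightarrow> y \<in> K \<Longrightarrow> x \<otimes> y = y \<otimes> x"
  shows "derived G K = {\<one>}"
proof -
  note [simp] = subgroup.mem_carrier[OF K]
  have "x \<otimes> y \<otimes> inv x \<otimes> inv y = \<one>" if xy: "x \<in> K" "y \<in> K" for x y
  proof -
    have "x \<otimes> y \<otimes> inv x \<otimes> inv y = y \<otimes> (x \<otimes> inv x) \<otimes> inv y"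
      using xy by (simp add: comm[of x y] m_assoc del: r_inv)
    then show ?thesis using xy by simp
  qed
  then have "derived_set G K \<subseteq> {\<one>}" by auto
  then have "derived G K \<subseteq> {\<one>}"
    unfolding derived_def by (intro generate_subgroup_incl triv_subgroup)
  then show ?thesis using generate.one[of G "derived_set G K"] by (auto simp: derived_def)
qed

lemma subgroup_restrict:
  assumes "subgroup H G" "subgroup K G" "H \<subseteq> K"
  shows "subgroup H (G\<lparr>carrier := K\<rparr>)"
  using assms subgroup_incl by blast

text \<open>Factors stay subsets of the ambient \<open>G\<close>, where their derived subgroups can
  be computed as well. Since \<open>central_products\<close> folds from the left, factors are added
  at the right end; this dictates the order in which they are attached later.\<close>

lemma central_products_snoc:
  assumes H: "subgroup H G" and K: "subgroup K G"
    and comm: "\<And>h k. h \<in> H \<Longrightarrow> k \<in> K \<Longrightarrow> h \<otimes> k = k \<otimes> h"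
    and card: "card (H \<inter> K) = p"
    and der: "derived G H = {\<one>} \<or> derived G H = H \<inter> K" "derived G K = {\<one>} \<or> derived G K = H \<inter> K"
    and types: "central_products p L (G\<lparr>carrier := H\<rparr>)" "L \<noteq> []" "Q (G\<lparr>carrier := K\<rparr>)"
  shows "central_products p (L @ [Q]) (G\<lparr>carrier := H <#> K\<rparr>)"
proof -
  note HK = subgroup_commuting_set_mult[OF H K comm]
  let ?P = "G\<lparr>carrier := H <#> K\<rparr>"
  have sub: "subgroup H ?P" "subgroup K ?P"
    using set_mult_upper[OF H K] by (auto intro: subgroup_restrict H K HK)
  have d: "derived ?P L = derived G L" if "L \<subseteq> H <#> K" "subgroup L G" for L
    using derived_consistent[OF that(1) HK] by simp
  have "is_central_product ?P H K"
    unfolding is_central_product_def using sub comm by (auto simp: set_mult_def)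
  moreover have "amalgamated p ?P H K"
    unfolding amalgamated_def using card der d[OF _ H] d[OF _ K] set_mult_upper[OF H K] by auto
  ultimately show ?thesis
    unfolding central_products_append[OF types(2)] central_prod_def using types
    by (intro exI[of _ H] exI[of _ K]) simp
qed

lemma factors_normal:
  assumes H: "subgroup H G" and K: "subgroup K G"
    and comm: "\<And>h k. h \<in> H \<Longrightarrow> k \<in> K \<Longrightarrow> h \<otimes> k = k \<otimes> h"
  shows "H \<lhd> (G\<lparr>carrier := H <#> K\<rparr>)" "K \<lhd> (G\<lparr>carrier := H <#> K\<rparr>)"
proof -
  note HK = subgroup_commuting_set_mult[OF H K comm]
  let ?P = "G\<lparr>carrier := H <#> K\<rparr>"
  interpret P: group ?P using HK by (rule subgroup_imp_group)
  note [simp] = subgroup.mem_carrier[OF H] subgroup.mem_carrier[OF K]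
    subgroup.m_closed[OF H] subgroup.m_closed[OF K]
    subgroup.m_inv_closed[OF H] subgroup.m_inv_closed[OF K]
  have sub: "subgroup H ?P" "subgroup K ?P"
    using set_mult_upper[OF H K] by (auto intro: subgroup_restrict H K HK)
  have inv: "inv\<^bsub>?P\<^esub> x = inv x" if "x \<in> H <#> K" for x
    using m_inv_consistent[OF HK] that by simp
  have conj: "h \<otimes> k \<otimes> h' \<otimes> inv (h \<otimes> k) = h \<otimes> h' \<otimes> inv h"
    "h \<otimes> k \<otimes> k' \<otimes> inv (h \<otimes> k) = k \<otimes> k' \<otimes> inv k"
    if "h \<in> H" "k \<in> K" "h' \<in> H" "k' \<in> K" for h k h' k'
  proof -
    have "h \<otimes> k \<otimes> h' \<otimes> inv (h \<otimes> k) = h \<otimes> (k \<otimes> h') \<otimes> inv (h \<otimes> k)"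
      using that by (simp add: m_assoc)
    also have "\<dots> = h \<otimes> (h' \<otimes> k) \<otimes> inv (h \<otimes> k)" using that comm[of h' k] by simp
    also have "\<dots> = h \<otimes> h' \<otimes> (k \<otimes> inv k) \<otimes> inv h"
      using that by (simp add: m_assoc inv_mult_group mult_inv_cancel)
    finally have "h \<otimes> k \<otimes> h' \<otimes> inv (h \<otimes> k) = h \<otimes> h' \<otimes> (k \<otimes> inv k) \<otimes> inv h" .
    then show "h \<otimes> k \<otimes> h' \<otimes> inv (h \<otimes> k) = h \<otimes> h' \<otimes> inv h"
      using that by simp
    have "h \<otimes> k \<otimes> k' \<otimes> inv (h \<otimes> k) = (h \<otimes> (k \<otimes> k' \<otimes> inv k)) \<otimes> inv h"
      using that by (simp add: m_assoc inv_mult_group)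
    also have "\<dots> = (k \<otimes> k' \<otimes> inv k) \<otimes> (h \<otimes> inv h)"
      using that comm[of h "k \<otimes> k' \<otimes> inv k"] by (simp add: m_assoc del: r_inv)
    finally show "h \<otimes> k \<otimes> k' \<otimes> inv (h \<otimes> k) = k \<otimes> k' \<otimes> inv k"
      using that by simp
  qed
  show "H \<lhd> ?P" "K \<lhd> ?P"
    unfolding P.normal_inv_iff using sub conj subgroup.one_closed[OF H] subgroup.one_closed[OF K]
    by (auto simp: inv) (auto simp: mem_set_mult)
qed

lemma direct_products_snoc:
  assumes H: "subgroup H G" and K: "subgroup K G"
    and comm: "\<And>h k. h \<in> H \<Longrightarrow> k \<in> K \<Longrightarrow> h \<otimes> k = k \<otimes> h"
    and int: "H \<inter> K \<subseteq> {\<one>}"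
    and types: "direct_products L (G\<lparr>carrier := H\<rparr>)" "L \<noteq> []" "Q (G\<lparr>carrier := K\<rparr>)"
  shows "direct_products (L @ [Q]) (G\<lparr>carrier := H <#> K\<rparr>)"
proof -
  note HK = subgroup_commuting_set_mult[OF H K comm]
  let ?P = "G\<lparr>carrier := H <#> K\<rparr>"
  interpret P: group ?P using HK by (rule subgroup_imp_group)
  have sub: "subgroup H ?P" "subgroup K ?P"
    using set_mult_upper[OF H K] by (auto intro: subgroup_restrict H K HK)
  have int': "H \<inter> K = {\<one>}"
    using int subgroup.one_closed[OF H] subgroup.one_closed[OF K] by auto
  have "H \<lhd> ?P" "K \<lhd> ?P"
    using factors_normal[OF H K comm] by auto
  then have "is_direct_product ?P (carrier ?P) H K"
    unfolding is_direct_product_def using P.subgroup_self int' by (simp add: set_mult_def)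
  then show ?thesis
    unfolding direct_products_append[OF types(2)] direct_prod_def using types
    by (intro exI[of _ H] exI[of _ K]) simp
qed

section \<open>Recognizing cyclic and elementary abelian groups\<close>

lemma cyclic_subgroup_iso:
  assumes "a \<in> carrier G" "ord a \<noteq> 0"
  shows "G\<lparr>carrier := generate G {a}\<rparr> \<cong> integer_mod_group (ord a)"
proof -
  let ?Z = "integer_mod_group (ord a)"
  let ?f = "\<lambda>i::int. a [^] i"
  have car: "carrier ?Z = {0..<int (ord a)}" using assms(2) by (simp add: carrier_integer_mod_group)
  have hom: "?f \<in> hom ?Z (G\<lparr>carrier := generate G {a}\<rparr>)"
  proof (rule homI)
    show "a [^] (x \<otimes>\<^bsub>?Z\<^esub> y) = a [^] x \<otimes>\<^bsub>G\<lparr>carrier := generate G {a}\<rparr>\<^esub> a [^] y" for x y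
    proof -
      have "a [^] ((x + y) mod int (ord a)) = a [^] (x + y)"
        using assms(1) by (simp add: int_pow_eq mod_eq_dvd_iff[symmetric] minus_mod_eq_mult_div)
      then show ?thesis using assms(1) by (simp add: int_pow_mult)
    qed
  qed (use generate_pow[OF assms(1)] in auto)
  have inj: "inj_on ?f (carrier ?Z)"
  proof (rule inj_onI)
    fix x y assume xy: "x \<in> carrier ?Z" "y \<in> carrier ?Z" "a [^] x = a [^] y"
    then have "y mod int (ord a) = x mod int (ord a)"
      using assms(1) by (simp add: int_pow_eq mod_eq_dvd_iff)
    then show "x = y" using xy by (simp add: car)
  qed
  have "a [^] i \<in> ?f ` carrier ?Z" for i :: int
  proof (rule image_eqI)
    show "i mod int (ord a) \<in> carrier ?Z" using assms(2) by (simp add: car)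
    show "a [^] i = a [^] (i mod int (ord a))"
      using assms(1) by (simp add: int_pow_eq) (simp add: minus_mod_eq_mult_div flip: dvd_minus_iff[of _ "_ - i"])
  qed
  then have "?f ` carrier ?Z = generate G {a}"
    using generate_pow[OF assms(1)] by auto
  then have "?f \<in> iso ?Z (G\<lparr>carrier := generate G {a}\<rparr>)"
    using hom inj by (simp add: iso_def bij_betw_def)
  then show ?thesis using group.iso_sym[OF group_integer_mod_group] is_isoI by blast
qed

end

text \<open>Exponent vectors map onto \<open>G\<close> because the image contains the generators;
  comparison of the two orders then gives injectivity, which takes the place of an independence
  condition on the \<open>z i\<close>.\<close>

lemma (in comm_group) iso_elem_abelian:
  fixes z :: "nat \<Rightarrow> 'a"
  assumes p: "p > 0" and z: "\<And>i. i < s \<Longrightarrow> z i \<in> carrier G" "\<And>i. i < s \<Longrightarrow> z i [^] p = \<one>"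
    and gen: "carrier G = generate G (z ` {..<s})" and card: "card (carrier G) = p ^ s"
  shows "G \<cong> elem_abelian p s"
proof -
  let ?E = "elem_abelian p s"
  define f where "f x = finprod G (\<lambda>i. z i [^] (x i :: int)) {..<s}" for x
  interpret E: group ?E unfolding elem_abelian_def by (rule product_group) auto
  have carE: "carrier ?E = (\<Pi>\<^sub>E i\<in>{..<s}. {0..<int p})"
    using p by (simp add: elem_abelian_def carrier_integer_mod_group)
  have "f \<in> hom ?E G"
  proof (rule homI)
    show "f x \<in> carrier G" for x unfolding f_def by (rule finprod_closed) (use z in auto)
    fix x y
    have pow: "z i [^] ((x i + y i) mod int p) = z i [^] x i \<otimes> z i [^] y i" if i: "i < s" for i
    proof -
      have "ord (z i) dvd p" using z[OF i] by (simp add: pow_eq_id)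
      then have "int (ord (z i)) dvd (x i + y i) - (x i + y i) mod int p"
        using dvd_trans[of "int (ord (z i))" "int p"] by (simp add: minus_mod_eq_mult_div)
      then show ?thesis using z(1)[OF i] by (simp add: int_pow_eq int_pow_mult[symmetric])
    qed
    have "f (x \<otimes>\<^bsub>?E\<^esub> y) = finprod G (\<lambda>i. z i [^] x i \<otimes> z i [^] y i) {..<s}"
      unfolding f_def by (rule finprod_cong') (use z pow in \<open>auto simp: elem_abelian_def\<close>)
    also have "\<dots> = f x \<otimes> f y" unfolding f_def by (rule finprod_multf) (use z in auto)
    finally show "f (x \<otimes>\<^bsub>?E\<^esub> y) = f x \<otimes> f y" .
  qed
  then interpret f: group_hom ?E G f by unfold_locales
  have "z i \<in> f ` carrier ?E" if i: "i < s" for i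
  \<comment> \<open>For \<open>p = 1\<close> the entry 1 of a unit vector is not in
    \<open>{0..<p}\<close>, so this degenerate case is treated apart.\<close>
  proof (cases "p = 1")
    case True
    then have "z i = \<one>" using z[OF i] by simp
    then show ?thesis using f.img_is_subgroup subgroup.one_closed by metis
  next
    case False
    define x where "x = (\<lambda>j\<in>{..<s}. if j = i then 1 else 0 :: int)"
    have "f x = finprod G (\<lambda>j. if i = j then z j else \<one>) {..<s}"
      unfolding f_def by (rule finprod_cong') (use z in \<open>auto simp: x_def\<close>)
    also have "\<dots> = z i" using i z by (intro finprod_singleton) auto
    finally show ?thesis using False p by (intro image_eqI[of _ _ x]) (auto simp: carE x_def)
  qed
  then have "generate G (z ` {..<s}) \<subseteq> f ` carrier ?E"
    by (intro generate_subgroup_incl f.img_is_subgroup) auto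
  then have surj: "f ` carrier ?E = carrier G"
    using gen f.img_is_subgroup subgroup.subset by blast
  have "card (carrier ?E) = p ^ s" by (simp add: carE card_PiE)
  then have "inj_on f (carrier ?E)"
    using surj card p by (intro eq_card_imp_inj_on) (auto simp: carE intro!: finite_PiE)
  then have "f \<in> iso ?E G" using surj f.homh by (simp add: iso_def bij_betw_def)
  then show ?thesis using E.iso_sym is_isoI by blast
qed

section \<open>Commutators of order \<open>p\<close>\<close>

text \<open>The center of the subgroup \<open>K\<close>, kept as a subset of \<open>G\<close>
  instead of being formed in a restricted record.\<close>

definition subcenter :: "('a, 'b) monoid_scheme \<Rightarrow> 'a set \<Rightarrow> 'a set" where
  "subcenter G K = {x \<in> K. \<forall>y\<in>K. x \<otimes>\<^bsub>G\<^esub> y = y \<otimes>\<^bsub>G\<^esub> x}"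

lemma (in group) center_closed: "x \<in> center G \<Longrightarrow> x \<in> carrier G"
  by (simp add: center_def)

lemma (in group) center_comm: "x \<in> center G \<Longrightarrow> y \<in> carrier G \<Longrightarrow> x \<otimes> y = y \<otimes> x"
  by (simp add: center_def)

lemma (in group) comm_mult:
  assumes "x \<otimes> z = z \<otimes> x" "y \<otimes> z = z \<otimes> y" "x \<in> carrier G" "y \<in> carrier G" "z \<in> carrier G"
  shows "x \<otimes> y \<otimes> z = z \<otimes> (x \<otimes> y)"
proof -
  have "x \<otimes> y \<otimes> z = (x \<otimes> z) \<otimes> y" using assms(2-) by (simp add: m_assoc)
  also have "\<dots> = z \<otimes> (x \<otimes> y)" unfolding assms(1) using assms(3-) by (simp add: m_assoc)
  finally show ?thesis .
qed

lemma (in group) comm_inv: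
  assumes "x \<otimes> z = z \<otimes> x" "x \<in> carrier G" "z \<in> carrier G"
  shows "inv x \<otimes> z = z \<otimes> inv x"
proof -
  have "inv x \<otimes> z = inv x \<otimes> (z \<otimes> x) \<otimes> inv x" using assms(2,3) by (simp add: m_assoc)
  also have "\<dots> = z \<otimes> inv x" using assms(2,3) by (simp add: assms(1)[symmetric] m_assoc mult_inv_cancel)
  finally show ?thesis .
qed

lemma (in group) subgroup_centralizer:
  assumes K: "subgroup K G" and A: "A \<subseteq> carrier G"
  shows "subgroup {x \<in> K. \<forall>a\<in>A. x \<otimes> a = a \<otimes> x} G"
proof (rule subgroupI)
  have "\<one> \<in> {x \<in> K. \<forall>a\<in>A. x \<otimes> a = a \<otimes> x}" using subgroup.one_closed[OF K] A by auto
  then show "{x \<in> K. \<forall>a\<in>A. x \<otimes> a = a \<otimes> x} \<noteq> {}" by blast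
qed (use subgroup.mem_carrier[OF K] subgroup.m_closed[OF K] subgroup.m_inv_closed[OF K] A in
    \<open>auto intro!: comm_mult comm_inv\<close>)

lemma (in group) subgroup_center: "subgroup (center G) G"
  using subgroup_centralizer[OF subgroup_self, of "carrier G"] by (simp add: center_def)

lemma (in group) subgroup_pow_closed: "subgroup K G \<Longrightarrow> x \<in> K \<Longrightarrow> x [^] (n::nat) \<in> K"
  by (induction n) (auto simp: subgroup.one_closed subgroup.m_closed)

lemma (in group) generate_pow_mem: "x \<in> carrier G \<Longrightarrow> x [^] (n::nat) \<in> generate G {x}"
  by (intro subgroup_pow_closed generate_is_subgroup generate.incl) auto

lemma (in group) subgroup_card_dvd:
  assumes "subgroup H G" "subgroup K G" "H \<subseteq> K"
  shows "card H dvd card K"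
proof -
  interpret K: group "G\<lparr>carrier := K\<rparr>" using assms(2) by (rule subgroup_imp_group)
  from K.lagrange[OF subgroup_restrict[OF assms]] have
    "card K = card (rcosets\<^bsub>G\<lparr>carrier := K\<rparr>\<^esub> H) * card H" by (simp add: order_def)
  then show ?thesis by simp
qed

text \<open>Collects what the commutator calculus and the attachment of factors rely on: a derived
  subgroup of odd prime order inside the center. The subgroup \<open>N\<close> enters later, through
  the form of \<open>p\<close>-th powers.\<close>

locale derived_prime_group = group G for G (structure) +
  fixes p :: nat and c :: 'a
  assumes fin: "finite (carrier G)" and prime: "Factorial_Ring.prime p" and p_gt: "p > 2"
    and c_center: "c \<in> center G"
    and derived: "derived G (carrier G) = generate G {c}"
    and card_C: "card (generate G {c}) = p"
begin

abbreviation C where "C \<equiv> generate G {c}"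
abbreviation Z where "Z \<equiv> center G"

text \<open>The convention of \<open>derived_set\<close>. As all values are central, it agrees with
  the commutator x^-1 y^-1 x y used in the relators of \<open>M3\<close>.\<close>

definition cm :: "'a \<Rightarrow> 'a \<Rightarrow> 'a" where "cm x y = x \<otimes> y \<otimes> inv x \<otimes> inv y"

lemma p_pos: "p > 0" using p_gt by simp

lemma c_closed: "c \<in> carrier G" using c_center center_closed by blast

lemma subgroup_C: "subgroup C G" using c_closed generate_is_subgroup by blast

lemma C_sub_Z: "C \<subseteq> Z"
  using generate_subgroup_incl[OF _ subgroup_center] c_center by blast

lemma C_Z: "x \<in> C \<Longrightarrow> x \<in> Z" using C_sub_Z by blast

lemma Z_closed: "x \<in> Z \<Longrightarrow> x \<in> carrier G" by (rule center_closed)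

lemma Z_comm: "x \<in> Z \<Longrightarrow> y \<in> carrier G \<Longrightarrow> x \<otimes> y = y \<otimes> x" by (rule center_comm)

lemma C_closed: "x \<in> C \<Longrightarrow> x \<in> carrier G" using C_Z Z_closed by blast

lemma C_ord:
  assumes d: "d \<in> C" "d \<noteq> \<one>"
  shows "ord d = p" "generate G {d} = C"
proof -
  have "ord d dvd p"
    using generate_pow_card[OF C_closed[OF d(1)]] subgroup_card_dvd[of "generate G {d}" C]
      generate_is_subgroup[of "{d}"] C_closed[OF d(1)] subgroup_C generate_subgroup_incl[of "{d}" C] d(1)
    by (simp add: card_C)
  then show *: "ord d = p"
    using prime d ord_eq_1[OF C_closed[OF d(1)]] by (auto simp: prime_nat_iff)
  show "generate G {d} = C"
  proof (rule card_subset_eq)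
    show "finite C" using card_C p_pos by (metis card.infinite less_irrefl)
    show "generate G {d} \<subseteq> C" using generate_subgroup_incl[of "{d}" C] d(1) subgroup_C by blast
    show "card (generate G {d}) = card C"
      using generate_pow_card[OF C_closed[OF d(1)]] * card_C by simp
  qed
qed

lemma C_pow_p: "d \<in> C \<Longrightarrow> d [^] p = \<one>"
  by (cases "d = \<one>") (use C_ord C_closed pow_eq_id in auto)

lemma C_pow_one: "d \<in> C \<Longrightarrow> d \<noteq> \<one> \<Longrightarrow> d [^] (n::nat) = \<one> \<longleftrightarrow> p dvd n"
  using C_ord C_closed pow_eq_id by auto

lemma C_pow_ex:
  assumes "d \<in> C" "d \<noteq> \<one>" "e \<in> C"
  shows "\<exists>i<p. e = d [^] (i::nat)"
proof -
  obtain k :: nat where k: "e = d [^] k"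
    using generate_pow_nat[OF C_closed[OF assms(1)]] C_ord[OF assms(1,2)] assms(3) p_pos by auto
  have "d [^] k = d [^] (k mod p + p * (k div p))" by simp
  also have "\<dots> = d [^] (k mod p) \<otimes> (d [^] p) [^] (k div p)"
    using C_closed[OF assms(1)] by (simp only: nat_pow_mult nat_pow_pow)
  also have "\<dots> = d [^] (k mod p)"
    using C_closed[OF assms(1)] C_pow_p[OF assms(1)] by simp
  finally show ?thesis using k p_pos by (metis mod_less_divisor)
qed

lemma C_pow_inj:
  assumes "d \<in> C" "d \<noteq> \<one>" "d [^] (i::nat) = d [^] (j::nat)" "i < p" "j < p"
  shows "i = j"
proof -
  have "int p dvd int j - int i"
    using assms int_pow_eq[OF C_closed[OF assms(1)], of "int i" "int j"] C_ord[OF assms(1,2)]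
    by (simp add: int_pow_int)
  then have "int j mod int p = int i mod int p" by (simp add: mod_eq_dvd_iff)
  then show ?thesis using assms(4,5) by simp
qed

lemma cm_C: "x \<in> carrier G \<Longrightarrow> y \<in> carrier G \<Longrightarrow> cm x y \<in> C"
  unfolding derived[symmetric] derived_def cm_def by (rule generate.incl) auto

lemma cm_Z: "x \<in> carrier G \<Longrightarrow> y \<in> carrier G \<Longrightarrow> cm x y \<in> Z"
  using cm_C C_Z by blast

lemma cm_closed [simp]: "x \<in> carrier G \<Longrightarrow> y \<in> carrier G \<Longrightarrow> cm x y \<in> carrier G"
  using cm_C C_closed by blast

lemma swap: "x \<in> carrier G \<Longrightarrow> y \<in> carrier G \<Longrightarrow> x \<otimes> y = cm x y \<otimes> (y \<otimes> x)"
  by (simp add: cm_def m_assoc mult_inv_cancel)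

lemma cm_eqI:
  assumes "x \<otimes> y = d \<otimes> (y \<otimes> x)" "x \<in> carrier G" "y \<in> carrier G" "d \<in> carrier G"
  shows "cm x y = d"
proof -
  have "cm x y \<otimes> (y \<otimes> x) = d \<otimes> (y \<otimes> x)" using swap[of x y] assms by simp
  then show ?thesis using assms by (simp add: right_cancel)
qed

lemma cm_one_iff: "x \<in> carrier G \<Longrightarrow> y \<in> carrier G \<Longrightarrow> cm x y = \<one> \<longleftrightarrow> x \<otimes> y = y \<otimes> x"
  using swap[of x y] cm_eqI[of x y \<one>] by auto

lemma cm_self [simp]: "x \<in> carrier G \<Longrightarrow> cm x x = \<one>"
  by (simp add: cm_one_iff)

lemma cm_mult_left:
  assumes [simp]: "x \<in> carrier G" "y \<in> carrier G" "z \<in> carrier G"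
  shows "cm (x \<otimes> y) z = cm x z \<otimes> cm y z"
proof (rule cm_eqI)
  have "x \<otimes> y \<otimes> z = x \<otimes> (cm y z \<otimes> (z \<otimes> y))" by (simp add: m_assoc swap[of y z, symmetric])
  also have "\<dots> = (cm y z \<otimes> x) \<otimes> (z \<otimes> y)" by (simp add: Z_comm[OF cm_Z] m_assoc)
  also have "\<dots> = cm y z \<otimes> (x \<otimes> z) \<otimes> y" by (simp add: m_assoc)
  also have "\<dots> = cm y z \<otimes> (cm x z \<otimes> (z \<otimes> x)) \<otimes> y" by (simp add: swap[of x z, symmetric])
  also have "\<dots> = (cm y z \<otimes> cm x z) \<otimes> (z \<otimes> (x \<otimes> y))" by (simp add: m_assoc)
  also have "cm y z \<otimes> cm x z = cm x z \<otimes> cm y z" by (rule Z_comm[OF cm_Z]) simp_all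
  finally show "x \<otimes> y \<otimes> z = cm x z \<otimes> cm y z \<otimes> (z \<otimes> (x \<otimes> y))" .
qed simp_all

lemma cm_swap:
  assumes [simp]: "x \<in> carrier G" "y \<in> carrier G"
  shows "cm y x = inv (cm x y)"
  by (simp add: cm_def inv_mult_group m_assoc)

lemma cm_mult_right:
  assumes [simp]: "x \<in> carrier G" "y \<in> carrier G" "z \<in> carrier G"
  shows "cm z (x \<otimes> y) = cm z x \<otimes> cm z y"
proof -
  have "cm z (x \<otimes> y) = inv (cm x z \<otimes> cm y z)"
    by (simp only: cm_swap[of "x \<otimes> y" z] cm_mult_left m_closed assms)
  also have "\<dots> = cm z y \<otimes> cm z x"
    by (simp add: inv_mult_group cm_swap[of x z] cm_swap[of y z])
  also have "\<dots> = cm z x \<otimes> cm z y" by (rule Z_comm[OF cm_Z]) simp_all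
  finally show ?thesis .
qed

lemma cm_one [simp]: "x \<in> carrier G \<Longrightarrow> cm x \<one> = \<one>" "x \<in> carrier G \<Longrightarrow> cm \<one> x = \<one>"
  by (simp_all add: cm_one_iff)

lemma cm_pow_left: "x \<in> carrier G \<Longrightarrow> y \<in> carrier G \<Longrightarrow> cm (x [^] (n::nat)) y = cm x y [^] n"
  by (induction n) (simp_all add: cm_mult_left)

lemma cm_pow_right: "x \<in> carrier G \<Longrightarrow> y \<in> carrier G \<Longrightarrow> cm x (y [^] (n::nat)) = cm x y [^] n"
  by (induction n) (simp_all add: cm_mult_right)

lemma cm_center: "z \<in> Z \<Longrightarrow> y \<in> carrier G \<Longrightarrow> cm z y = \<one>" "z \<in> Z \<Longrightarrow> y \<in> carrier G \<Longrightarrow> cm y z = \<one>"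
  using Z_comm[of z y] Z_closed[of z] by (simp_all add: cm_one_iff)

lemma Z_pow_closed: "z \<in> Z \<Longrightarrow> z [^] (n::nat) \<in> Z"
  by (rule subgroup_pow_closed[OF subgroup_center])

lemma Z_pow_distrib: "z \<in> Z \<Longrightarrow> y \<in> carrier G \<Longrightarrow> (y \<otimes> z) [^] (n::nat) = y [^] n \<otimes> z [^] n"
  using Z_comm[of z y] Z_closed[of z] by (intro pow_mult_distrib) auto

text \<open>The collection formula in class two: bringing \<open>(x y)^n\<close> into the form
  \<open>x^n y^n\<close> moves a \<open>y\<close> past an \<open>x\<close> once for every pair of
  positions, hence the binomial exponent.\<close>

lemma pow_mult_cm:
  assumes [simp]: "x \<in> carrier G" "y \<in> carrier G"
  shows "(x \<otimes> y) [^] (n::nat) = x [^] n \<otimes> y [^] n \<otimes> cm y x [^] (n * (n - 1) div 2)"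
proof (induction n)
  case (Suc n)
  define d where "d = cm y x"
  have dZ: "d [^] (k::nat) \<in> Z" for k unfolding d_def by (intro Z_pow_closed cm_Z) simp_all
  have [simp]: "d \<in> carrier G" by (simp add: d_def)
  have sw: "y [^] n \<otimes> x = d [^] n \<otimes> (x \<otimes> y [^] n)"
    using swap[of "y [^] n" x] by (simp add: cm_pow_left d_def)
  have ar: "n * (n - 1) div 2 + n = Suc n * (Suc n - 1) div 2"
    by (cases n) (simp_all add: algebra_simps)
  have "(x \<otimes> y) [^] Suc n = x [^] n \<otimes> y [^] n \<otimes> (d [^] (n * (n - 1) div 2) \<otimes> (x \<otimes> y))"
    by (simp add: Suc m_assoc d_def)
  also have "\<dots> = x [^] n \<otimes> y [^] n \<otimes> ((x \<otimes> y) \<otimes> d [^] (n * (n - 1) div 2))"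
    by (simp add: Z_comm[OF dZ])
  also have "\<dots> = x [^] n \<otimes> (y [^] n \<otimes> x) \<otimes> y \<otimes> d [^] (n * (n - 1) div 2)"
    by (simp add: m_assoc)
  also have "\<dots> = x [^] n \<otimes> (d [^] n \<otimes> (x \<otimes> y [^] n \<otimes> y)) \<otimes> d [^] (n * (n - 1) div 2)"
    by (simp add: sw m_assoc)
  also have "\<dots> = x [^] n \<otimes> ((x \<otimes> y [^] n \<otimes> y) \<otimes> d [^] n) \<otimes> d [^] (n * (n - 1) div 2)"
    by (subst Z_comm[OF dZ[of n], of "x \<otimes> y [^] n \<otimes> y"]) simp_all
  also have "\<dots> = x [^] Suc n \<otimes> y [^] Suc n \<otimes> d [^] (n * (n - 1) div 2 + n)"
    by (simp add: m_assoc nat_pow_mult add.commute)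
  finally show ?case unfolding ar d_def .
qed simp

lemma pow_p_mult:
  assumes "x \<in> carrier G" "y \<in> carrier G"
  shows "(x \<otimes> y) [^] p = x [^] p \<otimes> y [^] p"
proof -
  have "odd p" using prime p_gt prime_odd_nat by auto
  then obtain q where "p = 2 * q + 1" by (elim oddE)
  \<comment> \<open>For odd \<open>p\<close> the binomial exponent is a multiple of
    \<open>p\<close>, so the commutator term vanishes.\<close>
  then have "p * (p - 1) div 2 = p * q" by simp
  then show ?thesis
    using pow_mult_cm[OF assms, of p] assms C_pow_p[OF cm_C[of y x]]
    by (simp add: nat_pow_pow[symmetric])
qed

section \<open>Splitting off a noncommuting pair\<close>

definition centr :: "'a set \<Rightarrow> 'a set \<Rightarrow> 'a set" where
  "centr K A = {x \<in> K. \<forall>a\<in>A. x \<otimes> a = a \<otimes> x}"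

lemma subgroup_centr: "subgroup K G \<Longrightarrow> A \<subseteq> carrier G \<Longrightarrow> subgroup (centr K A) G"
  unfolding centr_def by (rule subgroup_centralizer)

lemma centr_pair_iff:
  "x \<in> carrier G \<Longrightarrow> a \<in> carrier G \<Longrightarrow> b \<in> carrier G \<Longrightarrow>
    x \<in> centr K {a, b} \<longleftrightarrow> x \<in> K \<and> cm x a = \<one> \<and> cm x b = \<one>"
  by (simp add: centr_def cm_one_iff)

lemma Z_sub_centr: "Z \<subseteq> K \<Longrightarrow> A \<subseteq> carrier G \<Longrightarrow> Z \<subseteq> centr K A"
  using Z_comm by (auto simp: centr_def subset_iff)

lemma cm_pair:
  assumes [simp]: "a \<in> carrier G" "b \<in> carrier G" "x \<in> carrier G"
  shows "cm (a [^] (i::nat) \<otimes> b [^] (j::nat) \<otimes> x) b = cm a b [^] i \<otimes> cm x b"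
    "cm (a [^] (i::nat) \<otimes> b [^] (j::nat) \<otimes> x) a = cm b a [^] j \<otimes> cm x a"
  by (simp_all add: cm_mult_left cm_pow_left)

text \<open>Orthogonal projection for the commutator form. \<open>C\<close> has prime order, so
  \<open>cm g b\<close> and \<open>cm g a\<close> are powers of the nontrivial elements
  \<open>cm a b\<close> and \<open>cm b a\<close>. These exponents are the coordinates
  \<open>i\<close> and \<open>j\<close>, and what remains after dividing them out commutes with both
  \<open>a\<close> and \<open>b\<close>.\<close>

lemma split_pair:
  assumes K: "subgroup K G" and ab: "a \<in> K" "b \<in> K" "cm a b \<noteq> \<one>" and g: "g \<in> K"
  shows "\<exists>i<p. \<exists>j<p. \<exists>x\<in>centr K {a, b}. g = a [^] (i::nat) \<otimes> b [^] (j::nat) \<otimes> x"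
proof -
  note [simp] = subgroup.mem_carrier[OF K]
  have ba: "cm b a \<noteq> \<one>" using ab by (simp add: cm_one_iff)
  obtain i where i: "i < p" "cm g b = cm a b [^] (i::nat)"
    using C_pow_ex[OF cm_C ab(3) cm_C, of g b] ab g by auto
  obtain j where j: "j < p" "cm g a = cm b a [^] (j::nat)"
    using C_pow_ex[OF cm_C ba cm_C, of g a] ab g by auto
  define x where "x = inv (a [^] i \<otimes> b [^] j) \<otimes> g"
  have xK: "x \<in> K" unfolding x_def
    by (intro subgroup.m_closed[OF K] subgroup.m_inv_closed[OF K] subgroup_pow_closed[OF K] ab g)
  have gx: "g = a [^] i \<otimes> b [^] j \<otimes> x"
    unfolding x_def by (subst mult_inv_cancel) (use ab g in simp_all)
  have "cm a b [^] i \<otimes> cm x b = cm a b [^] i \<otimes> \<one>" "cm b a [^] j \<otimes> cm x a = cm b a [^] j \<otimes> \<one>"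
    using cm_pair[of a b x i j, folded gx] i j xK ab by auto
  then have "cm x b = \<one>" "cm x a = \<one>" using xK ab by (simp_all add: l_cancel)
  then have "x \<in> centr K {a, b}" using xK ab by (simp add: centr_pair_iff)
  then show ?thesis using i j gx by blast
qed

text \<open>A central element of the orthogonal complement commutes with \<open>a\<close>, with
  \<open>b\<close> and with the complement, and these generate \<open>K\<close>. Hence splitting off
  a pair keeps the center, which is the invariant of the later inductions.\<close>

lemma split_subcenter:
  assumes K: "subgroup K G" and ab: "a \<in> K" "b \<in> K" "cm a b \<noteq> \<one>"
  shows "subcenter G (centr K {a, b}) = subcenter G K"
proof (rule equalityI)
  note [simp] = subgroup.mem_carrier[OF K]
  show "subcenter G K \<subseteq> subcenter G (centr K {a, b})"
    using ab by (auto simp: subcenter_def centr_def)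
  show "subcenter G (centr K {a, b}) \<subseteq> subcenter G K"
  proof
    fix x assume "x \<in> subcenter G (centr K {a, b})"
    then have x: "x \<in> centr K {a, b}" "\<And>y. y \<in> centr K {a, b} \<Longrightarrow> x \<otimes> y = y \<otimes> x"
      by (auto simp: subcenter_def)
    then have xK: "x \<in> K" "cm x a = \<one>" "cm x b = \<one>"
      using ab by (auto simp: centr_def cm_one_iff)
    have "x \<otimes> g = g \<otimes> x" if g: "g \<in> K" for g
    proof -
      obtain i j y where y: "y \<in> centr K {a, b}" "g = a [^] (i::nat) \<otimes> b [^] (j::nat) \<otimes> y"
        using split_pair[OF K ab g] by blast
      have "y \<in> K" using y by (simp add: centr_def)
      then have "cm x g = \<one>"
        using xK ab x(2)[OF y(1)] by (simp add: y(2) cm_mult_right cm_pow_right cm_one_iff[of x y])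
      then show ?thesis using xK g by (simp add: cm_one_iff)
    qed
    then show "x \<in> subcenter G K" using xK by (simp add: subcenter_def)
  qed
qed

text \<open>The coordinates \<open>i, j < p\<close> are recovered from the commutators with
  \<open>b\<close> and \<open>a\<close>, so the splitting of an element is unique.\<close>

lemma split_card:
  assumes K: "subgroup K G" and ab: "a \<in> K" "b \<in> K" "cm a b \<noteq> \<one>"
  shows "card K = p ^ 2 * card (centr K {a, b})"
proof -
  note [simp] = subgroup.mem_carrier[OF K]
  let ?D = "{..<p} \<times> {..<p} \<times> centr K {a, b}"
  define f where "f = (\<lambda>(i::nat, j::nat, x). a [^] i \<otimes> b [^] j \<otimes> x)"
  have cK: "x \<in> K" if "x \<in> centr K {a, b}" for x using that by (simp add: centr_def)
  have ba: "cm b a \<noteq> \<one>" using ab by (simp add: cm_one_iff)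
  have "inj_on f ?D"
  proof (rule inj_onI, clarsimp simp: f_def)
    fix i j x i' j' x'
    assume *: "i < p" "j < p" "x \<in> centr K {a, b}" "i' < p" "j' < p" "x' \<in> centr K {a, b}"
      and eq: "a [^] i \<otimes> b [^] j \<otimes> x = a [^] i' \<otimes> b [^] j' \<otimes> x'"
    have 1: "cm x a = \<one>" "cm x b = \<one>" "cm x' a = \<one>" "cm x' b = \<one>"
      using * ab by (auto simp: centr_def cm_one_iff)
    have "cm a b [^] i = cm a b [^] i'" "cm b a [^] j = cm b a [^] j'"
      using cm_pair[of a b x i j] cm_pair[of a b x' i' j'] * 1 ab by (auto simp: cK eq)
    then have "i = i'" "j = j'"
      using C_pow_inj[OF cm_C ab(3)] C_pow_inj[OF cm_C ba] * ab by auto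
    then show "i = i' \<and> j = j' \<and> x = x'" using eq * ab by (simp add: cK l_cancel)
  qed
  moreover have "f ` ?D = K"
  proof (rule equalityI)
    show "f ` ?D \<subseteq> K"
      by (auto simp: f_def cK ab intro!: subgroup.m_closed[OF K] subgroup_pow_closed[OF K])
    show "K \<subseteq> f ` ?D"
    proof
      fix g assume "g \<in> K"
      from split_pair[OF K ab this] obtain i j x where
        "i < p" "j < p" "x \<in> centr K {a, b}" "g = a [^] i \<otimes> b [^] j \<otimes> x" by blast
      then show "g \<in> f ` ?D" by (intro image_eqI[of _ _ "(i, j, x)"]) (auto simp: f_def)
    qed
  qed
  ultimately have "card K = card ?D" using card_image by metis
  then show ?thesis by (simp add: card_cartesian_product power2_eq_square)
qed

section \<open>Duality for the commutator form\<close>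

lemma finite_sub: "subgroup K G \<Longrightarrow> finite K"
  using fin finite_subset subgroup.subset by blast

lemma card_subgroup_pos: "subgroup K G \<Longrightarrow> card K > 0"
  using finite_sub subgroup.one_closed card_gt_0_iff by fast

lemma subcenter_noncommuting:
  assumes "K \<noteq> subcenter G K" "subgroup K G"
  obtains a b where "a \<in> K" "b \<in> K" "cm a b \<noteq> \<one>"
  using assms subgroup.mem_carrier[OF assms(2)] by (auto simp: subcenter_def cm_one_iff)

text \<open>An alternating form has even dimension modulo its radical: each noncommuting pair
  accounts for a factor \<open>p ^ 2\<close>, and the induction ends when the group equals its own
  center.\<close>

lemma card_subcenter_even:
  "subgroup U G \<Longrightarrow> \<exists>j. card U = card (subcenter G U) * p ^ (2 * j)"
proof (induction "card U" arbitrary: U rule: less_induct)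
  case less
  show ?case
  proof (cases "U = subcenter G U")
    case True
    then show ?thesis by (intro exI[of _ 0]) simp
  next
    case False
    then obtain a b where ab: "a \<in> U" "b \<in> U" "cm a b \<noteq> \<one>"
      using subcenter_noncommuting less.prems by blast
    have sub: "subgroup (centr U {a, b}) G"
      using ab subgroup.mem_carrier[OF less.prems] by (intro subgroup_centr less.prems) auto
    have "card (centr U {a, b}) < card U"
      using split_card[OF less.prems ab] card_subgroup_pos[OF sub] p_gt
        mult_less_mono1[of 1 "p ^ 2" "card (centr U {a, b})"] one_less_power[of p 2] by simp
    then obtain j where "card (centr U {a, b}) = card (subcenter G U) * p ^ (2 * j)"
      using less.hyps sub split_subcenter[OF less.prems ab] by metis
    then have "card U = card (subcenter G U) * p ^ (2 * Suc j)"
      by (simp add: split_card[OF less.prems ab] power_add power2_eq_square)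
    then show ?thesis by blast
  qed
qed

lemma subcenter_carrier: "subcenter G (carrier G) = Z"
  by (simp add: subcenter_def center_def)

text \<open>Index parity forces a subgroup of index \<open>p\<close> to have a center larger than \<open>Z(G)\<close>; the subgroup is the
  centralizer of any further element of its center.\<close>

lemma maximal_subgroup_dual:
  assumes U: "subgroup U G" "Z \<subseteq> U" "card (carrier G) = p * card U"
  obtains u where "u \<in> U" "u \<notin> Z" "\<And>g. g \<in> carrier G \<Longrightarrow> g \<in> U \<longleftrightarrow> cm g u = \<one>"
proof -
  note [simp] = subgroup.mem_carrier[OF U(1)]
  have ZU: "Z \<subseteq> subcenter G U"
  proof
    fix x assume x: "x \<in> Z"
    then have "x \<otimes> y = y \<otimes> x" if "y \<in> U" for y using that by (simp add: Z_comm[OF x])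
    then show "x \<in> subcenter G U" using x U(2) by (auto simp: subcenter_def)
  qed
  have "subcenter G U \<noteq> Z"
  proof
    assume eq: "subcenter G U = Z"
    obtain j where "card U = card Z * p ^ (2 * j)"
      using card_subcenter_even[OF U(1)] unfolding eq by blast
    moreover obtain k where "card (carrier G) = card Z * p ^ (2 * k)"
      using card_subcenter_even[OF subgroup_self] unfolding subcenter_carrier by blast
    ultimately have "p ^ (2 * k) = p ^ (Suc (2 * j))"
      using U(3) card_subgroup_pos[OF subgroup_center] by simp
    then have "2 * k = Suc (2 * j)" using p_gt power_inject_exp[of p "2 * k" "Suc (2 * j)"] by simp
    then show False by presburger
  qed
  then obtain u where u: "u \<in> subcenter G U" "u \<notin> Z" using ZU by blast
  then have uU: "u \<in> U" by (simp add: subcenter_def)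
  define D where "D = centr (carrier G) {u}"
  have D: "subgroup D G" unfolding D_def using uU by (intro subgroup_centr subgroup_self) auto
  have UD: "U \<subseteq> D" using u by (auto simp: D_def centr_def subcenter_def)
  have "D \<noteq> carrier G"
  proof
    assume "D = carrier G"
    then have "g \<in> D" if "g \<in> carrier G" for g using that by simp
    then have "u \<otimes> g = g \<otimes> u" if "g \<in> carrier G" for g
      using that by (simp add: D_def centr_def)
    then have "u \<in> Z" using uU by (simp add: center_def)
    then show False using u by simp
  qed
  obtain m where m: "card D = card U * m" using subgroup_card_dvd[OF U(1) D UD] by auto
  obtain n where n: "card (carrier G) = card D * n"
    using subgroup_card_dvd[OF D subgroup_self subgroup.subset[OF D]] by auto
  \<comment> \<open>\<open>U\<close> has prime index, so nothing lies strictly between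
    \<open>U\<close> and \<open>G\<close>; the proper subgroup \<open>D\<close> above
    \<open>U\<close> must be \<open>U\<close>.\<close>
  have "card U * (m * n) = card D * n" by (simp only: m mult.assoc)
  also have "\<dots> = card U * p" unfolding n[symmetric] U(3) by (rule mult.commute)
  finally have "card U * (m * n) = card U * p" .
  from iffD1[OF nat_mult_eq_cancel1[OF card_subgroup_pos[OF U(1)]] this] have mn: "m * n = p" .
  have "n \<noteq> 1"
  proof
    assume "n = 1"
    then have "card D = card (carrier G)" unfolding n by (simp only: mult_1_right)
    then show False using card_subset_eq[OF fin subgroup.subset[OF D]] \<open>D \<noteq> carrier G\<close> by blast
  qed
  moreover have "Factorial_Ring.prime (m * n)" unfolding mn by (rule prime)
  ultimately have "m = 1" using prime_product[of m n] by blast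
  then have "card U = card D" unfolding m by (simp only: mult_1_right)
  then have "U = D" using card_subset_eq[OF finite_sub[OF D] UD] by blast
  moreover have "g \<in> D \<longleftrightarrow> cm g u = \<one>" if "g \<in> carrier G" for g
    using that uU by (simp add: D_def centr_def cm_one_iff)
  ultimately have "g \<in> U \<longleftrightarrow> cm g u = \<one>" if "g \<in> carrier G" for g
    using that by blast
  then show ?thesis using that uU u by blast
qed

section \<open>Subgroups generated by a noncommuting pair and central elements\<close>

lemma derived_eq_C:
  assumes H: "subgroup H G" and xy: "x \<in> H" "y \<in> H" "cm x y \<noteq> \<one>"
  shows "derived G H = C"
proof (rule equalityI)
  note [simp] = subgroup.mem_carrier[OF H]
  show "derived G H \<subseteq> C"
    using mono_derived[OF subgroup.subset[OF H]] unfolding derived .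
  have "cm x y \<in> derived G H"
    unfolding derived_def cm_def using xy by (intro generate.incl) auto
  then have "generate G {cm x y} \<subseteq> derived G H"
    by (intro generate_subgroup_incl derived_is_subgroup) (use subgroup.subset[OF H] in auto)
  then show "C \<subseteq> derived G H" using C_ord(2)[OF cm_C xy(3)] xy by simp
qed

lemma derived_cases:
  assumes H: "subgroup H G"
  shows "derived G H = {\<one>} \<or> derived G H = C"
proof (cases "\<exists>x\<in>H. \<exists>y\<in>H. cm x y \<noteq> \<one>")
  case False
  have "derived G H = {\<one>}"
  proof (rule derived_commuting[OF H])
    fix x y assume "x \<in> H" "y \<in> H"
    then show "x \<otimes> y = y \<otimes> x"
      using False cm_one_iff[of x y] subgroup.mem_carrier[OF H] by blast
  qed
  then show ?thesis by simp
qed (use derived_eq_C[OF H] in blast)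

text \<open>\<open>W\<close> is meant to be the center of the resulting group. The choices
  \<open>C\<close>, \<open>C\<close> times \<open><a^p>\<close>, and \<open><a^p>\<close> times
  \<open><b^p>\<close> lead to \<open>M_p(1,1,1)\<close>, \<open>M_p(u,1,1)\<close> and
  \<open>M_p(u,v)\<close>.\<close>

definition pair_group :: "'a \<Rightarrow> 'a \<Rightarrow> 'a set \<Rightarrow> 'a set" where
  "pair_group a b W = {a [^] (i::nat) \<otimes> b [^] (j::nat) \<otimes> w | i j w. w \<in> W}"

context
  fixes a b W
  assumes ab [simp]: "a \<in> carrier G" "b \<in> carrier G" and cmab: "cm a b \<noteq> \<one>"
    and W: "subgroup W G" "C \<subseteq> W" "W \<subseteq> Z" and pow: "a [^] p \<in> W" "b [^] p \<in> W"
begin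

lemma cmba: "cm b a \<noteq> \<one>"
  using cmab by (simp add: cm_one_iff)

lemma W_closed: "w \<in> W \<Longrightarrow> w \<in> carrier G" using W(1) subgroup.mem_carrier by metis

lemma W_comm: "w \<in> W \<Longrightarrow> x \<in> carrier G \<Longrightarrow> w \<otimes> x = x \<otimes> w" using W(3) Z_comm by blast

lemma cm_W: "w \<in> W \<Longrightarrow> x \<in> carrier G \<Longrightarrow> cm w x = \<one>" using W(3) cm_center by blast

lemma pair_groupI: "w \<in> W \<Longrightarrow> a [^] (i::nat) \<otimes> b [^] (j::nat) \<otimes> w \<in> pair_group a b W"
  by (auto simp: pair_group_def)

lemma pair_group_mem: "a \<in> pair_group a b W" "b \<in> pair_group a b W" "W \<subseteq> pair_group a b W"
  using pair_groupI[of \<one> 1 0] pair_groupI[of \<one> 0 1] pair_groupI[of _ 0 0] subgroup.one_closed[OF W(1)]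
  by (auto simp: W_closed)

lemma subgroup_pair_group: "subgroup (pair_group a b W) G"
proof (rule subgroupI)
  show "pair_group a b W \<subseteq> carrier G" by (auto simp: pair_group_def W_closed)
  show "pair_group a b W \<noteq> {}" using pair_group_mem by blast
  have mult: "x \<otimes> y \<in> pair_group a b W" if xy: "x \<in> pair_group a b W" "y \<in> pair_group a b W" for x y
  proof -
    obtain i j w where x: "w \<in> W" "x = a [^] (i::nat) \<otimes> b [^] (j::nat) \<otimes> w"
      using xy by (auto simp: pair_group_def)
    obtain i' j' w' where y: "w' \<in> W" "y = a [^] (i'::nat) \<otimes> b [^] (j'::nat) \<otimes> w'"
      using xy by (auto simp: pair_group_def)
    define d where "d = cm (b [^] j) (a [^] i')"
    have dW: "d \<in> W" unfolding d_def using cm_C W(2) by auto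
    note [simp] = W_closed[OF x(1)] W_closed[OF y(1)] W_closed[OF dW]
    have "x \<otimes> y = a [^] i \<otimes> b [^] j \<otimes> (w \<otimes> (a [^] i' \<otimes> b [^] j')) \<otimes> w'"
      by (simp add: x y m_assoc)
    also have "\<dots> = a [^] i \<otimes> b [^] j \<otimes> ((a [^] i' \<otimes> b [^] j') \<otimes> w) \<otimes> w'"
      by (simp add: W_comm[OF x(1)])
    also have "\<dots> = a [^] i \<otimes> (b [^] j \<otimes> a [^] i') \<otimes> b [^] j' \<otimes> w \<otimes> w'"
      by (simp add: m_assoc)
    also have "b [^] j \<otimes> a [^] i' = d \<otimes> (a [^] i' \<otimes> b [^] j)"
      unfolding d_def by (rule swap) simp_all
    also have "a [^] i \<otimes> (d \<otimes> (a [^] i' \<otimes> b [^] j)) \<otimes> b [^] j' \<otimes> w \<otimes> w' =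
        a [^] i \<otimes> (d \<otimes> (a [^] i' \<otimes> b [^] j \<otimes> b [^] j')) \<otimes> w \<otimes> w'" by (simp add: m_assoc)
    also have "\<dots> = a [^] i \<otimes> ((a [^] i' \<otimes> b [^] j \<otimes> b [^] j') \<otimes> d) \<otimes> w \<otimes> w'"
      by (subst W_comm[OF dW]) simp_all
    also have "\<dots> = (a [^] i \<otimes> a [^] i') \<otimes> (b [^] j \<otimes> b [^] j') \<otimes> (d \<otimes> w \<otimes> w')"
      by (simp add: m_assoc)
    also have "\<dots> = a [^] (i + i') \<otimes> b [^] (j + j') \<otimes> (d \<otimes> w \<otimes> w')"
      by (simp only: nat_pow_mult ab)
    finally have "x \<otimes> y = a [^] (i + i') \<otimes> b [^] (j + j') \<otimes> (d \<otimes> w \<otimes> w')" .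
    then show ?thesis using pair_groupI[of "d \<otimes> w \<otimes> w'"] dW x(1) y(1) subgroup.m_closed[OF W(1)]
      by simp
  qed
  then show "x \<otimes> y \<in> pair_group a b W" if "x \<in> pair_group a b W" "y \<in> pair_group a b W" for x y
    using that .
  fix x assume x: "x \<in> pair_group a b W"
  then have xc: "x \<in> carrier G" by (auto simp: pair_group_def W_closed)
  have "x [^] (n::nat) \<in> pair_group a b W" for n
    by (induction n) (use x mult pair_group_mem(3) subgroup.one_closed[OF W(1)] in auto)
  moreover have "x [^] ord x = \<one>" "ord x > 0" using xc ord_ge_1[OF fin xc] by auto
  ultimately show "inv x \<in> pair_group a b W" using inv_eq_pow[OF xc] by metis
qed

text \<open>Commuting with \<open>b\<close> and \<open>a\<close> forces \<open>p\<close> to divide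
  the exponents \<open>i\<close> and \<open>j\<close>, and \<open>a^p\<close>, \<open>b^p\<close>
  already lie in \<open>W\<close>.\<close>

lemma pair_group_center: "pair_group a b W \<inter> Z = W"
proof (rule equalityI)
  show "W \<subseteq> pair_group a b W \<inter> Z" using pair_group_mem W by blast
  show "pair_group a b W \<inter> Z \<subseteq> W"
  proof
    fix x assume x: "x \<in> pair_group a b W \<inter> Z"
    then obtain i j w where w: "w \<in> W" "x = a [^] (i::nat) \<otimes> b [^] (j::nat) \<otimes> w"
      by (auto simp: pair_group_def)
    have "cm a b [^] i = \<one>" "cm b a [^] j = \<one>"
      using cm_pair[of a b w i j, folded w(2)] x w(1) by (auto simp: cm_center cm_W W_closed)
    then have "p dvd i" "p dvd j" using C_pow_one[OF cm_C] cmab cmba by auto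
    then obtain i' j' where "i = p * i'" "j = p * j'" by (meson dvdE)
    then have "a [^] i \<in> W" "b [^] j \<in> W"
      using pow subgroup_pow_closed[OF W(1)] by (simp_all add: nat_pow_pow[symmetric])
    then show "x \<in> W" using w subgroup.m_closed[OF W(1)] by simp
  qed
qed

lemma pair_group_derived: "derived G (pair_group a b W) = C"
  using derived_eq_C[OF subgroup_pair_group pair_group_mem(1,2) cmab] .

lemma pair_group_comm:
  assumes "x \<in> pair_group a b W" "y \<in> centr K {a, b}" "y \<in> carrier G"
  shows "x \<otimes> y = y \<otimes> x"
proof -
  obtain i j w where w: "w \<in> W" "x = a [^] (i::nat) \<otimes> b [^] (j::nat) \<otimes> w"
    using assms by (auto simp: pair_group_def)
  have "cm a y = \<one>" "cm b y = \<one>" using assms by (auto simp: cm_one_iff centr_def)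
  then have "cm x y = \<one>" using assms w by (simp add: cm_mult_left cm_pow_left cm_W W_closed)
  then show ?thesis using assms w by (simp add: cm_one_iff W_closed)
qed

lemma pair_group_sub:
  assumes "subgroup K G" "a \<in> K" "b \<in> K" "W \<subseteq> K"
  shows "pair_group a b W \<subseteq> K"
  using assms by (auto simp: pair_group_def intro!: subgroup.m_closed subgroup_pow_closed)

lemma pair_group_mult:
  assumes "subgroup K G" "a \<in> K" "b \<in> K" "W \<subseteq> K"
  shows "pair_group a b W <#> centr K {a, b} = K"
proof (rule equalityI)
  show "pair_group a b W <#> centr K {a, b} \<subseteq> K"
    using pair_group_sub[OF assms] subgroup.m_closed[OF assms(1)]
    by (auto simp: mem_set_mult centr_def subset_iff)
  show "K \<subseteq> pair_group a b W <#> centr K {a, b}"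
  proof
    fix g assume "g \<in> K"
    then obtain i j x where x: "x \<in> centr K {a, b}" "g = a [^] (i::nat) \<otimes> b [^] (j::nat) \<otimes> x"
      using split_pair[OF assms(1-3) cmab] by blast
    moreover have "a [^] i \<otimes> b [^] j \<in> pair_group a b W"
      using pair_groupI[OF subgroup.one_closed[OF W(1)], of i j] by simp
    ultimately show "g \<in> pair_group a b W <#> centr K {a, b}" by (auto simp: mem_set_mult)
  qed
qed

end

text \<open>\<open>int\<close> makes \<open>a\<close> independent of the commutator:
  \<open><a^p>\<close> avoids \<open>C\<close>, so a relation \<open>a^i d^k = 1\<close> with
  \<open>p\<close> dividing \<open>i\<close> splits into two. The conclusions on \<open>W\<close>
  are the standing assumptions for \<open>pair_group\<close>, ready to be passed on when the pair is
  attached.\<close>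

lemma pair_group_M3:
  assumes ab [simp]: "a \<in> carrier G" "b \<in> carrier G" and cmab: "cm a b \<noteq> \<one>"
    and ord: "ord a = p ^ u" "b [^] p = \<one>" and aZ: "a [^] p \<in> Z"
    and int: "generate G {a [^] p} \<inter> C \<subseteq> {\<one>}"
    and W: "W = C <#> generate G {a [^] p}"
  shows "Mp3 p u 1 (G\<lparr>carrier := pair_group a b W\<rparr>)"
    and "subgroup W G" "C \<subseteq> W" "W \<subseteq> Z" "a [^] p \<in> W" "b [^] p \<in> W"
proof -
  have A: "subgroup (generate G {a [^] p}) G" by (rule generate_is_subgroup) simp
  have AZ: "generate G {a [^] p} \<subseteq> Z"
    using generate_subgroup_incl[OF _ subgroup_center] aZ by simp
  show W1: "subgroup W G" unfolding W
    using Z_comm C_Z subgroup.mem_carrier[OF A] by (intro subgroup_commuting_set_mult subgroup_C A) blast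
  note WW = set_mult_upper[OF subgroup_C A]
  show W2: "C \<subseteq> W" using WW W by simp
  show W3: "W \<subseteq> Z" unfolding W using C_sub_Z AZ subgroup.m_closed[OF subgroup_center]
    by (auto simp: mem_set_mult subset_iff)
  show W4: "a [^] p \<in> W" using WW generate.incl[of "a [^] p" "{a [^] p}" G] W by auto
  show W5: "b [^] p \<in> W" using subgroup.one_closed[OF W1] ord by simp
  note ctx = ab cmab W1 W2 W3 W4 W5
  let ?M = "pair_group a b W"
  have M: "subgroup ?M G" by (rule subgroup_pair_group[OF ctx])
  interpret M: group "G\<lparr>carrier := ?M\<rparr>" using M by (rule subgroup_imp_group)
  define d where "d = cm a b"
  have d: "d \<in> C" "d \<noteq> \<one>" using cmab by (auto simp: d_def cm_C)
  note [simp] = C_closed[OF d(1)]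
  have powM: "x [^]\<^bsub>G\<lparr>carrier := ?M\<rparr>\<^esub> (n::nat) = x [^] n" for x n
    by (simp add: nat_pow_consistent[symmetric])
  have mem: "a \<in> ?M" "b \<in> ?M" "d \<in> ?M"
    using pair_group_mem[OF ctx] W2 d by auto
  have "?M \<subseteq> generate G {a, b, d}"
  proof
    fix x assume "x \<in> ?M"
    then obtain i j w where w: "w \<in> W" "x = a [^] (i::nat) \<otimes> b [^] (j::nat) \<otimes> w"
      by (auto simp: pair_group_def)
    then obtain e y where ey: "e \<in> C" "y \<in> generate G {a [^] p}" "w = e \<otimes> y"
      by (auto simp: W mem_set_mult)
    have g: "subgroup (generate G {a, b, d}) G" by (rule generate_is_subgroup) simp
    have gi: "a \<in> generate G {a, b, d}" "b \<in> generate G {a, b, d}" "d \<in> generate G {a, b, d}"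
      by (auto intro: generate.incl)
    have "generate G {d} \<subseteq> generate G {a, b, d}" "generate G {a [^] p} \<subseteq> generate G {a, b, d}"
      using gi by (auto intro!: generate_subgroup_incl[OF _ g] subgroup_pow_closed[OF g])
    then have "e \<in> generate G {a, b, d}" "y \<in> generate G {a, b, d}"
      using C_ord(2)[OF d] ey by auto
    then show "x \<in> generate G {a, b, d}"
      unfolding w ey using gi by (intro subgroup.m_closed[OF g] subgroup_pow_closed[OF g])
  qed
  then have gen: "?M = generate (G\<lparr>carrier := ?M\<rparr>) {a, b, d}"
    using generate_consistent[OF _ M, of "{a, b, d}"] generate_subgroup_incl[OF _ M, of "{a, b, d}"] mem
    by auto
  have "G\<lparr>carrier := ?M\<rparr> \<cong> M3 p u 1"
  proof (rule M.iso_M3[of p a b d])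
    show "a \<otimes>\<^bsub>G\<lparr>carrier := ?M\<rparr>\<^esub> b = b \<otimes>\<^bsub>G\<lparr>carrier := ?M\<rparr>\<^esub> a \<otimes>\<^bsub>G\<lparr>carrier := ?M\<rparr>\<^esub> d"
      using swap[of a b] Z_comm[OF C_Z[OF d(1)], of "b \<otimes> a"] by (simp add: d_def)
    show "a [^]\<^bsub>G\<lparr>carrier := ?M\<rparr>\<^esub> (p ^ u) = \<one>\<^bsub>G\<lparr>carrier := ?M\<rparr>\<^esub>"
      unfolding powM using pow_ord_eq_1[OF ab(1)] ord by simp
    show "p ^ u dvd i \<and> p ^ 1 dvd j \<and> p dvd k"
      if "b [^]\<^bsub>G\<lparr>carrier := ?M\<rparr>\<^esub> (j::nat) \<otimes>\<^bsub>G\<lparr>carrier := ?M\<rparr>\<^esub> a [^]\<^bsub>G\<lparr>carrier := ?M\<rparr>\<^esub> (i::nat)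
        \<otimes>\<^bsub>G\<lparr>carrier := ?M\<rparr>\<^esub> d [^]\<^bsub>G\<lparr>carrier := ?M\<rparr>\<^esub> (k::nat) = \<one>\<^bsub>G\<lparr>carrier := ?M\<rparr>\<^esub>" for i j k
    proof -
      have eq: "b [^] j \<otimes> a [^] i \<otimes> d [^] k = \<one>" using that by (simp add: powM)
      have dk: "d [^] k \<in> C" by (rule subgroup_pow_closed[OF subgroup_C d(1)])
      \<comment> \<open>Taking commutators of the relation with \<open>a\<close> and with
        \<open>b\<close> isolates the exponents; the central power of \<open>d\<close> drops
        out.\<close>
      have "cm b a [^] j \<otimes> cm (d [^] k) a = \<one>" "cm a b [^] i \<otimes> cm (d [^] k) b = \<one>"
        using cm_pair[of b a "d [^] k" j i, unfolded eq, symmetric] by simp_all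
      then have "cm b a [^] j = \<one>" "cm a b [^] i = \<one>"
        using cm_center(1)[OF C_Z[OF dk]] by auto
      moreover have "cm b a \<noteq> \<one>" using cmab by (simp add: cm_one_iff)
      ultimately have pj: "p dvd j" and pi: "p dvd i" using C_pow_one[OF cm_C] cmab by auto
      then obtain j' i' where j': "j = p * j'" and i': "i = p * i'" by (meson dvdE)
      then have bj: "b [^] j = \<one>" using ord by (simp add: nat_pow_pow[symmetric])
      have ai: "a [^] i \<otimes> d [^] k = \<one>" using eq bj by simp
      have "a [^] i = inv (d [^] k)" using ai by (intro inv_equality[symmetric]) simp_all
      then have "a [^] i \<in> C" using subgroup.m_inv_closed[OF subgroup_C dk] by simp
      moreover have "a [^] i \<in> generate G {a [^] p}"
        using subgroup_pow_closed[OF A generate.incl[of "a [^] p" "{a [^] p}"], of i']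
        by (simp add: i' nat_pow_pow)
      ultimately have a1: "a [^] i = \<one>" using int by blast
      then have "p ^ u dvd i" using pow_eq_id[OF ab(1)] ord by simp
      moreover have "d [^] k = \<one>" using ai a1 by simp
      then have "p dvd k" using C_pow_one[OF d] by simp
      ultimately show ?thesis using pj by simp
    qed
  qed (use mem gen p_pos ord C_pow_p[OF d(1)] Z_comm[OF C_Z[OF d(1)]] in \<open>simp_all add: powM\<close>)
  then show "Mp3 p u 1 (G\<lparr>carrier := ?M\<rparr>)" by (simp add: Mp3_def iso_to_def)
qed

text \<open>Here the commutator is a power of \<open>a\<close>, in fact of \<open>a^p\<close>
  because \<open>u \<ge> 2\<close>. Hence \<open>C\<close> lies in \<open><a^p>\<close>, and
  \<open>W\<close> has no separate factor for it.\<close>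

lemma pair_group_M2:
  assumes ab [simp]: "a \<in> carrier G" "b \<in> carrier G" and cmab: "cm a b \<noteq> \<one>"
    and ord: "ord a = p ^ u" "ord b = p ^ v" and u: "u \<ge> 2"
    and Zp: "a [^] p \<in> Z" "b [^] p \<in> Z"
    and cm_eq: "cm a b = a [^] (p ^ (u - 1))"
    and int: "generate G {a [^] p} \<inter> generate G {b [^] p} \<subseteq> {\<one>}"
    and W: "W = generate G {a [^] p} <#> generate G {b [^] p}"
  shows "Mp2 p u v (G\<lparr>carrier := pair_group a b W\<rparr>)"
    and "subgroup W G" "C \<subseteq> W" "W \<subseteq> Z" "a [^] p \<in> W" "b [^] p \<in> W"
proof -
  let ?A = "generate G {a [^] p}" and ?B = "generate G {b [^] p}"
  have A: "subgroup ?A G" and B: "subgroup ?B G" by (rule generate_is_subgroup, simp)+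
  have AZ: "?A \<subseteq> Z" and BZ: "?B \<subseteq> Z"
    using generate_subgroup_incl[OF _ subgroup_center] Zp by simp_all
  have apA: "a [^] (p * n) \<in> ?A" and bpB: "b [^] (p * n) \<in> ?B" for n :: nat
    using subgroup_pow_closed[OF A generate.incl[of "a [^] p" "{a [^] p}"], of n]
      subgroup_pow_closed[OF B generate.incl[of "b [^] p" "{b [^] p}"], of n]
    by (simp_all add: nat_pow_pow)
  show W1: "subgroup W G" unfolding W
    using Z_comm AZ subgroup.mem_carrier[OF B] by (intro subgroup_commuting_set_mult A B) blast
  note WW = set_mult_upper[OF A B]
  have "p ^ (u - 1) = p * p ^ (u - 2)"
    using u by (metis Suc_diff_le diff_Suc_Suc numeral_2_eq_2 power_Suc One_nat_def)
  then have "cm a b \<in> ?A" using apA[of "p ^ (u - 2)"] cm_eq by simp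
  then have "generate G {cm a b} \<subseteq> ?A" using generate_subgroup_incl[OF _ A] by simp
  then have CA: "C \<subseteq> ?A" using C_ord(2)[OF cm_C cmab] by simp
  show W2: "C \<subseteq> W" using CA WW W by simp
  show W3: "W \<subseteq> Z" unfolding W using AZ BZ subgroup.m_closed[OF subgroup_center]
    by (auto simp: mem_set_mult subset_iff)
  show W4: "a [^] p \<in> W" using WW apA[of 1] W by auto
  show W5: "b [^] p \<in> W" using WW bpB[of 1] W by auto
  note ctx = ab cmab W1 W2 W3 W4 W5
  let ?M = "pair_group a b W"
  have M: "subgroup ?M G" by (rule subgroup_pair_group[OF ctx])
  interpret M: group "G\<lparr>carrier := ?M\<rparr>" using M by (rule subgroup_imp_group)
  have powM: "x [^]\<^bsub>G\<lparr>carrier := ?M\<rparr>\<^esub> (n::nat) = x [^] n" for x n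
    by (simp add: nat_pow_consistent[symmetric])
  have mem: "a \<in> ?M" "b \<in> ?M"
    using pair_group_mem[OF ctx] by auto
  have "?M \<subseteq> generate G {a, b}"
  proof
    fix x assume "x \<in> ?M"
    then obtain i j w where w: "w \<in> W" "x = a [^] (i::nat) \<otimes> b [^] (j::nat) \<otimes> w"
      by (auto simp: pair_group_def)
    then obtain e y where ey: "e \<in> ?A" "y \<in> ?B" "w = e \<otimes> y"
      by (auto simp: W mem_set_mult)
    have g: "subgroup (generate G {a, b}) G" by (rule generate_is_subgroup) simp
    have gi: "a \<in> generate G {a, b}" "b \<in> generate G {a, b}"
      by (auto intro: generate.incl)
    have "?A \<subseteq> generate G {a, b}" "?B \<subseteq> generate G {a, b}"
      using gi by (auto intro!: generate_subgroup_incl[OF _ g] subgroup_pow_closed[OF g])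
    then have "e \<in> generate G {a, b}" "y \<in> generate G {a, b}" using ey by auto
    then show "x \<in> generate G {a, b}"
      unfolding w ey using gi by (intro subgroup.m_closed[OF g] subgroup_pow_closed[OF g])
  qed
  then have gen: "?M = generate (G\<lparr>carrier := ?M\<rparr>) {a, b}"
    using generate_consistent[OF _ M, of "{a, b}"] generate_subgroup_incl[OF _ M, of "{a, b}"] mem
    by auto
  have "G\<lparr>carrier := ?M\<rparr> \<cong> M2 p u v"
  proof (rule M.iso_M2[of p a b])
    have "a \<otimes> b = (b \<otimes> a) \<otimes> cm a b"
      using swap[of a b] Z_comm[OF cm_Z[of a b], of "b \<otimes> a"] by simp
    also have "\<dots> = b \<otimes> (a \<otimes> a [^] (p ^ (u - 1)))" by (simp add: m_assoc cm_eq)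
    also have "\<dots> = b \<otimes> a [^] (1 + p ^ (u - 1))" 
      using nat_pow_mult[OF ab(1), of 1 "p ^ (u - 1)"] by (simp only: nat_pow_eone[OF ab(1)])
    finally show "a \<otimes>\<^bsub>G\<lparr>carrier := ?M\<rparr>\<^esub> b =
        b \<otimes>\<^bsub>G\<lparr>carrier := ?M\<rparr>\<^esub> a [^]\<^bsub>G\<lparr>carrier := ?M\<rparr>\<^esub> (1 + p ^ (u - 1))"
      unfolding powM by simp
    show "p ^ u dvd i \<and> p ^ v dvd j"
      if "b [^]\<^bsub>G\<lparr>carrier := ?M\<rparr>\<^esub> (j::nat) \<otimes>\<^bsub>G\<lparr>carrier := ?M\<rparr>\<^esub> a [^]\<^bsub>G\<lparr>carrier := ?M\<rparr>\<^esub> (i::nat)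
        = \<one>\<^bsub>G\<lparr>carrier := ?M\<rparr>\<^esub>" for i j
    proof -
      have eq: "b [^] j \<otimes> a [^] i = \<one>" using that by (simp add: powM)
      have "cm b a [^] j = \<one>" "cm a b [^] i = \<one>"
        using cm_pair[of b a \<one> j i, symmetric] eq by simp_all
      moreover have "cm b a \<noteq> \<one>" using cmab by (simp add: cm_one_iff)
      ultimately have "p dvd j" and "p dvd i" using C_pow_one[OF cm_C] cmab by auto
      then obtain j' i' where j': "j = p * j'" and i': "i = p * i'" by (meson dvdE)
      have "b [^] j = inv (a [^] i)" using eq by (intro inv_equality[symmetric]) simp_all
      then have "b [^] j \<in> ?A" using subgroup.m_inv_closed[OF A apA] i' by simp
      then have b1: "b [^] j = \<one>" using bpB j' int by blast
      then have "a [^] i = \<one>" using eq by simp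
      then show ?thesis using b1 pow_eq_id ord by simp
    qed
  qed (use mem gen p_pos ord pow_ord_eq_1[OF ab(1)] pow_ord_eq_1[OF ab(2)] in \<open>simp_all add: powM\<close>)
  then show "Mp2 p u v (G\<lparr>carrier := ?M\<rparr>)" by (simp add: Mp2_def iso_to_def)
qed

section \<open>Central products of extraspecial groups of exponent \<open>p\<close>\<close>

text \<open>A formulation without a basis of the vanishing of both power functionals on
  \<open>K\<close>: the \<open>p\<close>-th power of each \<open>g\<close> is also the
  \<open>p\<close>-th power of a central element.\<close>

definition exp_adjustable :: "'a set \<Rightarrow> bool" where
  "exp_adjustable K \<longleftrightarrow> (\<forall>g\<in>K. \<exists>w\<in>Z. (g \<otimes> w) [^] p = \<one>)"

lemma exp_adjustable_mono: "exp_adjustable K \<Longrightarrow> L \<subseteq> K \<Longrightarrow> exp_adjustable L"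
  by (auto simp: exp_adjustable_def)

lemma cm_adjust:
  "x \<in> carrier G \<Longrightarrow> y \<in> carrier G \<Longrightarrow> w \<in> Z \<Longrightarrow> cm (x \<otimes> w) y = cm x y"
  "x \<in> carrier G \<Longrightarrow> y \<in> carrier G \<Longrightarrow> w \<in> Z \<Longrightarrow> cm x (y \<otimes> w) = cm x y"
  by (simp_all add: cm_mult_left cm_mult_right cm_center Z_closed)

text \<open>If \<open>x \<otimes> m\<close> is central, then \<open>m\<close> commutes with
  \<open>K\<close> because the product and \<open>x\<close> do. The alternative \<open>x = m\<close>
  covers elements common to \<open>S\<close> and \<open>K\<close>.\<close>

lemma central_factor:
  assumes "subgroup S G" "subgroup K G" "\<And>x y. x \<in> S \<Longrightarrow> y \<in> K \<Longrightarrow> x \<otimes> y = y \<otimes> x"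
    and "subcenter G K = Z" "m \<in> K" "x \<in> S" "x \<otimes> m \<in> Z \<or> x = m"
  shows "m \<in> Z"
proof -
  note [simp] = subgroup.mem_carrier[OF assms(1)] subgroup.mem_carrier[OF assms(2)]
  have "m \<otimes> y = y \<otimes> m" if y: "y \<in> K" for y
  proof (cases "x = m")
    case False
    then have "cm (x \<otimes> m) y = \<one>" using assms y by (auto simp: cm_center)
    moreover have "cm x y = \<one>" using assms y by (simp add: cm_one_iff)
    ultimately show ?thesis using assms y by (simp add: cm_mult_left cm_one_iff)
  qed (use assms y in auto)
  then show ?thesis using assms(4,5) by (auto simp: subcenter_def)
qed

text \<open>One step of the construction: \<open>S\<close> is the product built so far and
  \<open>K\<close> the part still to be decomposed. A pair in \<open>K\<close> contributes its pair
  group to \<open>S\<close> and leaves its centralizer as the new \<open>K\<close>. The conclusions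
  restore the hypotheses on \<open>S\<close> and \<open>K\<close>, and the formula for
  \<open>S' \<inter> Z\<close> records the absorbed central elements. By \<open>XW\<close> exactly
  \<open>C\<close> is amalgamated.\<close>

lemma attach_pair:
  assumes S: "subgroup S G" "C \<subseteq> S" and K: "subgroup K G" "Z \<subseteq> K" "subcenter G K = Z"
    and comm: "\<And>x y. x \<in> S \<Longrightarrow> y \<in> K \<Longrightarrow> x \<otimes> y = y \<otimes> x"
    and ab: "a \<in> K" "b \<in> K" "cm a b \<noteq> \<one>"
    and W: "subgroup W G" "C \<subseteq> W" "W \<subseteq> Z" "a [^] p \<in> W" "b [^] p \<in> W"
    and XW: "S \<inter> W \<subseteq> C"
    and types: "central_products p L (G\<lparr>carrier := S\<rparr>)" "L \<noteq> []" "Q (G\<lparr>carrier := pair_group a b W\<rparr>)"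
  defines "S' \<equiv> S <#> pair_group a b W" and "K' \<equiv> centr K {a, b}"
  shows "subgroup S' G" "C \<subseteq> S'" "S \<subseteq> S'" "subgroup K' G" "Z \<subseteq> K'" "subcenter G K' = Z"
    "\<And>x y. x \<in> S' \<Longrightarrow> y \<in> K' \<Longrightarrow> x \<otimes> y = y \<otimes> x"
    "card K = p ^ 2 * card K'" "S' <#> K' = S <#> K" "K' \<subseteq> K"
    "S' \<inter> Z = (S \<inter> Z) <#> W"
    "central_products p (L @ [Q]) (G\<lparr>carrier := S'\<rparr>)"
proof -
  note [simp] = subgroup.mem_carrier[OF K(1)] subgroup.mem_carrier[OF S(1)]
  have abG: "a \<in> carrier G" "b \<in> carrier G" using ab by auto
  note ctx = abG ab(3) W
  let ?M = "pair_group a b W"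
  have M: "subgroup ?M G" by (rule subgroup_pair_group[OF ctx])
  have MK: "?M \<subseteq> K" using W(3) K by (intro pair_group_sub[OF ctx] ab) auto
  have XM: "x \<otimes> y = y \<otimes> x" if "x \<in> S" "y \<in> ?M" for x y using comm that MK by blast
  show S': "subgroup S' G" unfolding S'_def by (rule subgroup_commuting_set_mult[OF S(1) M XM])
  show XX': "S \<subseteq> S'" unfolding S'_def using set_mult_upper[OF S(1) M] by blast
  then show "C \<subseteq> S'" using S by blast
  show K': "subgroup K' G" unfolding K'_def using abG by (intro subgroup_centr K) auto
  show "Z \<subseteq> K'" unfolding K'_def using abG by (intro Z_sub_centr K) auto
  show "subcenter G K' = Z" unfolding K'_def using split_subcenter[OF K(1) ab] K by simp
  show KK: "K' \<subseteq> K" by (auto simp: K'_def centr_def)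
  show "card K = p ^ 2 * card K'" unfolding K'_def by (rule split_card[OF K(1) ab])
  show "x \<otimes> y = y \<otimes> x" if xy: "x \<in> S'" "y \<in> K'" for x y
  proof -
    obtain u v where x: "u \<in> S" "v \<in> ?M" "x = u \<otimes> v" using xy by (auto simp: S'_def mem_set_mult)
    have [simp]: "v \<in> carrier G" using x M subgroup.mem_carrier by metis
    have "u \<otimes> y = y \<otimes> u" using x xy KK comm by blast
    moreover have "v \<otimes> y = y \<otimes> v"
      using x xy KK unfolding K'_def by (intro pair_group_comm[OF ctx]) (auto simp: K'_def)
    ultimately show ?thesis using x xy KK by (auto intro!: comm_mult)
  qed
  show "S' <#> K' = S <#> K"
    unfolding S'_def K'_def using pair_group_mult[OF ctx K(1) ab(1,2)] W(3) K(2)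
      set_mult_assoc[OF subgroup.subset[OF S(1)] subgroup.subset[OF M] subgroup.subset[OF K'], unfolded K'_def]
    by simp
  have MZ: "?M \<inter> Z = W" by (rule pair_group_center[OF ctx])
  show "S' \<inter> Z = (S \<inter> Z) <#> W"
  proof (rule equalityI; rule subsetI)
    fix x assume x: "x \<in> S' \<inter> Z"
    then obtain u v where uv: "u \<in> S" "v \<in> ?M" "x = u \<otimes> v" by (auto simp: S'_def mem_set_mult)
    have "v \<in> Z" using central_factor[OF S(1) K(1) comm K(3), of v u] uv x MK by auto
    then have v: "v \<in> W" using uv MZ by auto
    have "u = x \<otimes> inv v" using uv v W by (auto simp: m_assoc Z_closed subset_iff)
    then have "u \<in> Z" using x \<open>v \<in> Z\<close> subgroup_center
      by (simp add: subgroup.m_closed subgroup.m_inv_closed)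
    then show "x \<in> (S \<inter> Z) <#> W" using uv v by (auto simp: mem_set_mult)
  next
    fix x assume "x \<in> (S \<inter> Z) <#> W"
    then obtain u v where uv: "u \<in> S" "u \<in> Z" "v \<in> W" "x = u \<otimes> v" by (auto simp: mem_set_mult)
    then show "x \<in> S' \<inter> Z" using pair_group_mem(3)[OF ctx] W(3)
      by (auto simp: S'_def mem_set_mult subgroup.m_closed[OF subgroup_center] subset_iff)
  qed
  \<comment> \<open>A common element lies in \<open>K\<close> and commutes with it, so it is
    central; and the central elements of the pair group are those of \<open>W\<close>.\<close>
  have "S \<inter> ?M \<subseteq> C"
  proof
    fix x assume x: "x \<in> S \<inter> ?M"
    then have "x \<in> Z" using central_factor[OF S(1) K(1) comm K(3), of x x] MK by auto
    then show "x \<in> C" using x MZ XW by blast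
  qed
  then have int: "S \<inter> ?M = C" using S W pair_group_mem(3)[OF ctx] by blast
  show "central_products p (L @ [Q]) (G\<lparr>carrier := S'\<rparr>)"
    unfolding S'_def using derived_cases[OF S(1)] pair_group_derived[OF ctx] int card_C XM
    by (intro central_products_snoc S(1) M types) auto
qed

lemma set_mult_idem: "subgroup H G \<Longrightarrow> K \<subseteq> H \<Longrightarrow> \<one> \<in> K \<Longrightarrow> H <#> K = H"
proof (rule equalityI; rule subsetI)
  assume H: "subgroup H G" "K \<subseteq> H" "\<one> \<in> K"
  fix x
  show "x \<in> H" if "x \<in> H <#> K"
    using that H by (auto simp: mem_set_mult subset_iff intro: subgroup.m_closed)
  show "x \<in> H <#> K" if "x \<in> H" unfolding mem_set_mult
    using that H subgroup.mem_carrier[OF H(1)] by (intro bexI[of _ x] bexI[of _ \<one>]) auto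
qed

lemma Mp3_one:
  assumes "a \<in> carrier G" "b \<in> carrier G" "cm a b \<noteq> \<one>" "a [^] p = \<one>" "b [^] p = \<one>"
  shows "Mp3 p 1 1 (G\<lparr>carrier := pair_group a b C\<rparr>)"
proof -
  have "a \<noteq> \<one>" using assms by auto
  then have "ord a = p" using assms ord_eq_1[OF assms(1)] pow_eq_id[OF assms(1), of p] prime
    by (auto simp: prime_nat_iff)
  moreover have "generate G {a [^] p} = {\<one>}" using assms generate_one by simp
  moreover have "C = C <#> {\<one>}" using set_mult_idem[OF subgroup_C, of "{\<one>}"]
      subgroup.one_closed[OF subgroup_C] by simp
  ultimately show ?thesis using assms subgroup.one_closed[OF subgroup_center]
    by (intro pair_group_M3(1)) auto
qed

text \<open>Central factors make both \<open>p\<close>-th powers trivial and leave the commutator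
  unchanged.\<close>

lemma exponent_p_pair:
  assumes K: "subgroup K G" "Z \<subseteq> K" "subcenter G K = Z" "K \<noteq> Z" "exp_adjustable K"
  obtains a b where "a \<in> K" "b \<in> K" "cm a b \<noteq> \<one>" "a [^] p = \<one>" "b [^] p = \<one>"
proof -
  obtain a b where ab: "a \<in> K" "b \<in> K" "cm a b \<noteq> \<one>"
    using subcenter_noncommuting K by metis
  obtain w v where "w \<in> Z" "v \<in> Z" "(a \<otimes> w) [^] p = \<one>" "(b \<otimes> v) [^] p = \<one>"
    using K(5) ab by (meson exp_adjustable_def)
  then show ?thesis using that[of "a \<otimes> w" "b \<otimes> v"] ab K(2) subgroup.m_closed[OF K(1)]
      subgroup.mem_carrier[OF K(1)]
    by (auto simp: cm_adjust subset_iff)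
qed

text \<open>Induction on \<open>k\<close>, half the dimension of \<open>K\<close> modulo the center.
  Every step attaches a pair group with \<open>W = C\<close>, already contained in \<open>S\<close>,
  so the central part \<open>S \<inter> Z\<close> does not grow while \<open>K\<close> shrinks to
  \<open>Z\<close>.\<close>

lemma attach_exponent_p:
  assumes "subgroup S G" "C \<subseteq> S" "subgroup K G" "Z \<subseteq> K" "subcenter G K = Z"
    and "\<And>x y. x \<in> S \<Longrightarrow> y \<in> K \<Longrightarrow> x \<otimes> y = y \<otimes> x"
    and "card K = card Z * p ^ (2 * k)" "exp_adjustable K"
    and "central_products p L (G\<lparr>carrier := S\<rparr>)" "L \<noteq> []"
  shows "\<exists>Y. subgroup Y G \<and> C \<subseteq> Y \<and> Y \<inter> Z = S \<inter> Z \<and> Y <#> Z = S <#> K \<and>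
    central_products p (L @ replicate k (Mp3 p 1 1)) (G\<lparr>carrier := Y\<rparr>)"
  using assms
proof (induction k arbitrary: S K L)
  case 0
  have "K = Z" using card_subset_eq[OF finite_sub[OF 0(3)] 0(4)] 0(7) by simp
  then show ?case using 0 by (intro exI[of _ S]) auto
next
  case (Suc k)
  have "p ^ (2 * Suc k) > 1" using p_gt by (intro one_less_power) auto
  then have "card K \<noteq> card Z" using Suc.prems(7) card_subgroup_pos[OF subgroup_center] p_gt by simp
  then have "K \<noteq> Z" by auto
  then obtain a b where ab: "a \<in> K" "b \<in> K" "cm a b \<noteq> \<one>" "a [^] p = \<one>" "b [^] p = \<one>"
    using exponent_p_pair Suc.prems by metis
  have one: "\<one> \<in> C" using subgroup.one_closed[OF subgroup_C] .
  have abG: "a \<in> carrier G" "b \<in> carrier G" using ab subgroup.mem_carrier[OF Suc.prems(3)] by auto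
  have W: "subgroup C G" "C \<subseteq> C" "C \<subseteq> Z" "a [^] p \<in> C" "b [^] p \<in> C"
    using subgroup_C C_sub_Z one ab by auto
  note att = attach_pair[where Q = "Mp3 p 1 1", OF Suc.prems(1-6) ab(1-3) W _ Suc.prems(9,10) Mp3_one[OF abG ab(3-5)]]
  let ?S = "S <#> pair_group a b C" and ?K = "centr K {a, b}"
  have "\<exists>Y. subgroup Y G \<and> C \<subseteq> Y \<and> Y \<inter> Z = ?S \<inter> Z \<and> Y <#> Z = ?S <#> ?K \<and>
    central_products p ((L @ [Mp3 p 1 1]) @ replicate k (Mp3 p 1 1)) (G\<lparr>carrier := Y\<rparr>)"
  proof (rule Suc.IH)
    have "p ^ 2 * card ?K = card K" using att(8) by simp
    also have "\<dots> = p ^ 2 * (card Z * p ^ (2 * k))"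
      unfolding Suc.prems(7) by (simp add: power2_eq_square)
    finally show "card ?K = card Z * p ^ (2 * k)" using p_pos by simp
    show "exp_adjustable ?K" using exp_adjustable_mono Suc.prems(8) att(10) by blast
  qed (use att in auto)
  moreover have "(S \<inter> Z) <#> C = S \<inter> Z"
    using Suc.prems(2) C_sub_Z one
    by (intro set_mult_idem subgroups_Inter_pair Suc.prems(1) subgroup_center) auto
  then have "?S \<inter> Z = S \<inter> Z" using att(11) by simp
  ultimately show ?case using att(9) by simp
qed

lemma set_mult_Int_center:
  assumes "subgroup Y G" "subgroup A G" "A \<subseteq> Z"
  shows "(Y <#> A) \<inter> Z = (Y \<inter> Z) <#> A"
proof (rule equalityI; rule subsetI)
  fix x assume "x \<in> (Y <#> A) \<inter> Z"
  then obtain y a where ya: "y \<in> Y" "a \<in> A" "x = y \<otimes> a" "x \<in> Z" by (auto simp: mem_set_mult)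
  then have "y = x \<otimes> inv a" using subgroup.mem_carrier[OF assms(1)] subgroup.mem_carrier[OF assms(2)]
    by (simp add: m_assoc)
  moreover have "x \<otimes> inv a \<in> Z" using ya assms(3)
    by (intro subgroup.m_closed[OF subgroup_center] subgroup.m_inv_closed[OF subgroup_center]) auto
  ultimately have "y \<in> Z" by simp
  then show "x \<in> (Y \<inter> Z) <#> A" using ya by (auto simp: mem_set_mult)
next
  fix x assume "x \<in> (Y \<inter> Z) <#> A"
  then show "x \<in> (Y <#> A) \<inter> Z" using assms(3) subgroup.m_closed[OF subgroup_center]
    by (auto simp: mem_set_mult subset_iff)
qed

section \<open>The isomorphism types\<close>

text \<open>An internal direct decomposition of the center, meant for the two main cyclic factors
  \<open>A\<close>, \<open>B\<close> and the elementary abelian rest \<open>E\<close>. The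
  elementwise form makes it easy to exchange \<open>A\<close> and \<open>B\<close>.\<close>

definition center_triple :: "'a set \<Rightarrow> 'a set \<Rightarrow> 'a set \<Rightarrow> bool" where
  "center_triple A B E \<longleftrightarrow> subgroup A G \<and> subgroup B G \<and> subgroup E G \<and>
     A \<subseteq> Z \<and> B \<subseteq> Z \<and> E \<subseteq> Z \<and> A <#> B <#> E = Z \<and>
     (\<forall>a\<in>A. \<forall>b\<in>B. \<forall>e\<in>E. a \<otimes> b \<otimes> e = \<one> \<longrightarrow> a = \<one> \<and> b = \<one> \<and> e = \<one>)"

lemma center_tripleD:
  assumes "center_triple A B E"
  shows "subgroup A G" "subgroup B G" "subgroup E G" "A \<subseteq> Z" "B \<subseteq> Z" "E \<subseteq> Z" "A <#> B <#> E = Z"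
    "\<And>a b e. a \<in> A \<Longrightarrow> b \<in> B \<Longrightarrow> e \<in> E \<Longrightarrow> a \<otimes> b \<otimes> e = \<one> \<Longrightarrow> a = \<one> \<and> b = \<one> \<and> e = \<one>"
  using assms unfolding center_triple_def by blast+

lemma Z_set_mult_comm: "A \<subseteq> Z \<Longrightarrow> B \<subseteq> carrier G \<Longrightarrow> A <#> B = B <#> A"
proof (rule equalityI; rule subsetI)
  assume AB: "A \<subseteq> Z" "B \<subseteq> carrier G"
  have comm: "a \<otimes> b = b \<otimes> a" if "a \<in> A" "b \<in> B" for a b using that AB by (intro Z_comm) auto
  fix x
  show "x \<in> B <#> A" if "x \<in> A <#> B" using that comm unfolding mem_set_mult by blast
  show "x \<in> A <#> B" if "x \<in> B <#> A"
    using that comm[symmetric] unfolding mem_set_mult by blast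
qed

lemma center_triple_swap:
  assumes "center_triple A B E"
  shows "center_triple B A E"
proof -
  note t = center_tripleD[OF assms]
  have "B <#> A = A <#> B" using t(4,5) Z_closed by (intro Z_set_mult_comm) auto
  then have "B <#> A <#> E = Z" using t(7) by simp
  moreover have "b = \<one> \<and> a = \<one> \<and> e = \<one>"
    if "b \<in> B" "a \<in> A" "e \<in> E" "b \<otimes> a \<otimes> e = \<one>" for a b e
  proof -
    have "b \<otimes> a = a \<otimes> b" using that t(4,5) Z_closed by (intro Z_comm) auto
    then show ?thesis using that t(8)[of a b e] by simp
  qed
  ultimately have "\<forall>b\<in>B. \<forall>a\<in>A. \<forall>e\<in>E. b \<otimes> a \<otimes> e = \<one> \<longrightarrow> b = \<one> \<and> a = \<one> \<and> e = \<one>" "B <#> A <#> E = Z"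
    by blast+
  then show ?thesis unfolding center_triple_def using t(1-6) by simp
qed

lemma center_triple_int:
  assumes "center_triple A B E"
  shows "A \<inter> B \<subseteq> {\<one>}" "(A <#> B) \<inter> E \<subseteq> {\<one>}"
proof -
  note t = center_tripleD[OF assms]
  note cl = subgroup.mem_carrier[OF t(1)] subgroup.mem_carrier[OF t(2)] subgroup.mem_carrier[OF t(3)]
  show "A \<inter> B \<subseteq> {\<one>}"
  proof
    fix x assume x: "x \<in> A \<inter> B"
    then have "x \<otimes> inv x \<otimes> \<one> = \<one>" using cl by simp
    then show "x \<in> {\<one>}"
      using t(8)[of x "inv x" \<one>] x subgroup.m_inv_closed[OF t(2)] subgroup.one_closed[OF t(3)] by auto
  qed
  show "(A <#> B) \<inter> E \<subseteq> {\<one>}"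
  proof
    fix x assume x: "x \<in> (A <#> B) \<inter> E"
    then obtain a b where ab: "a \<in> A" "b \<in> B" "x = a \<otimes> b" by (auto simp: mem_set_mult)
    then have "a \<otimes> b \<otimes> inv x = \<one>" using cl by simp
    then have "inv x = \<one>" using t(8)[of a b "inv x"] ab x subgroup.m_inv_closed[OF t(3)] by auto
    then show "x \<in> {\<one>}" using x cl by (simp add: inv_eq_1_iff)
  qed
qed

section \<open>Attaching the remaining central factors\<close>

lemma central_comm: "A \<subseteq> Z \<Longrightarrow> Y \<subseteq> carrier G \<Longrightarrow> y \<in> Y \<Longrightarrow> a \<in> A \<Longrightarrow> y \<otimes> a = a \<otimes> y"
  by (rule Z_comm[symmetric]) auto

lemma attach_central_set_mult:
  assumes Y: "subgroup Y G" "Y <#> Z = carrier G" and A: "subgroup A G" "A \<subseteq> Z"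
  shows "subgroup (Y <#> A) G" "Y <#> A <#> Z = carrier G" "(Y <#> A) \<inter> Z = (Y \<inter> Z) <#> A"
proof -
  show YA: "subgroup (Y <#> A) G"
    using central_comm[OF A(2) subgroup.subset[OF Y(1)]] by (intro subgroup_commuting_set_mult Y A)
  have "Y <#> Z \<subseteq> Y <#> A <#> Z" using set_mult_upper[OF Y(1) A(1)] by (intro mono_set_mult) auto
  moreover have "Y <#> A <#> Z \<subseteq> carrier G"
    using setmult_subset_G[OF subgroup.subset[OF YA]] Z_closed by auto
  ultimately show "Y <#> A <#> Z = carrier G" using Y by simp
  show "(Y <#> A) \<inter> Z = (Y \<inter> Z) <#> A" by (rule set_mult_Int_center[OF Y(1) A])
qed

lemma direct_attach_central:
  assumes Y: "subgroup Y G" and A: "subgroup A G" "A \<subseteq> Z" and int: "(Y \<inter> Z) \<inter> A \<subseteq> {\<one>}"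
    and types: "direct_products L (G\<lparr>carrier := Y\<rparr>)" "L \<noteq> []" "Q (G\<lparr>carrier := A\<rparr>)"
  shows "direct_products (L @ [Q]) (G\<lparr>carrier := Y <#> A\<rparr>)"
  using central_comm[OF A(2) subgroup.subset[OF Y(1)]] A(2) int
  by (intro direct_products_snoc Y A types) auto

lemma central_attach_central:
  assumes Y: "subgroup Y G" and A: "subgroup A G" "A \<subseteq> Z" and int: "(Y \<inter> Z) \<inter> A = C"
    and types: "central_products p L (G\<lparr>carrier := Y\<rparr>)" "L \<noteq> []" "Q (G\<lparr>carrier := A\<rparr>)"
  shows "central_products p (L @ [Q]) (G\<lparr>carrier := Y <#> A\<rparr>)"
proof -
  have YA: "Y \<inter> A = C" using int A(2) by blast
  show ?thesis
    using central_comm[OF A(2) subgroup.subset[OF Y(1)]] derived_cases[OF Y] derived_cases[OF A(1)]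
    by (intro central_products_snoc Y A types) (simp_all add: YA card_C)
qed

text \<open>\<open>E\<close> meets \<open>Y\<close> only inside \<open>Y \<inter> Z = A B\<close>,
  hence trivially, and \<open>Y E = Y A B E = Y Z\<close> is everything.\<close>

lemma direct_products_finish:
  assumes t: "center_triple A B E" and Y: "subgroup Y G" "Y <#> Z = carrier G" "Y \<inter> Z = A <#> B"
    and types: "direct_products L (G\<lparr>carrier := Y\<rparr>)" "L \<noteq> []" "Q (G\<lparr>carrier := E\<rparr>)"
  shows "direct_products (L @ [Q]) G"
proof -
  note t' = center_tripleD[OF t]
  have AB: "A <#> B \<subseteq> Y" using Y(3) by blast
  have "Y <#> (A <#> B) = Y"
    using AB subgroup.one_closed[OF Y(1)] subgroup.one_closed[OF subgroup_center] Y(3)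
    by (intro set_mult_idem Y(1)) auto
  moreover have "Y <#> (A <#> B <#> E) = Y <#> (A <#> B) <#> E"
    using subgroup.subset[OF Y(1)] subgroup.subset[OF t'(3)] AB by (intro set_mult_assoc[symmetric]) auto
  ultimately have "Y <#> E = carrier G" using Y(2) t'(7) by simp
  then show ?thesis
    using direct_attach_central[where Q = Q, OF Y(1) t'(3,6) _ types] center_triple_int(2)[OF t] Y(3) by simp
qed

text \<open>The endings are named after the central part \<open>Y \<inter> Z\<close> already
  absorbed. What is missing of \<open>A B\<close> is attached before \<open>E\<close>: directly if
  it avoids \<open>C\<close>, by a central product if it contains \<open>C\<close>. In
  \<open>finish_C_AB\<close> the group \<open>A B\<close> is joined as one factor.\<close>

lemma finish_AB:
  assumes t: "center_triple A B E" and Y: "subgroup Y G" "Y <#> Z = carrier G" "Y \<inter> Z = A <#> B"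
    and types: "central_products p L (G\<lparr>carrier := Y\<rparr>)" "Q (G\<lparr>carrier := E\<rparr>)"
  shows "direct_products [central_products p L, Q] G"
  using direct_products_finish[OF t Y, of "[central_products p L]" Q] types by simp

lemma finish_A:
  assumes t: "center_triple A B E" and Y: "subgroup Y G" "Y <#> Z = carrier G" "Y \<inter> Z = A"
    and types: "central_products p L (G\<lparr>carrier := Y\<rparr>)" "P (G\<lparr>carrier := B\<rparr>)" "Q (G\<lparr>carrier := E\<rparr>)"
  shows "direct_products [central_products p L, P, Q] G"
proof -
  note t' = center_tripleD[OF t]
  have "direct_products ([central_products p L] @ [P]) (G\<lparr>carrier := Y <#> B\<rparr>)"
    using types center_triple_int(1)[OF t] Y(3) by (intro direct_attach_central Y(1) t') auto
  then show ?thesis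
    using direct_products_finish[where Q = Q and L = "[central_products p L, P]", OF t attach_central_set_mult(1,2)[OF Y(1,2) t'(2,5)] _ _ _ types(3)]
      attach_central_set_mult(3)[OF Y(1,2) t'(2,5)] Y(3) by simp
qed

text \<open>An element of \<open>C B\<close> that lies in \<open>A\<close> has trivial
  \<open>B\<close>-part. So joining \<open>A\<close> to a product with central part
  \<open>C B\<close> amalgamates precisely \<open>C\<close>.\<close>

lemma C_B_A:
  assumes t: "center_triple A B E" "C \<subseteq> A"
  shows "C <#> B <#> A = A <#> B" "(C <#> B) \<inter> A = C"
proof -
  note t' = center_tripleD[OF t(1)]
  note cl = subgroup.mem_carrier[OF t'(1)] subgroup.mem_carrier[OF t'(2)] C_closed
  have CB: "C <#> B \<subseteq> A <#> B" using t(2) by (intro mono_set_mult) auto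
  have AB: "subgroup (A <#> B) G"
    using central_comm[OF t'(5) subgroup.subset[OF t'(1)]] by (intro subgroup_commuting_set_mult t')
  show "C <#> B <#> A = A <#> B"
  proof (rule equalityI; rule subsetI)
    fix x assume "x \<in> C <#> B <#> A"
    then obtain h a where "h \<in> C <#> B" "a \<in> A" and x: "x = h \<otimes> a" unfolding mem_set_mult[of x] by blast
    then have "h \<in> A <#> B" "a \<in> A <#> B" using CB set_mult_upper(1)[OF t'(1,2)] by auto
    then show "x \<in> A <#> B" unfolding x by (rule subgroup.m_closed[OF AB])
  next
    fix x assume "x \<in> A <#> B"
    then obtain a b where x: "a \<in> A" "b \<in> B" "x = a \<otimes> b" by (auto simp: mem_set_mult)
    have "b \<otimes> a = a \<otimes> b" using x t'(4) cl by (intro Z_comm[symmetric]) auto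
    then have "x = \<one> \<otimes> b \<otimes> a" using x cl by simp
    moreover have "\<one> \<otimes> b \<in> C <#> B"
      using x(2) subgroup.one_closed[OF subgroup_C] by (auto simp: mem_set_mult)
    ultimately show "x \<in> C <#> B <#> A" using x(1) unfolding mem_set_mult[of x]
      by (intro bexI[of _ "\<one> \<otimes> b"] bexI[of _ a])
  qed
  show "(C <#> B) \<inter> A = C"
  proof (rule equalityI; rule subsetI)
    fix x assume x: "x \<in> (C <#> B) \<inter> A"
    then obtain d b where db: "d \<in> C" "b \<in> B" "x = d \<otimes> b" by (auto simp: mem_set_mult)
    then have "inv d \<otimes> x = b" using cl by (simp add: mult_inv_cancel)
    moreover have "inv d \<otimes> x \<in> A"
      using db x t(2) subgroup.m_closed[OF t'(1)] subgroup.m_inv_closed[OF t'(1)] by blast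
    ultimately have "b \<in> A" by (simp only:)
    then have "b = \<one>" using db(2) center_triple_int(1)[OF t(1)] by blast
    then show "x \<in> C" using db cl by simp
  next
    fix x assume "x \<in> C"
    then show "x \<in> (C <#> B) \<inter> A" using t(2) set_mult_upper(1)[OF subgroup_C t'(2)] by blast
  qed
qed

lemma finish_CB:
  assumes t: "center_triple A B E" "C \<subseteq> A" and Y: "subgroup Y G" "Y <#> Z = carrier G" "Y \<inter> Z = C <#> B"
    and types: "central_products p L (G\<lparr>carrier := Y\<rparr>)" "L \<noteq> []" "P (G\<lparr>carrier := A\<rparr>)" "Q (G\<lparr>carrier := E\<rparr>)"
  shows "direct_products [central_products p (L @ [P]), Q] G"
proof -
  note t' = center_tripleD[OF t(1)]
  have "central_products p (L @ [P]) (G\<lparr>carrier := Y <#> A\<rparr>)"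
    using types C_B_A(2)[OF t] Y(3) by (intro central_attach_central Y(1) t') auto
  then show ?thesis
    using finish_AB[where Q = Q, OF t(1) attach_central_set_mult(1,2)[OF Y(1,2) t'(1,4)] _ _ types(4)]
      attach_central_set_mult(3)[OF Y(1,2) t'(1,4)] Y(3) C_B_A(1)[OF t] by simp
qed

lemma finish_C:
  assumes t: "center_triple A B E" "C \<subseteq> A" and Y: "subgroup Y G" "Y <#> Z = carrier G" "Y \<inter> Z = C"
    and types: "central_products p L (G\<lparr>carrier := Y\<rparr>)" "L \<noteq> []" "P (G\<lparr>carrier := A\<rparr>)"
      "P' (G\<lparr>carrier := B\<rparr>)" "Q (G\<lparr>carrier := E\<rparr>)"
  shows "direct_products [central_products p (L @ [P]), P', Q] G"
proof -
  note t' = center_tripleD[OF t(1)]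
  have "central_products p (L @ [P]) (G\<lparr>carrier := Y <#> A\<rparr>)"
    using types t(2) Y(3) by (intro central_attach_central Y(1) t') auto
  moreover have "C <#> A = A <#> C" using C_sub_Z subgroup.subset[OF t'(1)] by (intro Z_set_mult_comm)
  then have "C <#> A = A"
    using set_mult_idem[OF t'(1) t(2)] subgroup.one_closed[OF subgroup_C] by simp
  ultimately show ?thesis
    using finish_A[where P = P' and Q = Q, OF t(1) attach_central_set_mult(1,2)[OF Y(1,2) t'(1,4)] _ _ types(4,5)]
      attach_central_set_mult(3)[OF Y(1,2) t'(1,4)] Y(3) by simp
qed

lemma finish_C_AB:
  assumes t: "center_triple A B E" "C \<subseteq> A <#> B" and Y: "subgroup Y G" "Y <#> Z = carrier G" "Y \<inter> Z = C"
    and types: "central_products p L (G\<lparr>carrier := Y\<rparr>)" "L \<noteq> []" "P (G\<lparr>carrier := A <#> B\<rparr>)"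
      "Q (G\<lparr>carrier := E\<rparr>)"
  shows "direct_products [central_products p (L @ [P]), Q] G"
proof -
  note t' = center_tripleD[OF t(1)]
  have AB: "subgroup (A <#> B) G" "A <#> B \<subseteq> Z"
    using central_comm[OF t'(5) subgroup.subset[OF t'(1)]] t'(4,5) subgroup.m_closed[OF subgroup_center]
    by (auto intro!: subgroup_commuting_set_mult t' simp: mem_set_mult subset_iff)
  have "central_products p (L @ [P]) (G\<lparr>carrier := Y <#> (A <#> B)\<rparr>)"
    using types t(2) Y(3) by (intro central_attach_central Y(1) AB) auto
  moreover have "C <#> (A <#> B) = A <#> B <#> C"
    using C_sub_Z subgroup.subset[OF AB(1)] by (intro Z_set_mult_comm)
  then have "C <#> (A <#> B) = A <#> B"
    using set_mult_idem[OF AB(1) t(2)] subgroup.one_closed[OF subgroup_C] by simp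
  ultimately show ?thesis
    using finish_AB[where Q = Q, OF t(1) attach_central_set_mult(1,2)[OF Y(1,2) AB] _ _ types(4)]
      attach_central_set_mult(3)[OF Y(1,2) AB] Y(3) by simp
qed

section \<open>Pairs adapted to a functional, and the products they start\<close>

lemma start_pair:
  assumes ab: "a \<in> carrier G" "b \<in> carrier G" "cm a b \<noteq> \<one>"
    and W: "subgroup W G" "C \<subseteq> W" "W \<subseteq> Z" "a [^] p \<in> W" "b [^] p \<in> W"
    and Q: "Q (G\<lparr>carrier := pair_group a b W\<rparr>)"
    and K: "exp_adjustable (centr (carrier G) {a, b})" and card: "card (carrier G) = card Z * p ^ (2 * k)"
  shows "\<exists>Y. subgroup Y G \<and> Y <#> Z = carrier G \<and> Y \<inter> Z = W \<and>
    central_products p (Q # replicate (k - 1) (Mp3 p 1 1)) (G\<lparr>carrier := Y\<rparr>)" and "k \<ge> 1"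
proof -
  note ctx = ab W
  let ?K = "centr (carrier G) {a, b}" and ?S = "pair_group a b W"
  have sub: "Z \<subseteq> carrier G" "W \<subseteq> carrier G" using Z_closed W(3) by auto
  have K1: "subgroup ?K G" "Z \<subseteq> ?K" "subcenter G ?K = Z" "card (carrier G) = p ^ 2 * card ?K"
    using subgroup_centr[OF subgroup_self, of "{a, b}"] Z_sub_centr[OF sub(1), of "{a, b}"]
      split_subcenter[OF subgroup_self ab] split_card[OF subgroup_self ab] ab
    by (simp_all add: subcenter_carrier)
  have comm: "x \<otimes> y = y \<otimes> x" if "x \<in> ?S" "y \<in> ?K" for x y
    using that subgroup.mem_carrier[OF K1(1)] by (intro pair_group_comm[OF ctx]) auto
  show k: "k \<ge> 1"
  proof (rule ccontr)
    assume "\<not> k \<ge> 1"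
    then have "card (carrier G) = card Z" using card by simp
    then have "Z = carrier G" using card_subset_eq[OF fin sub(1)] by simp
    then show False using ab cm_center by blast
  qed
  have "p ^ 2 * card ?K = card (carrier G)" using K1(4) by simp
  also have "\<dots> = p ^ 2 * (card Z * p ^ (2 * (k - 1)))"
    using k unfolding card by (cases k) (simp_all add: power2_eq_square)
  finally have cK: "card ?K = card Z * p ^ (2 * (k - 1))" using p_pos by simp
  have "C \<subseteq> ?S" using W(2) pair_group_mem(3)[OF ctx] by blast
  \<comment> \<open>The centralizer of the first pair is adjustable, so \<open>k - 1\<close> copies
    of \<open>M_p(1,1,1)\<close> use it up.\<close>
  from attach_exponent_p[OF subgroup_pair_group[OF ctx] this K1(1-3) comm cK K, of "[Q]"] Q
  obtain Y where "subgroup Y G" "Y \<inter> Z = ?S \<inter> Z" "Y <#> Z = ?S <#> ?K"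
    "central_products p ([Q] @ replicate (k - 1) (Mp3 p 1 1)) (G\<lparr>carrier := Y\<rparr>)" by auto
  then show "\<exists>Y. subgroup Y G \<and> Y <#> Z = carrier G \<and> Y \<inter> Z = W \<and>
    central_products p (Q # replicate (k - 1) (Mp3 p 1 1)) (G\<lparr>carrier := Y\<rparr>)"
    using pair_group_center[OF ctx] pair_group_mult[OF ctx subgroup_self ab(1,2) sub(2)]
    by (intro exI[of _ Y]) simp
qed

text \<open>The dual element \<open>v\<close> of the hyperplane \<open>U\<close> is normalized
  twice: a central factor kills its \<open>p\<close>-th power, and a power \<open>t\<close> prime to
  \<open>p\<close> brings the commutator with \<open>a\<close> to the value \<open>d\<close>.
  Neither changes the centralizer. The presentation of \<open>M2\<close> requires the exact
  value.\<close>

lemma dual_scaled: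
  assumes U: "subgroup U G" "Z \<subseteq> U" "card (carrier G) = p * card U" "exp_adjustable U"
    and a: "a \<in> carrier G" "a \<notin> U" and d: "d \<in> C" "d \<noteq> \<one>"
  obtains u where "u \<in> U" "\<And>g. g \<in> carrier G \<Longrightarrow> g \<in> U \<longleftrightarrow> cm g u = \<one>" "cm a u = d" "u [^] p = \<one>"
proof -
  obtain v where v: "v \<in> U" "v \<notin> Z" "\<And>g. g \<in> carrier G \<Longrightarrow> g \<in> U \<longleftrightarrow> cm g v = \<one>"
    using maximal_subgroup_dual[OF U(1-3)] by blast
  obtain w where w: "w \<in> Z" "(v \<otimes> w) [^] p = \<one>" using U(4) v by (auto simp: exp_adjustable_def)
  have vG: "v \<in> carrier G" and wG: "w \<in> carrier G" and wU: "w \<in> U"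
    using v w U(2) subgroup.mem_carrier[OF U(1)] by auto
  have nz: "cm a (v \<otimes> w) \<noteq> \<one>" using v(3)[OF a(1)] a vG w(1) by (simp add: cm_adjust)
  obtain t :: nat where t: "d = cm a (v \<otimes> w) [^] t"
    using C_pow_ex[OF cm_C nz d(1)] a vG wG by auto
  have pt: "\<not> p dvd t" using t d nz C_pow_one[OF cm_C, of a "v \<otimes> w" t] a vG wG by auto
  let ?u = "(v \<otimes> w) [^] t"
  show ?thesis
  proof (rule that[of ?u])
    show "?u \<in> U" using v wU subgroup.m_closed[OF U(1)] by (intro subgroup_pow_closed[OF U(1)]) auto
    show "cm a ?u = d" using t a vG wG by (simp add: cm_pow_right)
    have "?u [^] p = ((v \<otimes> w) [^] p) [^] t" using vG wG by (simp add: nat_pow_pow mult.commute)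
    then show "?u [^] p = \<one>" using w by simp
    fix g assume g: "g \<in> carrier G"
    have "cm g ?u = cm g v [^] t" using g vG wG w(1) by (simp add: cm_pow_right cm_adjust)
    then have "cm g ?u = \<one> \<longleftrightarrow> cm g v = \<one>"
      using C_pow_one[OF cm_C[OF g vG], of t] pt by (cases "cm g v = \<one>") auto
    then show "g \<in> U \<longleftrightarrow> cm g ?u = \<one>" using v(3)[OF g] by simp
  qed
qed

text \<open>\<open>a \<noteq> \<one>\<close> settles the case \<open>e = 0\<close>: the trivial
  element also has a \<open>p\<close>-th power of order 1.\<close>

lemma ord_from_pow:
  assumes "a \<in> carrier G" "a \<noteq> \<one>" "ord (a [^] p) = p ^ e"
  shows "ord a = p ^ (e + 1)"
proof -
  have "a [^] (p ^ (e + 1)) = (a [^] p) [^] (p ^ e)" using assms(1) by (simp add: nat_pow_pow)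
  also have "\<dots> = \<one>" using pow_ord_eq_1[of "a [^] p"] assms by simp
  finally have "ord a dvd p ^ (e + 1)" using pow_eq_id[OF assms(1)] by simp
  then obtain j where j: "ord a = p ^ j" using divides_primepow_nat[OF prime] by blast
  have "j \<noteq> 0" using j ord_eq_1[OF assms(1)] assms(2) by auto
  then have "p dvd ord a" using j by simp
  then have "ord (a [^] p) = ord a div p" using ord_pow[OF assms(1)] p_pos by simp
  then show ?thesis using assms(3) \<open>p dvd ord a\<close> by simp
qed

text \<open>A cyclic group of order \<open>p ^ (e + 1)\<close> has only one subgroup of order \<open>p\<close>.\<close>

lemma socle_pow:
  assumes a: "a \<in> carrier G" "ord a = p ^ (e + 1)" and C: "C \<subseteq> generate G {a [^] p}"
  shows "a [^] (p ^ e) \<in> C" "a [^] (p ^ e) \<noteq> \<one>"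
proof -
  show "a [^] (p ^ e) \<noteq> \<one>"
  proof
    assume "a [^] (p ^ e) = \<one>"
    then have "p ^ (e + 1) dvd p ^ e" using pow_eq_id[OF a(1)] a(2) by simp
    then show False using p_gt power_dvd_imp_le[of p "e + 1" e] by simp
  qed
  have ap: "a [^] p \<in> carrier G" using a by simp
  have "ord (a [^] p) \<noteq> 0" using ord_ge_1[OF fin ap] by simp
  moreover have "c \<in> generate G {a [^] p}" using C generate.incl[of c "{c}" G] by auto
  ultimately obtain i :: nat where i: "c = (a [^] p) [^] i"
    using generate_pow_nat[OF ap] by auto
  have c1: "c [^] p = \<one>" using C_pow_p[of c] generate.incl[of c "{c}" G] by simp
  have cn: "c \<noteq> \<one>"
  proof
    assume "c = \<one>"
    then have "C = {\<one>}" using generate_one by simp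
    then show False using card_C p_gt by simp
  qed
  have "a [^] (p * i * p) = \<one>" using c1 i a by (simp add: nat_pow_pow)
  then have "p ^ (e + 1) dvd p * i * p" using pow_eq_id[OF a(1)] a(2) by simp
  then have "p ^ e dvd p * i" using p_pos by (simp add: mult.commute)
  then obtain q where q: "p * i = p ^ e * q" by auto
  have cq: "c = (a [^] (p ^ e)) [^] q" using i a q by (simp add: nat_pow_pow)
  have d: "a [^] (p ^ e) \<in> carrier G" "(a [^] (p ^ e)) [^] p = \<one>"
    using a pow_ord_eq_1[OF a(1)] by (simp_all add: nat_pow_pow mult.commute)
  have D: "subgroup (generate G {a [^] (p ^ e)}) G" using d by (intro generate_is_subgroup) auto
  have "c \<in> generate G {a [^] (p ^ e)}"
    unfolding cq by (intro subgroup_pow_closed[OF D] generate.incl) simp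
  then have sub: "C \<subseteq> generate G {a [^] (p ^ e)}" using generate_subgroup_incl[OF _ D] by simp
  have "ord (a [^] (p ^ e)) dvd p" using pow_eq_id[OF d(1)] d(2) by simp
  then have "card (generate G {a [^] (p ^ e)}) \<le> card C"
    using generate_pow_card[OF d(1)] card_C p_pos by (simp add: dvd_imp_le)
  then have "C = generate G {a [^] (p ^ e)}" using card_seteq[OF finite_sub[OF D] sub] by simp
  then show "a [^] (p ^ e) \<in> C" using generate.incl[of "a [^] (p ^ e)" "{a [^] (p ^ e)}" G] by simp
qed

lemma C_not_trivial: "c \<noteq> \<one>"
proof
  assume "c = \<one>"
  then have "C = {\<one>}" using generate_one by simp
  then show False using card_C p_gt by simp
qed

lemma Z_neq_carrier: "Z \<noteq> carrier G"
proof
  assume eq: "Z = carrier G"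
  have "derived G (carrier G) = {\<one>}"
    using Z_comm unfolding eq by (intro derived_commuting subgroup_self)
  then show False using derived card_C p_gt by simp
qed

lemma type_exponent_p_aux:
  assumes U: "exp_adjustable (carrier G)" and card: "card (carrier G) = card Z * p ^ (2 * k)"
  obtains Y where "subgroup Y G" "Y <#> Z = carrier G" "Y \<inter> Z = C"
    "central_products p (replicate k (Mp3 p 1 1)) (G\<lparr>carrier := Y\<rparr>)" "k \<ge> 1"
proof -
  have sub: "Z \<subseteq> carrier G" using Z_closed by auto
  obtain a b where ab: "a \<in> carrier G" "b \<in> carrier G" "cm a b \<noteq> \<one>" "a [^] p = \<one>" "b [^] p = \<one>"
    using exponent_p_pair[OF subgroup_self sub subcenter_carrier _ U] Z_neq_carrier by metis
  have W: "subgroup C G" "C \<subseteq> C" "C \<subseteq> Z" "a [^] p \<in> C" "b [^] p \<in> C"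
    using subgroup_C C_sub_Z subgroup.one_closed[OF subgroup_C] ab by auto
  have K: "exp_adjustable (centr (carrier G) {a, b})"
    by (rule exp_adjustable_mono[OF U]) (auto simp: centr_def)
  note st = start_pair[where Q = "Mp3 p 1 1", OF ab(1-3) W Mp3_one[OF ab] K card]
  have "Mp3 p 1 1 # replicate (k - 1) (Mp3 p 1 1) = replicate k (Mp3 p 1 1)"
    using st(2) by (cases k) simp_all
  then show ?thesis using st that by metis
qed

text \<open>Both functionals vanish, so no exceptional factor occurs: a complement of the center
  splits into pairs of exponent \<open>p\<close>, and the center is joined afterwards.\<close>

lemma type_M3_power:
  assumes t: "center_triple A B E" "C \<subseteq> A" and U: "exp_adjustable (carrier G)"
    and card: "card (carrier G) = card Z * p ^ (2 * k)"
    and types: "P (G\<lparr>carrier := A\<rparr>)" "P' (G\<lparr>carrier := B\<rparr>)" "Q (G\<lparr>carrier := E\<rparr>)"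
  shows "direct_products [central_products p (replicate k (Mp3 p 1 1) @ [P]), P', Q] G"
proof -
  obtain Y where Y: "subgroup Y G" "Y <#> Z = carrier G" "Y \<inter> Z = C"
    "central_products p (replicate k (Mp3 p 1 1)) (G\<lparr>carrier := Y\<rparr>)" "k \<ge> 1"
    using type_exponent_p_aux[OF U card] by metis
  show ?thesis by (rule finish_C[where P = P and P' = P' and Q = Q, OF t Y(1-4) _ types]) (use Y(5) in auto)
qed

text \<open>The version for type \<open>A_4\<close>: \<open>C\<close> is only known to lie in
  \<open>A B\<close>, so this group is joined as a whole.\<close>

lemma type_M3_power_pair:
  assumes t: "center_triple A B E" "C \<subseteq> A <#> B" and U: "exp_adjustable (carrier G)"
    and card: "card (carrier G) = card Z * p ^ (2 * k)"
    and types: "P (G\<lparr>carrier := A <#> B\<rparr>)" "Q (G\<lparr>carrier := E\<rparr>)"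
  shows "direct_products [central_products p (replicate k (Mp3 p 1 1) @ [P]), Q] G"
proof -
  obtain Y where Y: "subgroup Y G" "Y <#> Z = carrier G" "Y \<inter> Z = C"
    "central_products p (replicate k (Mp3 p 1 1)) (G\<lparr>carrier := Y\<rparr>)" "k \<ge> 1"
    using type_exponent_p_aux[OF U card] by metis
  show ?thesis by (rule finish_C_AB[where P = P and Q = Q, OF t Y(1-4) _ types]) (use Y(5) in auto)
qed

lemma centr_sub_dual:
  assumes "\<And>g. g \<in> carrier G \<Longrightarrow> g \<in> U \<longleftrightarrow> cm g u = \<one>" "u \<in> carrier G"
  shows "centr (carrier G) {a, u} \<subseteq> U"
  using assms by (auto simp: centr_def cm_one_iff)

text \<open>Recognition of \<open>M_p(e+1,1)\<close>: since the partner has trivial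
  \<open>p\<close>-th power, \<open>W\<close> reduces to \<open><a^p>\<close>.\<close>

lemma M2_one_pair:
  assumes a: "a \<in> carrier G" "ord (a [^] p) = p ^ e" "e \<ge> 1" and C: "C \<subseteq> generate G {a [^] p}"
    and aZ: "a [^] p \<in> Z"
    and u: "u \<in> carrier G" "u [^] p = \<one>" "cm a u = a [^] (p ^ e)" "cm a u \<noteq> \<one>"
  shows "Mp2 p (e + 1) 1 (G\<lparr>carrier := pair_group a u (generate G {a [^] p})\<rparr>)"
    "subgroup (generate G {a [^] p}) G" "generate G {a [^] p} \<subseteq> Z"
    "a [^] p \<in> generate G {a [^] p}" "u [^] p \<in> generate G {a [^] p}"
proof -
  show A: "subgroup (generate G {a [^] p}) G" using a by (intro generate_is_subgroup) auto
  show "generate G {a [^] p} \<subseteq> Z" using generate_subgroup_incl[OF _ subgroup_center] aZ by simp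
  show "a [^] p \<in> generate G {a [^] p}" by (intro generate.incl) simp
  show "u [^] p \<in> generate G {a [^] p}" using u subgroup.one_closed[OF A] by simp
  have "a \<noteq> \<one>" "u \<noteq> \<one>" using u a by auto
  then have o: "ord a = p ^ (e + 1)" "ord u = p ^ 1"
    using ord_from_pow[OF a(1)] a(2) ord_from_pow[OF u(1), of 0] u(2) by auto
  have "generate G {a [^] p} = generate G {a [^] p} <#> generate G {u [^] p}"
    using set_mult_idem[OF A, of "{\<one>}"] subgroup.one_closed[OF A] u(2) generate_one by simp
  then show "Mp2 p (e + 1) 1 (G\<lparr>carrier := pair_group a u (generate G {a [^] p})\<rparr>)"
    using a u aZ o subgroup.one_closed[OF subgroup_center] generate_one
    by (intro pair_group_M2(1)) auto
qed

lemma M3_one_pair: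
  assumes a: "a \<in> carrier G" "ord (a [^] p) = p ^ f" and int: "generate G {a [^] p} \<inter> C \<subseteq> {\<one>}"
    and aZ: "a [^] p \<in> Z"
    and u: "u \<in> carrier G" "u [^] p = \<one>" "cm a u \<noteq> \<one>"
  shows "Mp3 p (f + 1) 1 (G\<lparr>carrier := pair_group a u (C <#> generate G {a [^] p})\<rparr>)"
    "subgroup (C <#> generate G {a [^] p}) G" "C \<subseteq> C <#> generate G {a [^] p}"
    "C <#> generate G {a [^] p} \<subseteq> Z"
    "a [^] p \<in> C <#> generate G {a [^] p}" "u [^] p \<in> C <#> generate G {a [^] p}"
proof -
  have "a \<noteq> \<one>" using u a by auto
  then have o: "ord a = p ^ (f + 1)" using ord_from_pow[OF a(1)] a(2) by auto
  note M = pair_group_M3[OF a(1) u(1,3) o u(2) aZ int HOL.refl]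
  show "Mp3 p (f + 1) 1 (G\<lparr>carrier := pair_group a u (C <#> generate G {a [^] p})\<rparr>)" by (rule M)
  show "subgroup (C <#> generate G {a [^] p}) G" "C \<subseteq> C <#> generate G {a [^] p}"
    "C <#> generate G {a [^] p} \<subseteq> Z"
    "a [^] p \<in> C <#> generate G {a [^] p}" "u [^] p \<in> C <#> generate G {a [^] p}"
    by (rule M)+
qed

text \<open>\<open>U\<close> plays the role of the kernel of a functional that is nonzero at
  \<open>a\<close>. As \<open>C\<close> lies in \<open><a^p>\<close>, the dual of \<open>U\<close>
  can be scaled so that the pair generates \<open>M_p(e+1,1)\<close>. The centralizer of the pair is
  inside \<open>U\<close>, which leaves only copies of \<open>M_p(1,1,1)\<close>.\<close>

lemma type_M2_one:
  assumes t: "center_triple (generate G {a [^] p}) B E" "C \<subseteq> generate G {a [^] p}"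
    and U: "subgroup U G" "Z \<subseteq> U" "card (carrier G) = p * card U" "exp_adjustable U"
    and a: "a \<in> carrier G" "a \<notin> U" "ord (a [^] p) = p ^ e" "e \<ge> 1"
    and card: "card (carrier G) = card Z * p ^ (2 * k)"
    and types: "P (G\<lparr>carrier := B\<rparr>)" "Q (G\<lparr>carrier := E\<rparr>)"
  shows "direct_products [central_products p (Mp2 p (e + 1) 1 # replicate (k - 1) (Mp3 p 1 1)), P, Q] G"
proof -
  have aZ: "a [^] p \<in> Z" using center_tripleD(4)[OF t(1)] generate.incl[of "a [^] p" "{a [^] p}" G] by blast
  have "a \<noteq> \<one>" using a U(2) subgroup.one_closed[OF subgroup_center] by auto
  then have o: "ord a = p ^ (e + 1)" by (rule ord_from_pow[OF a(1) _ a(3)])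
  obtain u where u: "u \<in> U" "\<And>g. g \<in> carrier G \<Longrightarrow> g \<in> U \<longleftrightarrow> cm g u = \<one>"
    "cm a u = a [^] (p ^ e)" "u [^] p = \<one>"
    using dual_scaled[OF U a(1,2) socle_pow[OF a(1) o t(2)]] by metis
  have uG: "u \<in> carrier G" using u(1) subgroup.mem_carrier[OF U(1)] by simp
  have nz: "cm a u \<noteq> \<one>" using socle_pow(2)[OF a(1) o t(2)] u(3) by simp
  note M = M2_one_pair[OF a(1,3,4) t(2) aZ uG u(4,3) nz]
  have K: "exp_adjustable (centr (carrier G) {a, u})"
    by (rule exp_adjustable_mono[OF U(4) centr_sub_dual[OF u(2) uG]])
  obtain Y where Y: "subgroup Y G" "Y <#> Z = carrier G" "Y \<inter> Z = generate G {a [^] p}"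
    "central_products p (Mp2 p (e + 1) 1 # replicate (k - 1) (Mp3 p 1 1)) (G\<lparr>carrier := Y\<rparr>)"
    using start_pair(1)[where Q = "Mp2 p (e + 1) 1", OF a(1) uG nz M(2) t(2) M(3-5,1) K card] by blast
  show ?thesis by (rule finish_A[where P = P and Q = Q, OF t(1) Y types])
qed

text \<open>The counterpart with \<open>C\<close> in the other factor: the commutator is independent
  of \<open>a\<close>, so the pair gives \<open>M_p(f+1,1,1)\<close> with center \<open>C\<close>
  times \<open><a^p>\<close>, and \<open>A\<close> is joined at the end.\<close>

lemma type_M3_one:
  assumes t: "center_triple A (generate G {a [^] p}) E" "C \<subseteq> A"
    and U: "subgroup U G" "Z \<subseteq> U" "card (carrier G) = p * card U" "exp_adjustable U"
    and a: "a \<in> carrier G" "a \<notin> U" "ord (a [^] p) = p ^ f"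
    and card: "card (carrier G) = card Z * p ^ (2 * k)"
    and types: "P (G\<lparr>carrier := A\<rparr>)" "Q (G\<lparr>carrier := E\<rparr>)"
  shows "direct_products [central_products p
    (Mp3 p (f + 1) 1 # replicate (k - 1) (Mp3 p 1 1) @ [P]), Q] G"
proof -
  have aZ: "a [^] p \<in> Z" using center_tripleD(5)[OF t(1)] generate.incl[of "a [^] p" "{a [^] p}" G] by blast
  have int: "generate G {a [^] p} \<inter> C \<subseteq> {\<one>}" using center_triple_int(1)[OF t(1)] t(2) by blast
  have cC: "c \<in> C" by (intro generate.incl) simp
  obtain u where u: "u \<in> U" "\<And>g. g \<in> carrier G \<Longrightarrow> g \<in> U \<longleftrightarrow> cm g u = \<one>"
    "cm a u = c" "u [^] p = \<one>"
    using dual_scaled[OF U a(1,2) cC C_not_trivial] by metis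
  have uG: "u \<in> carrier G" using u(1) subgroup.mem_carrier[OF U(1)] by simp
  have nz: "cm a u \<noteq> \<one>" using u(3) C_not_trivial by simp
  note M = M3_one_pair[OF a(1,3) int aZ uG u(4) nz]
  have K: "exp_adjustable (centr (carrier G) {a, u})"
    by (rule exp_adjustable_mono[OF U(4) centr_sub_dual[OF u(2) uG]])
  obtain Y where Y: "subgroup Y G" "Y <#> Z = carrier G" "Y \<inter> Z = C <#> generate G {a [^] p}"
    "central_products p (Mp3 p (f + 1) 1 # replicate (k - 1) (Mp3 p 1 1)) (G\<lparr>carrier := Y\<rparr>)"
    using start_pair(1)[where Q = "Mp3 p (f + 1) 1", OF a(1) uG nz M(2-6,1) K card] by blast
  show ?thesis using finish_CB[where P = P and Q = Q, OF t Y _ types] by simp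
qed

lemma generate_pow_coprime:
  assumes "x \<in> carrier G" "ord x = p ^ e" "\<not> p dvd s"
  shows "generate G {x [^] s} = generate G {x}" "ord (x [^] s) = p ^ e"
proof -
  have "coprime (int s) (int (p ^ e))"
    using prime assms(3) by (simp add: prime_imp_coprime coprime_commute)
  then obtain u v where uv: "u * int s + v * int (p ^ e) = 1"
    using bezout_int[of "int s" "int (p ^ e)"] by auto
  have "x [^] (int s * u) = x [^] (1 :: int)"
    using int_pow_eq[OF assms(1), of "int s * u" 1] assms(2) uv
    by (metis dvd_triv_right add_diff_cancel_left' mult.commute)
  then have xq: "(x [^] s) [^] u = x"
    using assms(1) int_pow_pow[OF assms(1), of "int s" u] by (simp add: int_pow_int)
  have g: "subgroup (generate G {x}) G" "subgroup (generate G {x [^] s}) G"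
    using assms(1) by (auto intro: generate_is_subgroup)
  have "x [^] s \<in> generate G {x}" by (intro subgroup_pow_closed[OF g(1)] generate.incl) simp
  moreover have "(x [^] s) [^] u \<in> generate G {x [^] s}"
    using generate_pow[of "x [^] s"] assms(1) by auto
  ultimately show eq: "generate G {x [^] s} = generate G {x}"
    using generate_subgroup_incl[OF _ g(1), of "{x [^] s}"] generate_subgroup_incl[OF _ g(2), of "{x}"]
    unfolding xq by blast
  show "ord (x [^] s) = p ^ e"
    using generate_pow_card[of "x [^] s"] generate_pow_card[of x] eq assms by simp
qed

text \<open>A single pair absorbs both cyclic factors of the center. Replacing \<open>b\<close> by a
  power prime to \<open>p\<close> keeps \<open><b^p>\<close> and the centralizer of the pair, but
  turns the commutator into \<open>a^(p^e)\<close>.\<close>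

lemma type_M2_two:
  assumes t: "center_triple (generate G {a [^] p}) (generate G {b [^] p}) E" "C \<subseteq> generate G {a [^] p}"
    and K: "exp_adjustable (centr (carrier G) {a, b})"
    and a: "a \<in> carrier G" "ord (a [^] p) = p ^ e" "e \<ge> 1" and b: "b \<in> carrier G" "ord (b [^] p) = p ^ f"
    and nz: "cm a b \<noteq> \<one>"
    and card: "card (carrier G) = card Z * p ^ (2 * k)"
    and types: "Q (G\<lparr>carrier := E\<rparr>)"
  shows "direct_products [central_products p (Mp2 p (e + 1) (f + 1) # replicate (k - 1) (Mp3 p 1 1)), Q] G"
proof -
  have o: "ord a = p ^ (e + 1)" using nz a(1) b(1) by (intro ord_from_pow[OF a(1) _ a(2)]) auto
  note so = socle_pow[OF a(1) o t(2)]
  obtain s where s: "a [^] (p ^ e) = cm a b [^] (s::nat)"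
    using C_pow_ex[OF cm_C nz so(1)] a b by auto
  have ps: "\<not> p dvd s"
    using s so(2) nz C_pow_one[OF cm_C, of a b s] a(1) b(1) by auto
  define b' where "b' = b [^] s"
  have b'G: "b' \<in> carrier G" using b by (simp add: b'_def)
  have cmb: "cm a b' = a [^] (p ^ e)" using s a b by (simp add: b'_def cm_pow_right)
  have nz': "cm a b' \<noteq> \<one>" using cmb so by simp
  have "b' [^] p = (b [^] p) [^] s" using b by (simp add: b'_def nat_pow_pow mult.commute)
  then have gb: "generate G {b' [^] p} = generate G {b [^] p}" "ord (b' [^] p) = p ^ f"
    using generate_pow_coprime[of "b [^] p" f s] b ps by simp_all
  have o': "ord b' = p ^ (f + 1)" using nz' a(1) b'G by (intro ord_from_pow[OF b'G _ gb(2)]) auto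
  note t' = center_tripleD[OF t(1)]
  let ?W = "generate G {a [^] p} <#> generate G {b' [^] p}"
  have Zp: "a [^] p \<in> Z" "b' [^] p \<in> Z"
    using t'(4,5) generate.incl[of "a [^] p" "{a [^] p}" G] generate.incl[of "b' [^] p" "{b' [^] p}" G]
    unfolding gb by auto
  have e: "e + 1 \<ge> 2" "a [^] (p ^ e) = a [^] (p ^ (e + 1 - 1))" using a(3) by auto
  note M = pair_group_M2[OF a(1) b'G nz' o o' e(1) Zp cmb[unfolded e(2)]
      center_triple_int(1)[OF t(1), folded gb(1)] HOL.refl]
  have K': "exp_adjustable (centr (carrier G) {a, b'})"
  proof (rule exp_adjustable_mono[OF K], rule subsetI)
    fix x assume "x \<in> centr (carrier G) {a, b'}"
    then have x: "x \<in> carrier G" "cm x a = \<one>" "cm x b' = \<one>"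
      using a b'G by (auto simp: centr_def cm_one_iff)
    have "cm x b [^] s = \<one>" using x b by (simp add: b'_def cm_pow_right)
    then have "cm x b = \<one>" using C_pow_one[OF cm_C[OF x(1) b(1)], of s] ps by auto
    then show "x \<in> centr (carrier G) {a, b}" using x a b by (simp add: centr_pair_iff)
  qed
  obtain Y where Y: "subgroup Y G" "Y <#> Z = carrier G" "Y \<inter> Z = ?W"
    "central_products p (Mp2 p (e + 1) (f + 1) # replicate (k - 1) (Mp3 p 1 1)) (G\<lparr>carrier := Y\<rparr>)"
    using start_pair(1)[where Q = "Mp2 p (e + 1) (f + 1)", OF a(1) b'G nz' M(2-6,1) K' card] by blast
  show ?thesis by (rule finish_AB[where Q = Q, OF t(1) Y(1,2) Y(3)[unfolded gb] Y(4) types])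
qed

text \<open>Distinct kernels with commuting duals \<open>u1\<close>, \<open>u2\<close> call for two
  orthogonal pairs: an \<open>a\<close> outside \<open>U1\<close> with a multiple of
  \<open>u1\<close>, and, in their centralizer, a \<open>b\<close> outside \<open>U2\<close> with
  \<open>u2\<close>. Since \<open>C\<close> lies in \<open>A\<close>, the first pair gives
  \<open>M_p(e+1,1)\<close> and the second \<open>M_p(f+1,1,1)\<close>. Two pairs force
  \<open>k \<ge> 2\<close>.\<close>

lemma type_M2_M3:
  assumes t: "center_triple A B E" "C \<subseteq> A"
    and U1: "subgroup U1 G" "Z \<subseteq> U1" "card (carrier G) = p * card U1"
    and U2: "subgroup U2 G" "Z \<subseteq> U2" "card (carrier G) = p * card U2"
    and ex: "exp_adjustable (U1 \<inter> U2)"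
    and A: "\<And>g. g \<in> U2 \<Longrightarrow> g \<notin> U1 \<Longrightarrow> \<exists>w\<in>Z. generate G {(g \<otimes> w) [^] p} = A \<and> ord ((g \<otimes> w) [^] p) = p ^ e"
    and B: "\<And>g. g \<in> U1 \<Longrightarrow> g \<notin> U2 \<Longrightarrow> \<exists>w\<in>Z. generate G {(g \<otimes> w) [^] p} = B \<and> ord ((g \<otimes> w) [^] p) = p ^ f"
    and e: "e \<ge> 1"
    and u1: "u1 \<in> U1" "u1 \<in> U2" "\<And>g. g \<in> carrier G \<Longrightarrow> g \<in> U1 \<longleftrightarrow> cm g u1 = \<one>"
    and u2: "u2 \<in> U1" "u2 \<in> U2" "\<And>g. g \<in> carrier G \<Longrightarrow> g \<in> U2 \<longleftrightarrow> cm g u2 = \<one>" "u2 \<notin> Z"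
    and ne: "\<not> U2 \<subseteq> U1"
    and card: "card (carrier G) = card Z * p ^ (2 * k)"
    and types: "Q (G\<lparr>carrier := E\<rparr>)"
  shows "k \<ge> 2 \<and> direct_products [central_products p
    (Mp2 p (e + 1) 1 # Mp3 p (f + 1) 1 # replicate (k - 2) (Mp3 p 1 1)), Q] G"
proof -
  note [simp] = subgroup.mem_carrier[OF U1(1)] subgroup.mem_carrier[OF U2(1)]
  note t' = center_tripleD[OF t(1)]
  have adj: "\<exists>w\<in>Z. u \<otimes> w \<in> U1 \<and> u \<otimes> w \<in> U2 \<and> (u \<otimes> w) [^] p = \<one>" if u: "u \<in> U1" "u \<in> U2" for u
  proof -
    obtain w where w: "w \<in> Z" "(u \<otimes> w) [^] p = \<one>" using ex u by (auto simp: exp_adjustable_def)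
    then show ?thesis using that U1(2) U2(2) subgroup.m_closed[OF U1(1)] subgroup.m_closed[OF U2(1)]
      by (intro bexI[of _ w]) auto
  qed
  obtain g where g: "g \<in> U2" "g \<notin> U1" using ne by blast
  obtain w where w: "w \<in> Z" "generate G {(g \<otimes> w) [^] p} = A" "ord ((g \<otimes> w) [^] p) = p ^ e"
    using A[OF g] by blast
  define a where "a = g \<otimes> w"
  have aU: "a \<in> U2" using g w U2 subgroup.m_closed[OF U2(1)] by (auto simp: a_def)
  have aG: "a \<in> carrier G" using aU by simp
  have gA: "generate G {a [^] p} = A" "ord (a [^] p) = p ^ e" using w by (simp_all add: a_def)
  have aZ: "a [^] p \<in> Z" using t'(4) generate.incl[of "a [^] p" "{a [^] p}" G] gA by auto
  have "cm a u1 \<noteq> \<one>"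
    using u1(3)[of g] g w u1(1) by (simp add: a_def cm_adjust)
  then have "a \<noteq> \<one>" using u1(1) by auto
  then have o: "ord a = p ^ (e + 1)" by (rule ord_from_pow[OF aG _ gA(2)])
  note so = socle_pow[OF aG o, unfolded gA, OF t(2)]
  obtain w1 where w1: "w1 \<in> Z" "u1 \<otimes> w1 \<in> U1" "u1 \<otimes> w1 \<in> U2" "(u1 \<otimes> w1) [^] p = \<one>"
    using adj[OF u1(1,2)] by blast
  have nz1: "cm a (u1 \<otimes> w1) \<noteq> \<one>" using \<open>cm a u1 \<noteq> \<one>\<close> aG u1(1) w1 by (simp add: cm_adjust)
  obtain s where s: "a [^] (p ^ e) = cm a (u1 \<otimes> w1) [^] (s::nat)"
    using C_pow_ex[OF cm_C nz1 so(1)] aG w1 by auto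
  have ps: "\<not> p dvd s"
    using s so(2) nz1 C_pow_one[OF cm_C, of a "u1 \<otimes> w1" s] aG w1(2) by auto
  \<comment> \<open>Scaling the corrected \<open>u1\<close> gives exactly the commutator that the
    presentation of \<open>M_p(e+1,1)\<close> prescribes.\<close>
  define v where "v = (u1 \<otimes> w1) [^] s"
  have v: "v \<in> U1" "v \<in> U2" using w1 subgroup_pow_closed U1(1) U2(1) by (auto simp: v_def)
  have vG: "v \<in> carrier G" using v by simp
  have cmv: "cm a v = a [^] (p ^ e)" using s aG w1 by (simp add: v_def cm_pow_right)
  have nzv: "cm a v \<noteq> \<one>" using cmv so by simp
  have "v [^] p = ((u1 \<otimes> w1) [^] p) [^] s" using w1(2) by (simp add: v_def nat_pow_pow mult.commute)
  then have vp: "v [^] p = \<one>" using w1 by simp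
  have vU: "g \<in> U1" if "g \<in> carrier G" "cm g v = \<one>" for g
  proof -
    have "cm g v = cm g u1 [^] s"
      using that(1) u1(1) w1(1,2) Z_closed[OF w1(1)] by (simp add: v_def cm_pow_right cm_adjust)
    then have "cm g u1 = \<one>" using that C_pow_one[OF cm_C[of g u1], of s] ps u1(1) by auto
    then show ?thesis using u1(3) that by simp
  qed
  note M = M2_one_pair[OF aG gA(2) e _ aZ vG vp cmv nzv, unfolded gA, OF t(2)]
  let ?S = "pair_group a v A" and ?K = "centr (carrier G) {a, v}"
  note ctx = aG vG nzv M(2) t(2) M(3-5)
  have sub: "Z \<subseteq> carrier G" using Z_closed by auto
  have K: "subgroup ?K G" "Z \<subseteq> ?K" "subcenter G ?K = Z" "card (carrier G) = p ^ 2 * card ?K"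
    using subgroup_centr[OF subgroup_self, of "{a, v}"] Z_sub_centr[OF sub, of "{a, v}"]
      split_subcenter[OF subgroup_self aG vG nzv] split_card[OF subgroup_self aG vG nzv] aG vG
    by (simp_all add: subcenter_carrier)
  have comm: "x \<otimes> y = y \<otimes> x" if "x \<in> ?S" "y \<in> ?K" for x y
    using that subgroup.mem_carrier[OF K(1)] by (intro pair_group_comm[OF ctx]) auto
  have CS: "C \<subseteq> ?S" using t(2) pair_group_mem(3)[OF ctx] by blast
  obtain w2 where w2: "w2 \<in> Z" "u2 \<otimes> w2 \<in> U1" "u2 \<otimes> w2 \<in> U2" "(u2 \<otimes> w2) [^] p = \<one>"
    using adj[OF u2(1,2)] by blast
  define u where "u = u2 \<otimes> w2"
  have uG: "u \<in> carrier G" using w2 by (simp add: u_def)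
  have uU: "g \<in> U2 \<longleftrightarrow> cm g u = \<one>" if "g \<in> carrier G" for g
    using that u2(3) w2 u2(1) by (simp add: u_def cm_adjust)
  \<comment> \<open>\<open>a\<close> and \<open>v\<close> lie in \<open>U2\<close>, the centralizer
    of \<open>u\<close>. So the partner for the second pair already lies in the complement of the
    first.\<close>
  have "cm a u = \<one>" "cm v u = \<one>" using uU[OF aG] uU[OF vG] aU v by blast+
  then have "cm u a = \<one>" "cm u v = \<one>" by (simp_all add: cm_swap[OF aG uG] cm_swap[OF vG uG])
  then have uK: "u \<in> ?K" using uG aG vG by (simp add: centr_pair_iff)
  have "u \<notin> Z"
  proof
    assume "u \<in> Z"
    then have "u \<otimes> inv w2 \<in> Z"
      using subgroup.m_closed[OF subgroup_center] subgroup.m_inv_closed[OF subgroup_center] w2(1) by blast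
    moreover have "u \<otimes> inv w2 = u2" using u2(1) Z_closed[OF w2(1)] by (simp add: u_def m_assoc)
    ultimately show False using u2(4) by simp
  qed
  \<comment> \<open>The complement has center \<open>Z\<close>, so the noncentral \<open>u\<close>
    fails to commute with some \<open>h\<close> in it. That puts \<open>h\<close> outside
    \<open>U2\<close>, while commuting with \<open>v\<close> puts it in \<open>U1\<close>.\<close>
  then obtain h where h: "h \<in> ?K" "u \<otimes> h \<noteq> h \<otimes> u" using uK K(3) by (auto simp: subcenter_def)
  have hG: "h \<in> carrier G" using h(1) by (simp add: centr_def)
  have "cm h u \<noteq> \<one>" using h(2) hG uG cm_one_iff[of h u] by metis
  then have hU2: "h \<notin> U2" using uU[OF hG] by simp
  have "cm h v = \<one>" using h(1) hG vG aG by (simp add: centr_pair_iff)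
  then have hU1: "h \<in> U1" using vU hG by simp
  obtain w3 where w3: "w3 \<in> Z" "generate G {(h \<otimes> w3) [^] p} = B" "ord ((h \<otimes> w3) [^] p) = p ^ f"
    using B[OF hU1 hU2] by blast
  define b where "b = h \<otimes> w3"
  have bK: "b \<in> ?K" using h(1) w3(1) K(2) subgroup.m_closed[OF K(1)] by (auto simp: b_def)
  have bG: "b \<in> carrier G" using bK by (simp add: centr_def)
  have gB: "generate G {b [^] p} = B" "ord (b [^] p) = p ^ f" using w3 by (simp_all add: b_def)
  have bZ: "b [^] p \<in> Z" using t'(5) generate.incl[of "b [^] p" "{b [^] p}" G] gB by auto
  have nzb: "cm b u \<noteq> \<one>" using \<open>cm h u \<noteq> \<one>\<close> hG uG w3(1) by (simp add: b_def cm_adjust)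
  have up: "u [^] p = \<one>" using w2 by (simp add: u_def)
  have "B \<inter> C \<subseteq> {\<one>}" using center_triple_int(1)[OF t(1)] t(2) by blast
  note N = M3_one_pair[OF bG gB(2) _ bZ uG up nzb, unfolded gB, OF this]
  \<comment> \<open>The central part of the first factor is \<open>A\<close>, which meets
    \<open>C B\<close> in \<open>C\<close>.\<close>
  have "?S \<inter> (C <#> B) \<subseteq> C"
    using pair_group_center[OF ctx] N(4) C_B_A(2)[OF t] by blast
  note att = attach_pair[where Q = "Mp3 p (f + 1) 1" and L = "[Mp2 p (e + 1) 1]",
      OF subgroup_pair_group[OF ctx] CS K(1-3) comm bK uK nzb N(2-6) this _ _ N(1)]
  let ?S' = "?S <#> pair_group b u (C <#> B)" and ?K' = "centr ?K {b, u}"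
  have att': "subgroup ?S' G" "C \<subseteq> ?S'" "subgroup ?K' G" "Z \<subseteq> ?K'" "subcenter G ?K' = Z"
    "\<And>x y. x \<in> ?S' \<Longrightarrow> y \<in> ?K' \<Longrightarrow> x \<otimes> y = y \<otimes> x"
    "card ?K = p ^ 2 * card ?K'" "?S' <#> ?K' = ?S <#> ?K" "?S' \<inter> Z = (?S \<inter> Z) <#> (C <#> B)"
    "central_products p [Mp2 p (e + 1) 1, Mp3 p (f + 1) 1] (G\<lparr>carrier := ?S'\<rparr>)"
    using att M(1) by simp_all
  \<comment> \<open>The two pairs account for \<open>p ^ 4\<close>; this bounds \<open>k\<close>
    from below and gives the order of the remaining complement.\<close>
  have "card Z dvd card ?K'" by (rule subgroup_card_dvd[OF subgroup_center att'(3,4)])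
  then obtain m where m: "card ?K' = card Z * m" by auto
  have "card Z * p ^ (2 * k) = p ^ 2 * (p ^ 2 * card ?K')" using card K(4) att'(7) by simp
  also have "\<dots> = card Z * (p ^ 4 * m)" unfolding m by (simp add: power_add[of p 2 2, simplified])
  finally have "p ^ (2 * k) = p ^ 4 * m" using card_subgroup_pos[OF subgroup_center] by simp
  then have "4 \<le> 2 * k" using p_gt by (intro power_dvd_imp_le[of p]) auto
  then have k: "k \<ge> 2" by simp
  then have "4 + 2 * (k - 2) = 2 * k" by simp
  then have "p ^ (2 * k) = p ^ 4 * p ^ (2 * (k - 2))" by (simp only: power_add[symmetric])
  then have "p ^ 4 * m = p ^ 4 * p ^ (2 * (k - 2))" using \<open>p ^ (2 * k) = p ^ 4 * m\<close> by simp
  then have cK': "card ?K' = card Z * p ^ (2 * (k - 2))" using m p_pos by simp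
  have K'U: "?K' \<subseteq> U1 \<inter> U2"
  proof
    fix x assume x: "x \<in> ?K'"
    then have xG: "x \<in> carrier G" by (simp add: centr_def)
    have "cm x v = \<one>" "cm x u = \<one>" using x xG vG uG by (auto simp: centr_def cm_one_iff)
    then show "x \<in> U1 \<inter> U2" using vU[OF xG] uU[OF xG] by blast
  qed
  obtain Y where Y: "subgroup Y G" "Y \<inter> Z = ?S' \<inter> Z" "Y <#> Z = ?S' <#> ?K'"
    "central_products p ([Mp2 p (e + 1) 1, Mp3 p (f + 1) 1] @ replicate (k - 2) (Mp3 p 1 1)) (G\<lparr>carrier := Y\<rparr>)"
    using attach_exponent_p[OF att'(1-6) cK' exp_adjustable_mono[OF ex K'U] att'(10)] by auto
  have A_sub: "A \<subseteq> carrier G" using M(3) sub by blast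
  have "Y <#> Z = carrier G"
    using Y(3) att'(8) pair_group_mult[OF ctx subgroup_self aG vG A_sub] by simp
  moreover have "Y \<inter> Z = A <#> B"
  proof -
    have "Y \<inter> Z = A <#> (C <#> B)" using Y(2) att'(9) pair_group_center[OF ctx] by simp
    also have "\<dots> = C <#> B <#> A" using M(3) N(4) sub by (intro Z_set_mult_comm) auto
    finally show ?thesis using C_B_A(1)[OF t] by simp
  qed
  ultimately show ?thesis
    using finish_AB[where Q = Q, OF t(1) Y(1) _ _ Y(4) types] k by simp
qed

end

section \<open>The functionals given by \<open>p\<close>-th powers, and changes of basis\<close>

lemma prime_mult_mod_surj:
  fixes p s k :: nat
  assumes "Factorial_Ring.prime p" "\<not> p dvd s"
  shows "\<exists>i<p. (i * s) mod p = k mod p"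
proof -
  have p0: "p > 0" using assms(1) by (simp add: prime_gt_0_nat)
  have "coprime (int s) (int p)"
    using assms by (simp add: prime_imp_coprime coprime_commute)
  then obtain u v where uv: "u * int s + v * int p = 1"
    using bezout_int[of "int s" "int p"] by auto
  define i where "i = nat ((u * int k) mod int p)"
  have i: "int i = (u * int k) mod int p" using p0 by (simp add: i_def)
  have "int (i * s) mod int p = (u * int k * int s) mod int p"
    by (simp add: i mod_mult_left_eq)
  also have "u * int k * int s = int k + int p * (- v * int k)"
    using uv by (simp add: algebra_simps) (metis distrib_left mult.left_commute mult.right_neutral)
  also have "\<dots> mod int p = int k mod int p" by (rule mod_mult_self2)
  finally have "(i * s) mod p = k mod p" by (metis of_nat_mod of_nat_eq_iff)
  moreover have "i < p" using i p0 by (metis of_nat_less_iff pos_mod_bound of_nat_0_less_iff)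
  ultimately show ?thesis by blast
qed

context derived_prime_group
begin

lemma subgroup_finiteI:
  assumes "H \<subseteq> carrier G" "\<one> \<in> H" "\<And>x y. x \<in> H \<Longrightarrow> y \<in> H \<Longrightarrow> x \<otimes> y \<in> H"
  shows "subgroup H G"
proof (rule subgroupI)
  fix x assume x: "x \<in> H"
  then have xc: "x \<in> carrier G" using assms(1) by blast
  have "x [^] (n::nat) \<in> H" for n by (induction n) (use x assms in auto)
  moreover have "inv x = x [^] (ord x - 1)"
    using ord_ge_1[OF fin xc] by (intro inv_eq_pow[OF xc] pow_ord_eq_1 xc) simp
  ultimately show "inv x \<in> H" by simp
qed (use assms in auto)

text \<open>The kernel of the functional \<open>f\<^sub>1\<close>; exchanging \<open>x\<close> and \<open>y\<close> gives that of \<open>f\<^sub>2\<close>.\<close>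

definition pow_kernel :: "'a \<Rightarrow> 'a \<Rightarrow> 'a set" where
  "pow_kernel x y = {g \<in> carrier G. \<exists>(i::nat) j::nat. g [^] p = x [^] (p * i) \<otimes> y [^] j}"

text \<open>The data on the center that enter the case analysis. They are symmetric in the two
  factors, so each statement on the first functional yields the one on the second.\<close>

definition pow_basis :: "'a \<Rightarrow> 'a \<Rightarrow> nat \<Rightarrow> nat \<Rightarrow> 'a set \<Rightarrow> bool" where
  "pow_basis x y e f E \<longleftrightarrow> x \<in> Z \<and> y \<in> Z \<and> center_triple (generate G {x}) (generate G {y}) E \<and>
     ord x = p ^ e \<and> ord y = p ^ f \<and> e \<ge> 1 \<and> f \<ge> 1 \<and> (\<forall>a\<in>E. a [^] p = \<one>) \<and>
     (\<forall>g\<in>carrier G. \<exists>(i::nat) j::nat. g [^] p = x [^] i \<otimes> y [^] j)"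

lemma pow_basis_swap:
  assumes "pow_basis x y e f E"
  shows "pow_basis y x f e E"
proof -
  have xy: "x \<in> Z" "y \<in> Z" and ex: "\<forall>g\<in>carrier G. \<exists>(i::nat) j::nat. g [^] p = x [^] i \<otimes> y [^] j"
    using assms by (auto simp: pow_basis_def)
  have "x [^] i \<otimes> y [^] j = y [^] j \<otimes> x [^] i" for i j :: nat
    using xy by (intro Z_comm Z_pow_closed nat_pow_closed Z_closed)
  then have "\<forall>g\<in>carrier G. \<exists>(i::nat) j::nat. g [^] p = y [^] i \<otimes> x [^] j" using ex by metis
  then show ?thesis using assms center_triple_swap by (auto simp: pow_basis_def)
qed

lemma generate_nat_powE:
  assumes "a \<in> generate G {x}" "x \<in> carrier G"
  obtains n :: nat where "a = x [^] n"
  using generate_pow_nat[OF assms(2)] ord_ge_1[OF fin assms(2)] assms(1) by auto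

lemma Z_pair_comm: "x \<in> Z \<Longrightarrow> y \<in> Z \<Longrightarrow> x [^] (i::nat) \<otimes> y [^] (j::nat) = y [^] j \<otimes> x [^] i"
  by (intro Z_comm Z_pow_closed nat_pow_closed Z_closed)

lemma Z_pair_mult:
  assumes "x \<in> Z" "y \<in> Z"
  shows "(x [^] (i::nat) \<otimes> y [^] (j::nat)) \<otimes> (x [^] (i'::nat) \<otimes> y [^] (j'::nat)) = x [^] (i + i') \<otimes> y [^] (j + j')"
proof -
  note [simp] = Z_closed[OF assms(1)] Z_closed[OF assms(2)]
  have "(x [^] i \<otimes> y [^] j) \<otimes> (x [^] i' \<otimes> y [^] j') = x [^] i \<otimes> (y [^] j \<otimes> x [^] i') \<otimes> y [^] j'"
    by (simp add: m_assoc)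
  also have "y [^] j \<otimes> x [^] i' = x [^] i' \<otimes> y [^] j" by (rule Z_pair_comm[OF assms, symmetric])
  also have "x [^] i \<otimes> (x [^] i' \<otimes> y [^] j) \<otimes> y [^] j' = (x [^] i \<otimes> x [^] i') \<otimes> (y [^] j \<otimes> y [^] j')"
    by (simp add: m_assoc)
  finally show ?thesis using assms by (simp only: nat_pow_mult Z_closed)
qed

lemma Z_pair_pow:
  assumes "x \<in> Z" "y \<in> Z"
  shows "(x [^] (i::nat) \<otimes> y [^] (j::nat)) [^] (n::nat) = x [^] (i * n) \<otimes> y [^] (j * n)"
  using assms Z_closed by (subst pow_mult_distrib[OF Z_pair_comm]) (simp_all add: nat_pow_pow)

text \<open>Directness of the product of \<open><x>\<close> and \<open><y>\<close>, phrased with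
  natural exponents.\<close>

definition indep :: "'a \<Rightarrow> 'a \<Rightarrow> bool" where
  "indep x y \<longleftrightarrow> (\<forall>(i::nat) j::nat. x [^] i \<otimes> y [^] j = \<one> \<longrightarrow> x [^] i = \<one> \<and> y [^] j = \<one>)"

lemma indepD: "indep x y \<Longrightarrow> x [^] (i::nat) \<otimes> y [^] (j::nat) = \<one> \<Longrightarrow> x [^] i = \<one> \<and> y [^] j = \<one>"
  by (simp add: indep_def)

lemma indep_sym:
  assumes "x \<in> Z" "y \<in> Z" "indep x y"
  shows "indep y x"
  unfolding indep_def using indepD[OF assms(3)] by (simp add: Z_pair_comm[OF assms(2,1)])

text \<open>A shear of the basis. As \<open>ord y\<close> divides \<open>ord x\<close>, the factor
  \<open>y^j\<close> cannot raise the order. If a power of \<open>x'\<close> times a power of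
  \<open>y\<close> is trivial, its \<open>x\<close>-part forces \<open>p^e\<close> to divide the
  exponent of \<open>x'\<close>, and then the contribution of \<open>y^j\<close> is trivial
  too.\<close>

lemma indep_change:
  fixes i j :: nat
  assumes xy: "x \<in> Z" "y \<in> Z" and ord: "ord x = p ^ e" "ord y = p ^ f" and fe: "f \<le> e"
    and pi: "\<not> p dvd i" and ind: "indep x y"
  defines "x' \<equiv> x [^] i \<otimes> y [^] j"
  shows "x' \<in> Z" "ord x' = p ^ e" "indep x' y"
    "generate G {x'} <#> generate G {y} = generate G {x} <#> generate G {y}"
proof -
  note xc = Z_closed[OF xy(1)] and yc = Z_closed[OF xy(2)]
  show x'Z: "x' \<in> Z" unfolding x'_def
    by (intro subgroup.m_closed[OF subgroup_center] Z_pow_closed xy)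
  have x'c: "x' \<in> carrier G" using x'Z Z_closed by blast
  have gp: "generate G {x [^] i} = generate G {x}" "ord (x [^] i) = p ^ e"
    using generate_pow_coprime[OF xc ord(1) pi] by auto
  let ?A = "generate G {x}" and ?B = "generate G {y}" and ?A' = "generate G {x'}"
  have A: "subgroup ?A G" and B: "subgroup ?B G" and A': "subgroup ?A' G"
    using xc yc x'c by (auto intro: generate_is_subgroup)
  have BZ: "?B \<subseteq> Z" using generate_subgroup_incl[OF _ subgroup_center] xy by simp
  have AB: "subgroup (?A <#> ?B) G"
    using central_comm[OF BZ subgroup.subset[OF A]] by (intro subgroup_commuting_set_mult A B)
  have A'B: "subgroup (?A' <#> ?B) G"
    using central_comm[OF BZ subgroup.subset[OF A']] by (intro subgroup_commuting_set_mult A' B)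
  have y_pow: "y [^] n = \<one>" if "p ^ e dvd n" for n
  proof -
    have "p ^ f dvd n" using that fe le_imp_power_dvd dvd_trans by blast
    then show ?thesis using ord(2) yc by (simp add: pow_eq_id)
  qed
  have key: "p ^ e dvd n" if "x [^] (i * n) = \<one>" for n
  proof -
    have "(x [^] i) [^] n = \<one>" using that xc by (simp add: nat_pow_pow)
    then show ?thesis using gp(2) pow_eq_id[of "x [^] i" n] xc by simp
  qed
  have x'n: "x' [^] n = x [^] (i * n) \<otimes> y [^] (j * n)" for n :: nat
    unfolding x'_def by (rule Z_pair_pow[OF xy])
  show "?A' <#> ?B = ?A <#> ?B"
  proof (rule equalityI)
    have "x' \<in> ?A <#> ?B"
      unfolding x'_def mem_set_mult using generate_pow_mem xc yc by blast
    then have "?A' \<subseteq> ?A <#> ?B" using generate_subgroup_incl[OF _ AB] by simp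
    moreover have "?B \<subseteq> ?A <#> ?B" by (rule set_mult_upper(2)[OF A B])
    ultimately show "?A' <#> ?B \<subseteq> ?A <#> ?B"
      using subgroup.m_closed[OF AB] by (auto simp: mem_set_mult[of _ ?A'] subset_iff)
    have "x [^] i = x' \<otimes> inv (y [^] j)" using xc yc by (simp add: x'_def m_assoc)
    moreover have "x' \<in> ?A'" by (intro generate.incl) simp
    moreover have "inv (y [^] j) \<in> ?B"
      using subgroup.m_inv_closed[OF B generate_pow_mem[OF yc]] .
    ultimately have "x [^] i \<in> ?A' <#> ?B" unfolding mem_set_mult by blast
    then have "?A \<subseteq> ?A' <#> ?B" using generate_subgroup_incl[OF _ A'B, of "{x [^] i}"] gp(1) by simp
    moreover have "?B \<subseteq> ?A' <#> ?B" by (rule set_mult_upper(2)[OF A' B])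
    ultimately show "?A <#> ?B \<subseteq> ?A' <#> ?B"
      using subgroup.m_closed[OF A'B] by (auto simp: mem_set_mult[of _ ?A] subset_iff)
  qed
  show "indep x' y" unfolding indep_def
  proof (intro allI impI)
    fix n k :: nat
    assume "x' [^] n \<otimes> y [^] k = \<one>"
    then have h0: "x [^] (i * n) \<otimes> y [^] (j * n + k) = \<one>"
      using xc yc unfolding x'n by (simp add: m_assoc nat_pow_mult)
    then have h: "x [^] (i * n) = \<one>" "y [^] (j * n + k) = \<one>" using indepD[OF ind] by blast+
    then have "y [^] (j * n) = \<one>" using y_pow key by simp
    moreover have "y [^] (j * n) \<otimes> y [^] k = \<one>" using h(2) yc by (simp only: nat_pow_mult)
    ultimately show "x' [^] n = \<one> \<and> y [^] k = \<one>" using h(1) yc unfolding x'n by simp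
  qed
  show "ord x' = p ^ e"
  proof (rule dvd_antisym)
    have "x [^] (i * p ^ e) = \<one>" using ord(1) xc by (simp add: pow_eq_id)
    then have "x' [^] (p ^ e) = \<one>" using y_pow[of "j * p ^ e"] by (simp add: x'n)
    then show "ord x' dvd p ^ e" using x'c by (simp add: pow_eq_id)
    have "x [^] (i * ord x') \<otimes> y [^] (j * ord x') = \<one>" using pow_ord_eq_1[OF x'c] by (simp add: x'n)
    then show "p ^ e dvd ord x'" using indepD[OF ind] key by blast
  qed
qed

context
  fixes x y e f E
  assumes basis: "pow_basis x y e f E"
begin

lemma basisD: "x \<in> Z" "y \<in> Z" "center_triple (generate G {x}) (generate G {y}) E"
  "ord x = p ^ e" "ord y = p ^ f" "e \<ge> 1" "f \<ge> 1" "\<And>a. a \<in> E \<Longrightarrow> a [^] p = \<one>"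
  "\<And>g. g \<in> carrier G \<Longrightarrow> \<exists>(i::nat) j::nat. g [^] p = x [^] i \<otimes> y [^] j"
  using basis by (auto simp: pow_basis_def)

lemma xy_closed [simp]: "x \<in> carrier G" "y \<in> carrier G"
  using basisD Z_closed by blast+

lemmas xy_pow_comm = Z_pair_comm[OF basisD(1,2)]
lemmas xy_pow_mult = Z_pair_mult[OF basisD(1,2)]
lemmas xy_pow_pow = Z_pair_pow[OF basisD(1,2)]

lemma xy_pow_one:
  assumes "x [^] (i::nat) \<otimes> y [^] (j::nat) = \<one>"
  shows "x [^] i = \<one>" "y [^] j = \<one>"
  using center_tripleD(8)[OF basisD(3), of "x [^] i" "y [^] j" \<one>] assms generate_pow_mem[of x i]
    generate_pow_mem[of y j] subgroup.one_closed[OF center_tripleD(3)[OF basisD(3)]]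
  by simp_all

lemma indep_xy: "indep x y"
  unfolding indep_def using xy_pow_one by blast

lemma p_dvd_ord: "p dvd ord x" using basisD(4,6) by simp

text \<open>The functional is well defined: the exponent of \<open>x\<close> is determined modulo
  \<open>ord x\<close>, a multiple of \<open>p\<close>.\<close>

lemma pow_x_cong:
  assumes "x [^] (i::nat) \<otimes> y [^] (j::nat) = x [^] (i'::nat) \<otimes> y [^] (j'::nat)"
  shows "i mod p = i' mod p"
proof -
  \<comment> \<open>Exponents are natural numbers. Instead of dividing by the right-hand side, both
    sides are multiplied by powers with exponents complementary to \<open>i'\<close> and
    \<open>j'\<close> with respect to a common multiple \<open>N\<close> of the two orders.\<close>
  define N where "N = ord x * ord y"
  have N: "x [^] (N * k) = \<one>" "y [^] (N * k) = \<one>" for k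
    by (simp_all add: pow_eq_id N_def)
  have pos: "N \<ge> 1" using basisD(4,5) p_pos by (simp add: N_def)
  define r where "r = N * (i' + 1) - i'"
  define s where "s = N * (j' + 1) - j'"
  have le: "i' \<le> N * (i' + 1)" "j' \<le> N * (j' + 1)"
    using mult_le_mono[OF pos, of i' "i' + 1"] mult_le_mono[OF pos, of j' "j' + 1"] by simp_all
  then have rs: "i' + r = N * (i' + 1)" "j' + s = N * (j' + 1)" by (simp_all add: r_def s_def)
  have "x [^] (i + r) \<otimes> y [^] (j + s) = x [^] (i' + r) \<otimes> y [^] (j' + s)"
    unfolding xy_pow_mult[symmetric] assms ..
  also have "\<dots> = \<one>" unfolding rs N by simp
  finally have "x [^] (i + r) = \<one>" by (rule xy_pow_one)
  then have "ord x dvd i + r" using pow_eq_id by simp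
  then have "p dvd i + r" using p_dvd_ord dvd_trans by blast
  moreover have "p dvd i' + r" unfolding rs using p_dvd_ord by (simp add: N_def)
  ultimately have "(i + r) mod p = (i' + r) mod p" by simp
  then show ?thesis using mod_add_cong[of "i + r" p "i' + r" "r * (p - 1)" "r * (p - 1)"] p_pos
    by (simp add: add.assoc) (metis Suc_pred mult_Suc_right mod_mult_self1 mult.commute)
qed

lemma mem_pow_kernel:
  assumes "g \<in> carrier G" "g [^] p = x [^] (i::nat) \<otimes> y [^] (j::nat)"
  shows "g \<in> pow_kernel x y \<longleftrightarrow> p dvd i"
proof
  assume "g \<in> pow_kernel x y"
  then obtain i' j' :: nat where "g [^] p = x [^] (p * i') \<otimes> y [^] j'" by (auto simp: pow_kernel_def)
  then have "i mod p = (p * i') mod p" using assms pow_x_cong[of i j "p * i'" j'] by simp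
  then show "p dvd i" by auto
next
  assume "p dvd i"
  then show "g \<in> pow_kernel x y" using assms by (auto simp: pow_kernel_def)
qed

text \<open>The factor \<open>E\<close> disappears because its elements have trivial
  \<open>p\<close>-th power. Hence both functionals vanish on the center and live on
  \<open>V\<close>.\<close>

lemma Z_pow_p: "z \<in> Z \<Longrightarrow> \<exists>(i::nat) j::nat. z [^] p = x [^] (p * i) \<otimes> y [^] (p * j)"
proof -
  assume z: "z \<in> Z"
  note t = center_tripleD[OF basisD(3)]
  obtain a b d where abd: "a \<in> generate G {x}" "b \<in> generate G {y}" "d \<in> E" "z = a \<otimes> b \<otimes> d"
    using equalityD2[OF t(7), THEN subsetD, OF z] by (auto simp: mem_set_mult)
  obtain i j :: nat where ij: "a = x [^] i" "b = y [^] j"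
    using generate_nat_powE[OF abd(1)] generate_nat_powE[OF abd(2)] xy_closed by metis
  have dZ: "d \<in> Z" using abd t(6) by blast
  have "z [^] p = (x [^] i \<otimes> y [^] j) [^] p \<otimes> d [^] p"
    unfolding abd(4) ij by (rule Z_pow_distrib[OF dZ]) simp
  also have "\<dots> = x [^] (p * i) \<otimes> y [^] (p * j)"
    by (simp add: xy_pow_pow basisD(8)[OF abd(3)] mult.commute)
  finally show ?thesis by blast
qed

lemma Z_sub_pow_kernel: "Z \<subseteq> pow_kernel x y"
  using Z_pow_p Z_closed unfolding pow_kernel_def by blast

lemma subgroup_pow_kernel: "subgroup (pow_kernel x y) G"
proof (rule subgroup_finiteI)
  show "\<one> \<in> pow_kernel x y" using Z_sub_pow_kernel subgroup.one_closed[OF subgroup_center] by blast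
  fix g h assume gh: "g \<in> pow_kernel x y" "h \<in> pow_kernel x y"
  then obtain i j i' j' :: nat where *: "g [^] p = x [^] (p * i) \<otimes> y [^] j"
    "h [^] p = x [^] (p * i') \<otimes> y [^] j'" by (auto simp: pow_kernel_def)
  have "(g \<otimes> h) [^] p = x [^] (p * i + p * i') \<otimes> y [^] (j + j')"
    using gh pow_p_mult[of g h] by (simp add: * xy_pow_mult pow_kernel_def)
  also have "p * i + p * i' = p * (i + i')" by (simp add: distrib_left)
  finally show "g \<otimes> h \<in> pow_kernel x y" using gh unfolding pow_kernel_def by blast
qed (auto simp: pow_kernel_def)

text \<open>For \<open>a\<close> outside the kernel, the powers \<open>a^i\<close> with
  \<open>i < p\<close> are coset representatives, because the value \<open>s\<close> of the
  functional at \<open>a\<close> is invertible modulo \<open>p\<close>.\<close>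

lemma card_pow_kernel:
  assumes "pow_kernel x y \<noteq> carrier G"
  shows "card (carrier G) = p * card (pow_kernel x y)"
proof -
  let ?U = "pow_kernel x y"
  have Usub: "?U \<subseteq> carrier G" by (auto simp: pow_kernel_def)
  then obtain a where a: "a \<in> carrier G" "a \<notin> ?U" using assms by blast
  obtain s t :: nat where st: "a [^] p = x [^] s \<otimes> y [^] t" using basisD(9)[OF a(1)] by blast
  have ps: "\<not> p dvd s" using mem_pow_kernel[OF a(1) st] a(2) by simp
  have ai: "(a [^] i \<otimes> u) [^] p = x [^] (i * s + k) \<otimes> y [^] (i * t + l)"
    if "u \<in> carrier G" "u [^] p = x [^] k \<otimes> y [^] l" for i u and k l :: nat
  proof -
    have "(a [^] i) [^] p = (a [^] p) [^] i" using a(1) by (simp add: nat_pow_pow mult.commute)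
    also have "\<dots> = x [^] (i * s) \<otimes> y [^] (i * t)" by (simp add: st xy_pow_pow mult.commute)
    finally show ?thesis using a(1) that pow_p_mult[of "a [^] i" u] by (simp add: xy_pow_mult)
  qed
  define F where "F = (\<lambda>(i::nat, u). a [^] i \<otimes> u)"
  have "inj_on F ({..<p} \<times> ?U)"
  proof (rule inj_onI, clarsimp simp: F_def)
    fix i u i' u'
    assume h: "i < p" "i' < p" "u \<in> ?U" "u' \<in> ?U" and eq: "a [^] i \<otimes> u = a [^] i' \<otimes> u'"
    obtain k l k' l' :: nat where kl: "u [^] p = x [^] (p * k) \<otimes> y [^] l"
      "u' [^] p = x [^] (p * k') \<otimes> y [^] l'" using h by (auto simp: pow_kernel_def)
    have uc: "u \<in> carrier G" "u' \<in> carrier G" using h Usub by auto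
    have "x [^] (i * s + p * k) \<otimes> y [^] (i * t + l) = x [^] (i' * s + p * k') \<otimes> y [^] (i' * t + l')"
      using ai[OF uc(1) kl(1), of i] ai[OF uc(2) kl(2), of i'] eq by simp
    then have "(i * s) mod p = (i' * s) mod p" using pow_x_cong by fastforce
    from arg_cong[OF this, of int] have "int (i * s) mod int p = int (i' * s) mod int p"
      by (simp only: zmod_int)
    then have "int p dvd int (i * s) - int (i' * s)" by (simp only: mod_eq_dvd_iff)
    also have "int (i * s) - int (i' * s) = (int i - int i') * int s" by (simp add: left_diff_distrib)
    finally have "int p dvd (int i - int i') * int s" .
    moreover have "Factorial_Ring.prime (int p)" using prime by simp
    moreover have "\<not> int p dvd int s" using ps by simp
    ultimately have "int p dvd int i - int i'" using prime_dvd_multD by blast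
    then have "int i mod int p = int i' mod int p" by (simp add: mod_eq_dvd_iff)
    then have ii: "i = i'" using h by simp
    from eq[unfolded ii] have "u = u'" using uc a(1) l_cancel[of "a [^] i'" u u'] by blast
    then show "i = i' \<and> u = u'" using ii by simp
  qed
  moreover have "F ` ({..<p} \<times> ?U) = carrier G"
  proof (rule equalityI; rule subsetI)
    fix g assume "g \<in> F ` ({..<p} \<times> ?U)"
    then show "g \<in> carrier G" using a(1) Usub by (auto simp: F_def)
  next
    fix g assume g: "g \<in> carrier G"
    obtain k l :: nat where kl: "g [^] p = x [^] k \<otimes> y [^] l" using basisD(9)[OF g] by blast
    obtain i where i: "i < p" "(i * s) mod p = k mod p" using prime_mult_mod_surj[OF prime ps] by blast
    define u where "u = inv (a [^] i) \<otimes> g"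
    have u: "u \<in> carrier G" "a [^] i \<otimes> u = g" using a(1) g by (simp_all add: u_def mult_inv_cancel)
    obtain k' l' :: nat where kl': "u [^] p = x [^] k' \<otimes> y [^] l'" using basisD(9)[OF u(1)] by blast
    have "x [^] (i * s + k') \<otimes> y [^] (i * t + l') = x [^] k \<otimes> y [^] l"
      using ai[OF u(1) kl', of i] u(2) kl by simp
    then have "(i * s + k') mod p = (i * s) mod p" using pow_x_cong i(2) by metis
    then have "p dvd (i * s + k') - i * s" using mod_eq_dvd_iff_nat[of "i * s" "i * s + k'" p] by simp
    then have "p dvd k'" by simp
    then have "u \<in> ?U" using mem_pow_kernel[OF u(1) kl'] by simp
    then show "g \<in> F ` ({..<p} \<times> ?U)"
      using i(1) u(2) by (intro image_eqI[of _ _ "(i, u)"]) (auto simp: F_def)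
  qed
  ultimately have "card (carrier G) = card ({..<p} \<times> ?U)" using card_image by metis
  then show ?thesis by (simp add: card_cartesian_product)
qed

text \<open>When only the exponent of \<open>x\<close> is prime to \<open>p\<close>, the
  \<open>y\<close>-part of \<open>g^p\<close> is the \<open>p\<close>-th power of a central element
  and can be removed; what is left generates \<open><x>\<close>.\<close>

lemma pow_kernel_adjust:
  assumes g: "g \<in> pow_kernel y x" "g \<notin> pow_kernel x y"
  shows "\<exists>w\<in>Z. generate G {(g \<otimes> w) [^] p} = generate G {x} \<and> ord ((g \<otimes> w) [^] p) = p ^ e"
proof -
  have gc: "g \<in> carrier G" using g by (simp add: pow_kernel_def)
  obtain i j :: nat where "g [^] p = y [^] (p * i) \<otimes> x [^] j" using g by (auto simp: pow_kernel_def)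
  then have gp: "g [^] p = x [^] j \<otimes> y [^] (p * i)" by (simp add: xy_pow_comm)
  have pj: "\<not> p dvd j" using mem_pow_kernel[OF gc gp] g(2) by simp
  define w where "w = inv (y [^] i)"
  have w: "w \<in> Z" unfolding w_def
    by (intro subgroup.m_inv_closed[OF subgroup_center] Z_pow_closed basisD)
  have "(g \<otimes> w) [^] p = x [^] j \<otimes> y [^] (p * i) \<otimes> inv (y [^] (p * i))"
    by (simp add: Z_pow_distrib[OF w[unfolded w_def] gc] gp w_def nat_pow_inv nat_pow_pow mult.commute)
  then have gw: "(g \<otimes> w) [^] p = x [^] j" by (simp add: m_assoc)
  show ?thesis
    using w generate_pow_coprime[OF xy_closed(1) basisD(4) pj] unfolding gw[symmetric] by blast
qed

text \<open>Both exponents are divisible by \<open>p\<close>, so \<open>g^p\<close> has a central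
  \<open>p\<close>-th root, whose inverse is the correction.\<close>

lemma exp_adjustable_pow_kernel: "exp_adjustable (pow_kernel x y \<inter> pow_kernel y x)"
  unfolding exp_adjustable_def
proof
  fix g assume g: "g \<in> pow_kernel x y \<inter> pow_kernel y x"
  then have gc: "g \<in> carrier G" by (simp add: pow_kernel_def)
  obtain i j :: nat where "g [^] p = y [^] (p * i) \<otimes> x [^] j" using g by (auto simp: pow_kernel_def)
  then have gp: "g [^] p = x [^] j \<otimes> y [^] (p * i)" by (simp add: xy_pow_comm)
  then have "p dvd j" using mem_pow_kernel[OF gc gp] g by simp
  then obtain j' where j': "j = p * j'" by auto
  define v where "v = x [^] j' \<otimes> y [^] i"
  have v: "v \<in> Z" unfolding v_def
    by (intro subgroup.m_closed[OF subgroup_center] Z_pow_closed basisD)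
  have vp: "v [^] p = g [^] p" by (simp add: v_def xy_pow_pow gp j' mult.commute)
  have w: "inv v \<in> Z" by (rule subgroup.m_inv_closed[OF subgroup_center v])
  have "(g \<otimes> inv v) [^] p = g [^] p \<otimes> inv (g [^] p)"
    by (simp add: Z_pow_distrib[OF w gc] nat_pow_inv[OF Z_closed[OF v]] vp)
  then show "\<exists>w\<in>Z. (g \<otimes> w) [^] p = \<one>" using w gc by (intro bexI[of _ "inv v"]) simp_all
qed

text \<open>Makes \<open><a^p>\<close> a direct factor of the center when \<open>a^p\<close>
  involves both \<open>x\<close> and \<open>y\<close>, the situation for proportional
  functionals.\<close>

lemma change_basis:
  fixes i j :: nat
  assumes fe: "f \<le> e" and pi: "\<not> p dvd i"
  defines "x' \<equiv> x [^] i \<otimes> y [^] j"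
  shows "center_triple (generate G {x'}) (generate G {y}) E" "ord x' = p ^ e"
proof -
  note t = center_tripleD[OF basisD(3)]
  note ic = indep_change[OF basisD(1,2,4,5) fe pi indep_xy, of j, folded x'_def]
  have x'c: "x' \<in> carrier G" using ic(1) Z_closed by blast
  have A': "subgroup (generate G {x'}) G" using x'c by (intro generate_is_subgroup) simp
  have A'Z: "generate G {x'} \<subseteq> Z" using generate_subgroup_incl[OF _ subgroup_center] ic(1) by simp
  show "ord x' = p ^ e" by (rule ic(2))
  have "a = \<one> \<and> b = \<one> \<and> d = \<one>"
    if abd: "a \<in> generate G {x'}" "b \<in> generate G {y}" "d \<in> E" "a \<otimes> b \<otimes> d = \<one>" for a b d
  proof -
    obtain n :: nat where n1: "a = x' [^] n" using generate_nat_powE[OF abd(1) x'c] .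
    obtain k :: nat where n2: "b = y [^] k" using generate_nat_powE[OF abd(2) xy_closed(2)] .
    note n = n1 n2
    have ab: "a \<otimes> b = x [^] (i * n) \<otimes> y [^] (j * n + k)"
      unfolding n x'_def by (simp add: xy_pow_pow m_assoc nat_pow_mult)
    have "x [^] (i * n) = \<one> \<and> y [^] (j * n + k) = \<one> \<and> d = \<one>"
      by (rule t(8)[OF generate_pow_mem[OF xy_closed(1)] generate_pow_mem[OF xy_closed(2)] abd(3)])
        (use abd(4) ab in simp)
    then have "a \<otimes> b = \<one>" "d = \<one>" using ab by simp_all
    then show ?thesis using indepD[OF ic(3)] unfolding n by blast
  qed
  then show "center_triple (generate G {x'}) (generate G {y}) E"
    unfolding center_triple_def using A' A'Z t(2,3,5,6,7) ic(4) by simp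
qed

text \<open>An element of order \<open>p\<close> in \<open><x>\<close> is a power of
  \<open>x^i\<close> whose exponent is divisible by \<open>p^(e-1)\<close>, hence, as
  \<open>f < e\<close>, by the order of \<open>y\<close>. Raising \<open>x^i y^j\<close> to this
  exponent loses the \<open>y\<close>-part.\<close>

lemma change_basis_socle:
  assumes fe: "f < e" and pi: "\<not> p dvd i" and C: "C \<subseteq> generate G {x}"
  shows "C \<subseteq> generate G {x [^] (i::nat) \<otimes> y [^] (j::nat)}"
proof -
  have gp: "generate G {x [^] i} = generate G {x}" "ord (x [^] i) = p ^ e"
    using generate_pow_coprime[OF xy_closed(1) basisD(4) pi] by auto
  have "c \<in> C" by (intro generate.incl) simp
  then have c: "c \<in> generate G {x [^] i}" "c [^] p = \<one>" using C gp C_pow_p by auto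
  obtain n :: nat where n: "c = (x [^] i) [^] n" using generate_nat_powE[OF c(1)] by auto
  have "(x [^] i) [^] (n * p) = \<one>" using c(2) by (simp add: n nat_pow_pow mult.assoc)
  then have "p ^ e dvd n * p" using gp(2) pow_eq_id[of "x [^] i" "n * p"] by simp
  moreover have "p ^ e = p ^ (e - 1) * p" using fe by (cases e) simp_all
  ultimately have "p ^ (e - 1) dvd n" using p_pos by simp
  moreover have "p ^ f dvd p ^ (e - 1)" using fe by (intro le_imp_power_dvd) simp
  ultimately have "p ^ f dvd j * n" by (meson dvd_trans dvd_mult)
  then have "y [^] (j * n) = \<one>" using basisD(5) by (simp add: pow_eq_id)
  then have "(x [^] i \<otimes> y [^] j) [^] n = c" by (simp add: xy_pow_pow n nat_pow_pow)
  then have "c \<in> generate G {x [^] i \<otimes> y [^] j}"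
    using generate_pow_mem[of "x [^] i \<otimes> y [^] j" n] by simp
  then show ?thesis by (intro generate_subgroup_incl generate_is_subgroup) auto
qed

end

section \<open>Case analysis on the two functionals\<close>

lemma Cyc_generate: "x \<in> carrier G \<Longrightarrow> ord x = q \<Longrightarrow> Cyc q (G\<lparr>carrier := generate G {x}\<rparr>)"
  using cyclic_subgroup_iso[of x] ord_ge_1[OF fin, of x] by (auto simp: Cyc_def iso_to_def)

text \<open>One statement for all cases with \<open>c\<close> in a cyclic factor: five alternatives
  for arbitrary functionals, and the two that survive when the first or the second functional is
  zero, as in types \<open>A_2\<close> and \<open>A_3\<close>. Exchanging \<open>x\<close> and
  \<open>y\<close> covers \<open>c\<close> in the other factor.\<close>

lemma classification:
  fixes k
  defines "R n \<equiv> replicate (k - n) (Mp3 p 1 1)"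
  assumes b: "pow_basis x y e f E" and C: "C \<subseteq> generate G {x}"
    and card: "card (carrier G) = card Z * p ^ (2 * k)" and Q: "Q (G\<lparr>carrier := E\<rparr>)"
  shows "(direct_products [central_products p (Mp2 p (e + 1) (f + 1) # R 1), Q] G \<or>
    (k \<ge> 2 \<and> direct_products [central_products p (Mp2 p (e + 1) 1 # Mp3 p (f + 1) 1 # R 2), Q] G) \<or>
    direct_products [central_products p (Mp2 p (e + 1) 1 # R 1), Cyc (p ^ f), Q] G \<or>
    direct_products [central_products p (Mp3 p (f + 1) 1 # R 1 @ [Cyc (p ^ e)]), Q] G \<or>
    direct_products [central_products p (R 0 @ [Cyc (p ^ e)]), Cyc (p ^ f), Q] G) \<and>
   (pow_kernel x y = carrier G \<longrightarrow>
    direct_products [central_products p (Mp3 p (f + 1) 1 # R 1 @ [Cyc (p ^ e)]), Q] G \<or>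
    direct_products [central_products p (R 0 @ [Cyc (p ^ e)]), Cyc (p ^ f), Q] G) \<and>
   (pow_kernel y x = carrier G \<longrightarrow>
    direct_products [central_products p (Mp2 p (e + 1) 1 # R 1), Cyc (p ^ f), Q] G \<or>
    direct_products [central_products p (R 0 @ [Cyc (p ^ e)]), Cyc (p ^ f), Q] G)"
    (is "(?T1 \<or> ?T2 \<or> ?T3 \<or> ?T4 \<or> ?T5) \<and> _")
proof -
  note b' = pow_basis_swap[OF b]
  note D = basisD[OF b]
  note xyc = xy_closed[OF b]
  let ?U = "pow_kernel x y" and ?V = "pow_kernel y x"
  let ?A = "generate G {x}" and ?B = "generate G {y}"
  note U = subgroup_pow_kernel[OF b] Z_sub_pow_kernel[OF b] card_pow_kernel[OF b]
  note V = subgroup_pow_kernel[OF b'] Z_sub_pow_kernel[OF b'] card_pow_kernel[OF b']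
  note ex = exp_adjustable_pow_kernel[OF b]
  note A = pow_kernel_adjust[OF b] and B = pow_kernel_adjust[OF b']
  have UV: "?U \<subseteq> carrier G" "?V \<subseteq> carrier G" by (auto simp: pow_kernel_def)
  have cycA: "Cyc (p ^ e) (G\<lparr>carrier := ?A\<rparr>)" by (rule Cyc_generate[OF xyc(1) D(4)])
  have cycB: "Cyc (p ^ f) (G\<lparr>carrier := ?B\<rparr>)" by (rule Cyc_generate[OF xyc(2) D(5)])
  note t = D(3)
  have T5: ?T5 if h: "?U = carrier G" "?V = carrier G"
  proof -
    have "exp_adjustable (carrier G)" using ex h by simp
    from type_M3_power[where P = "Cyc (p ^ e)" and P' = "Cyc (p ^ f)" and Q = Q, OF t C this card cycA cycB Q]
    show ?thesis by (simp add: R_def)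
  qed
  have T4: ?T4 if h: "?U = carrier G" "?V \<noteq> carrier G"
  proof -
    obtain g where g: "g \<in> ?U" "g \<notin> ?V" using h UV by blast
    obtain w where w: "w \<in> Z" "generate G {(g \<otimes> w) [^] p} = ?B" "ord ((g \<otimes> w) [^] p) = p ^ f"
      using B[OF g] by blast
    have gc: "g \<in> carrier G" "g \<otimes> w \<in> carrier G" using g UV w Z_closed by auto
    have "g \<otimes> w \<notin> ?V"
    proof
      assume "g \<otimes> w \<in> ?V"
      then have "g \<otimes> w \<otimes> inv w \<in> ?V"
        using V(2) w(1) subgroup.m_closed[OF V(1)] subgroup.m_inv_closed[OF V(1)] by blast
      then show False using g(2) gc Z_closed[OF w(1)] by (simp add: m_assoc)
    qed
    moreover have "exp_adjustable ?V" using ex h(1) UV(2) by (simp add: Int_absorb1)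
    ultimately have "direct_products [central_products p
        (Mp3 p (f + 1) 1 # replicate (k - 1) (Mp3 p 1 1) @ [Cyc (p ^ e)]), Q] G"
      using h(2) gc w t cycA Q by (intro type_M3_one[of ?A "g \<otimes> w" E ?V] C V card) auto
    then show ?thesis by (simp add: R_def)
  qed
  have T3: ?T3 if h: "?V = carrier G" "?U \<noteq> carrier G"
  proof -
    obtain g where g: "g \<in> ?V" "g \<notin> ?U" using h UV by blast
    obtain w where w: "w \<in> Z" "generate G {(g \<otimes> w) [^] p} = ?A" "ord ((g \<otimes> w) [^] p) = p ^ e"
      using A[OF g] by blast
    have gc: "g \<in> carrier G" "g \<otimes> w \<in> carrier G" using g UV w Z_closed by auto
    have "g \<otimes> w \<notin> ?U"
    proof
      assume "g \<otimes> w \<in> ?U"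
      then have "g \<otimes> w \<otimes> inv w \<in> ?U"
        using U(2) w(1) subgroup.m_closed[OF U(1)] subgroup.m_inv_closed[OF U(1)] by blast
      then show False using g(2) gc Z_closed[OF w(1)] by (simp add: m_assoc)
    qed
    moreover have "exp_adjustable ?U" using ex h(1) UV(1) by (simp add: Int_absorb2)
    ultimately have "direct_products [central_products p
        (Mp2 p (e + 1) 1 # replicate (k - 1) (Mp3 p 1 1)), Cyc (p ^ f), Q] G"
      using h(2) gc w t cycB Q D(6) C by (intro type_M2_one[of "g \<otimes> w" ?B E ?U] U card) auto
    then show ?thesis by (simp add: R_def)
  qed
  have indep: "?T1 \<or> ?T2 \<or> ?T3 \<or> ?T4" if h: "?U \<noteq> carrier G" "?V \<noteq> carrier G"
  \<comment> \<open>The kernels have equal order, so inclusion means that the functionals are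
    proportional.\<close>
  proof (cases "?V \<subseteq> ?U")
    case True
    have "card ?V = card ?U" using U(3)[OF h(1)] V(3)[OF h(2)] p_pos by simp
    then have eq: "?V = ?U" using card_subset_eq[OF finite_sub[OF U(1)] True] by simp
    then have exU: "exp_adjustable ?U" "exp_adjustable ?V" using ex by simp_all
    obtain a where a: "a \<in> carrier G" "a \<notin> ?U" using h UV by blast
    obtain i j :: nat where ij: "a [^] p = x [^] i \<otimes> y [^] j" using D(9)[OF a(1)] by blast
    then have ji: "a [^] p = y [^] j \<otimes> x [^] i" by (simp add: xy_pow_comm[OF b])
    have pi: "\<not> p dvd i" using mem_pow_kernel[OF b a(1) ij] a(2) by simp
    have pj: "\<not> p dvd j" using mem_pow_kernel[OF b' a(1) ji] a(2) eq by simp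
    show ?thesis
    \<comment> \<open>Both exponents of \<open>a^p\<close> are prime to \<open>p\<close>. For
      \<open>f < e\<close> it replaces \<open>x\<close>, and \<open>C\<close> stays in the new first
      factor, giving \<open>M_p(e+1,1)\<close>. Otherwise it replaces \<open>y\<close> and the
      factor \<open><x>\<close> containing \<open>C\<close> is kept, giving
      \<open>M_p(f+1,1,1)\<close>.\<close>
    proof (cases "f < e")
      case True
      have "center_triple (generate G {a [^] p}) ?B E" "ord (a [^] p) = p ^ e"
        "C \<subseteq> generate G {a [^] p}"
        using change_basis[OF b _ pi, of j] change_basis_socle[OF b True pi C, of j] True
        unfolding ij by simp_all
      from type_M2_one[where P = "Cyc (p ^ f)" and Q = Q,
          OF this(1,3) U(1,2) U(3)[OF h(1)] exU(1) a this(2) D(6) card cycB Q]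
      show ?thesis by (simp add: R_def)
    next
      case False
      have "center_triple (generate G {a [^] p}) ?A E" "ord (a [^] p) = p ^ f"
        using change_basis[OF b' _ pj, of i] False unfolding ji by simp_all
      from type_M3_one[where P = "Cyc (p ^ e)" and Q = Q,
          OF center_triple_swap[OF this(1)] C U(1,2) U(3)[OF h(1)] exU(1) a this(2) card cycA Q]
      show ?thesis by (simp add: R_def)
    qed
  next
    case False
    obtain u where u: "u \<in> ?U" "u \<notin> Z" "\<And>g. g \<in> carrier G \<Longrightarrow> g \<in> ?U \<longleftrightarrow> cm g u = \<one>"
      using maximal_subgroup_dual[OF U(1,2) U(3)[OF h(1)]] by blast
    obtain v where v: "v \<in> ?V" "v \<notin> Z" "\<And>g. g \<in> carrier G \<Longrightarrow> g \<in> ?V \<longleftrightarrow> cm g v = \<one>"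
      using maximal_subgroup_dual[OF V(1,2) V(3)[OF h(2)]] by blast
    have uc: "u \<in> carrier G" and vc: "v \<in> carrier G" using u(1) v(1) UV by auto
    show ?thesis
    \<comment> \<open>Commuting duals need two orthogonal pairs. Otherwise the duals themselves,
      after central corrections, form one pair: the \<open>p\<close>-th power of \<open>v\<close>
      then generates \<open><x>\<close> and that of \<open>u\<close> generates
      \<open><y>\<close>.\<close>
    proof (cases "cm v u = \<one>")
      case True
      then have "cm u v = \<one>" using cm_swap[OF vc uc] by simp
      then have uv: "u \<in> ?V" "v \<in> ?U" using u(3)[OF vc] v(3)[OF uc] True by auto
      have "k \<ge> 2 \<and> direct_products [central_products p
        (Mp2 p (e + 1) 1 # Mp3 p (f + 1) 1 # replicate (k - 2) (Mp3 p 1 1)), Q] G"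
        by (rule type_M2_M3[where Q = Q, OF t C U(1,2) U(3)[OF h(1)] V(1,2) V(3)[OF h(2)] ex A B D(6)
            u(1) uv(1) u(3) uv(2) v(1) v(3) v(2) False card Q])
      then show ?thesis by (simp add: R_def)
    next
      case False
      then have "cm u v \<noteq> \<one>" using cm_swap[OF uc vc] cm_closed[OF uc vc] by auto
      then have uv: "u \<notin> ?V" "v \<notin> ?U" using u(3)[OF vc] v(3)[OF uc] False by auto
      obtain w where w: "w \<in> Z" "generate G {(v \<otimes> w) [^] p} = ?A" "ord ((v \<otimes> w) [^] p) = p ^ e"
        using A[OF v(1) uv(2)] by blast
      obtain w' where w': "w' \<in> Z" "generate G {(u \<otimes> w') [^] p} = ?B" "ord ((u \<otimes> w') [^] p) = p ^ f"
        using B[OF u(1) uv(1)] by blast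
      have cl: "v \<otimes> w \<in> carrier G" "u \<otimes> w' \<in> carrier G" "w \<in> carrier G" "w' \<in> carrier G"
        using uc vc w(1) w'(1) Z_closed by auto
      have nz: "cm (v \<otimes> w) (u \<otimes> w') \<noteq> \<one>" using False cl uc vc w(1) w'(1) by (simp add: cm_adjust)
      have sub: "centr (carrier G) {v \<otimes> w, u \<otimes> w'} \<subseteq> ?U \<inter> ?V"
      proof
        fix g assume g: "g \<in> centr (carrier G) {v \<otimes> w, u \<otimes> w'}"
        then have gc: "g \<in> carrier G" by (simp add: centr_def)
        have "cm g (v \<otimes> w) = \<one>" "cm g (u \<otimes> w') = \<one>" using g gc cl by (simp_all add: centr_pair_iff)
        then have "cm g v = \<one>" "cm g u = \<one>" using gc uc vc w(1) w'(1) by (simp_all add: cm_adjust)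
        then show "g \<in> ?U \<inter> ?V" using u(3)[OF gc] v(3)[OF gc] by simp
      qed
      have "center_triple (generate G {(v \<otimes> w) [^] p}) (generate G {(u \<otimes> w') [^] p}) E"
        "C \<subseteq> generate G {(v \<otimes> w) [^] p}" unfolding w(2) w'(2) by (rule t, rule C)
      from type_M2_two[where Q = Q, OF this exp_adjustable_mono[OF ex sub] cl(1) w(3) D(6) cl(2) w'(3) nz card Q]
      show ?thesis by (simp add: R_def)
    qed
  qed
  show ?thesis
    by (cases "?U = carrier G"; cases "?V = carrier G") (use T5 T4 T3 indep in blast)+
qed

end

section \<open>Decompositions of the center\<close>

context group
begin

lemma card_set_mult_le:
  assumes "finite H" "finite K"
  shows "card (H <#> K) \<le> card H * card K"
proof -
  have "H <#> K = (\<lambda>(h, k). h \<otimes> k) ` (H \<times> K)" by (auto simp: set_mult_def)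
  then show ?thesis using card_image_le[of "H \<times> K"] assms by (simp add: card_cartesian_product)
qed

lemma card_set_mult_disjoint:
  assumes H: "subgroup H G" and K: "subgroup K G" and int: "H \<inter> K \<subseteq> {\<one>}"
  shows "card (H <#> K) = card H * card K"
proof -
  note cl = subgroup.mem_carrier[OF H] subgroup.mem_carrier[OF K]
  have "inj_on (\<lambda>(h, k). h \<otimes> k) (H \<times> K)"
  proof (rule inj_onI, clarify)
    fix h k h' k' assume m: "h \<in> H" "k \<in> K" "h' \<in> H" "k' \<in> K" and eq: "h \<otimes> k = h' \<otimes> k'"
    have "inv h' \<otimes> h = inv h' \<otimes> (h \<otimes> k) \<otimes> inv k" using m cl by (simp add: m_assoc)
    also have "\<dots> = k' \<otimes> inv k" unfolding eq using m cl by (simp add: mult_inv_cancel)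
    finally have e: "inv h' \<otimes> h = k' \<otimes> inv k" .
    have "inv h' \<otimes> h \<in> H" "k' \<otimes> inv k \<in> K"
      using m subgroup.m_closed[OF H] subgroup.m_inv_closed[OF H]
        subgroup.m_closed[OF K] subgroup.m_inv_closed[OF K] by simp_all
    then have "inv h' \<otimes> h = \<one>" using int e by auto
    then have hh: "h = h'" using m cl inv_solve_left'[of h' h \<one>] by (metis inv_equality inv_inv inv_closed)
    then show "h = h' \<and> k = k'" using eq m cl l_cancel[of h' k k'] by blast
  qed
  moreover have "H <#> K = (\<lambda>(h, k). h \<otimes> k) ` (H \<times> K)" by (auto simp: set_mult_def)
  ultimately show ?thesis by (simp add: card_image card_cartesian_product)
qed

text \<open>With enough products, multiplication is injective on pairs; but
  \<open>(x, inv x)\<close> and the trivial pair have the same product.\<close>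

lemma disjoint_if_card_set_mult:
  assumes H: "subgroup H G" and K: "subgroup K G" and fin: "finite H" "finite K"
    and card: "card H * card K \<le> card (H <#> K)"
  shows "H \<inter> K \<subseteq> {\<one>}"
proof
  fix x assume x: "x \<in> H \<inter> K"
  have img: "H <#> K = (\<lambda>(h, k). h \<otimes> k) ` (H \<times> K)" by (auto simp: set_mult_def)
  then have "card ((\<lambda>(h, k). h \<otimes> k) ` (H \<times> K)) = card (H \<times> K)"
    using card_set_mult_le[OF fin] card by (simp add: card_cartesian_product)
  then have inj: "inj_on (\<lambda>(h, k). h \<otimes> k) (H \<times> K)" using fin by (intro eq_card_imp_inj_on) auto
  have "(x, inv x) = (\<one>, \<one>)"
    using x subgroup.one_closed[OF H] subgroup.one_closed[OF K] subgroup.m_inv_closed[OF K]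
      subgroup.mem_carrier[OF H] by (intro inj_onD[OF inj]) auto
  then show "x \<in> {\<one>}" by simp
qed

lemma generate_UN_generate:
  assumes "\<And>i. i \<in> I \<Longrightarrow> z i \<in> carrier G"
  shows "generate G (\<Union>i\<in>I. generate G {z i}) = generate G (z ` I)"
proof (rule equalityI)
  have g: "subgroup (generate G (z ` I)) G" using assms by (intro generate_is_subgroup) auto
  have "generate G {z i} \<subseteq> generate G (z ` I)" if "i \<in> I" for i
    using that by (intro mono_generate) auto
  then show "generate G (\<Union>i\<in>I. generate G {z i}) \<subseteq> generate G (z ` I)"
    by (intro generate_subgroup_incl[OF _ g]) blast
  have "z ` I \<subseteq> (\<Union>i\<in>I. generate G {z i})" by (auto intro: generate.incl)
  then show "generate G (z ` I) \<subseteq> generate G (\<Union>i\<in>I. generate G {z i})" by (rule mono_generate)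
qed

lemma iso_DirProd_set_mult:
  assumes H: "subgroup H G" and K: "subgroup K G"
    and comm: "\<And>h k. h \<in> H \<Longrightarrow> k \<in> K \<Longrightarrow> h \<otimes> k = k \<otimes> h" and int: "H \<inter> K \<subseteq> {\<one>}"
    and fin: "finite H" "finite K"
  shows "G\<lparr>carrier := H <#> K\<rparr> \<cong> (G\<lparr>carrier := H\<rparr>) \<times>\<times> (G\<lparr>carrier := K\<rparr>)"
proof -
  note cl = subgroup.mem_carrier[OF H] subgroup.mem_carrier[OF K]
  let ?f = "\<lambda>(h, k). h \<otimes> k"
  let ?D = "(G\<lparr>carrier := H\<rparr>) \<times>\<times> (G\<lparr>carrier := K\<rparr>)"
  have D: "group ?D" using H K by (intro DirProd_group subgroup_imp_group)
  have img: "?f ` (H \<times> K) = H <#> K" by (auto simp: set_mult_def)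
  then have "card (?f ` (H \<times> K)) = card (H \<times> K)"
    using card_set_mult_disjoint[OF H K int] by (simp add: card_cartesian_product)
  then have inj: "inj_on ?f (H \<times> K)" using fin by (intro eq_card_imp_inj_on) auto
  have "?f \<in> hom ?D (G\<lparr>carrier := H <#> K\<rparr>)"
  proof (rule homI)
    show "?f x \<in> carrier (G\<lparr>carrier := H <#> K\<rparr>)" if "x \<in> carrier ?D" for x
      using that by (auto simp: set_mult_def)
    fix x y assume "x \<in> carrier ?D" "y \<in> carrier ?D"
    then obtain h k h' k' where m: "h \<in> H" "k \<in> K" "h' \<in> H" "k' \<in> K" "x = (h, k)" "y = (h', k')" by auto
    have "h \<otimes> h' \<otimes> (k \<otimes> k') = h \<otimes> (h' \<otimes> k) \<otimes> k'" using m cl by (simp add: m_assoc)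
    also have "\<dots> = h \<otimes> (k \<otimes> h') \<otimes> k'" by (simp only: comm[OF m(3,2)])
    also have "\<dots> = h \<otimes> k \<otimes> (h' \<otimes> k')" using m cl by (simp add: m_assoc)
    finally show "?f (x \<otimes>\<^bsub>?D\<^esub> y) = ?f x \<otimes>\<^bsub>G\<lparr>carrier := H <#> K\<rparr>\<^esub> ?f y"
      using m(5,6) by simp
  qed
  then have "?f \<in> iso ?D (G\<lparr>carrier := H <#> K\<rparr>)" using inj img by (simp add: iso_def bij_betw_def)
  then show ?thesis using group.iso_sym[OF D] is_isoI by blast
qed

end

context derived_prime_group
begin

lemma finite_Z_sub: "A \<subseteq> Z \<Longrightarrow> finite A"
  using finite_sub[OF subgroup_center] finite_subset by blast

lemma subgroup_Z_mult:
  assumes "subgroup A G" "subgroup B G" "A \<subseteq> Z" "B \<subseteq> Z"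
  shows "subgroup (A <#> B) G" "A <#> B \<subseteq> Z"
proof -
  show "subgroup (A <#> B) G"
    using central_comm[OF assms(4) subgroup.subset[OF assms(1)]]
    by (intro subgroup_commuting_set_mult assms)
  show "A <#> B \<subseteq> Z" using assms subgroup.m_closed[OF subgroup_center]
    by (auto simp: mem_set_mult subset_iff)
qed

lemma generate_single:
  assumes "x \<in> Z"
  shows "subgroup (generate G {x}) G" "generate G {x} \<subseteq> Z" "x \<in> generate G {x}"
    "card (generate G {x}) = ord x"
  using assms Z_closed generate_is_subgroup[of "{x}"] generate_subgroup_incl[OF _ subgroup_center, of "{x}"]
    generate_pow_card[of x] by (auto intro: generate.incl)

text \<open>Bounds the order of whatever the \<open>z j\<close> generate. An enclosing subgroup
  suffices for this and can be enlarged by one cyclic factor at a time.\<close>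

lemma exists_subgroup_prod_ord:
  assumes "finite J" "\<And>j. j \<in> J \<Longrightarrow> z j \<in> Z"
  shows "\<exists>K. subgroup K G \<and> K \<subseteq> Z \<and> z ` J \<subseteq> K \<and> card K \<le> (\<Prod>j\<in>J. ord (z j))"
  using assms
proof (induction J rule: finite_induct)
  case empty
  have "subgroup {\<one>} G" "{\<one>} \<subseteq> Z" using triv_subgroup subgroup.one_closed[OF subgroup_center] by auto
  then show ?case by (intro exI[of _ "{\<one>}"]) simp
next
  case (insert j J)
  then obtain K where K: "subgroup K G" "K \<subseteq> Z" "z ` J \<subseteq> K" "card K \<le> (\<Prod>j\<in>J. ord (z j))" by auto
  have zj: "z j \<in> Z" using insert by simp
  note g = generate_single[OF zj]
  let ?K = "generate G {z j} <#> K"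
  note up = set_mult_upper[OF g(1) K(1)]
  have "card ?K \<le> ord (z j) * (\<Prod>j\<in>J. ord (z j))"
    using order_trans[OF card_set_mult_le[OF finite_Z_sub[OF g(2)] finite_Z_sub[OF K(2)], unfolded g(4)]
      mult_le_mono2[OF K(4)]] .
  then have "card ?K \<le> (\<Prod>j\<in>insert j J. ord (z j))" using insert by simp
  then show ?case using subgroup_Z_mult[OF g(1) K(1) g(2) K(2)] up g(3) K(3)
    by (intro exI[of _ ?K]) auto
qed

text \<open>Directness by counting: each factor times the span of the others is all of
  \<open>Z\<close>, while their orders multiply to at most \<open>card Z\<close>, so they can only
  intersect trivially.\<close>

lemma internal_direct_product_center:
  assumes fin: "finite J" and z: "\<And>j. j \<in> J \<Longrightarrow> z j \<in> Z" and gen: "generate G (z ` J) = Z"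
    and card: "card Z = (\<Prod>j\<in>J. ord (z j))"
  shows "internal_direct_product G Z J (\<lambda>j. generate G {z j})"
proof -
  have zc: "z j \<in> carrier G" if "j \<in> J" for j using z[OF that] Z_closed by blast
  interpret Zg: comm_group "G\<lparr>carrier := Z\<rparr>"
  proof -
    interpret g: group "G\<lparr>carrier := Z\<rparr>" using subgroup_center by (rule subgroup_imp_group)
    show "comm_group (G\<lparr>carrier := Z\<rparr>)"
      using Z_comm Z_closed by (intro g.group_comm_groupI) auto
  qed
  have norm: "generate G {z j} \<lhd> (G\<lparr>carrier := Z\<rparr>)" if "j \<in> J" for j
    using generate_single[OF z[OF that]] subgroup_center
    by (intro Zg.subgroup_imp_normal subgroup_restrict)
  have triv: "generate G {z i} \<inter> generate G (\<Union>j\<in>J - {i}. generate G {z j}) = {\<one>}" if i: "i \<in> J" for i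
  proof -
    let ?H = "generate G {z i}" and ?L = "generate G (z ` (J - {i}))"
    have zi: "z i \<in> Z" by (rule z[OF i])
    note g = generate_single[OF zi]
    obtain K where K: "subgroup K G" "K \<subseteq> Z" "z ` (J - {i}) \<subseteq> K" "card K \<le> (\<Prod>j\<in>J - {i}. ord (z j))"
      using exists_subgroup_prod_ord[of "J - {i}" z] fin z by auto
    have L: "subgroup ?L G" using zc by (intro generate_is_subgroup) auto
    have LK: "?L \<subseteq> K" by (rule generate_subgroup_incl[OF K(3,1)])
    have LZ: "?L \<subseteq> Z" using LK K(2) by blast
    have "z ` J \<subseteq> ?H <#> ?L"
    proof
      fix x assume "x \<in> z ` J"
      then obtain j where j: "j \<in> J" "x = z j" by auto
      show "x \<in> ?H <#> ?L"
      proof (cases "j = i")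
        case True
        then show ?thesis using set_mult_upper(1)[OF g(1) L] g(3) j(2) by auto
      next
        case False
        then have "x \<in> ?L" using j by (auto intro: generate.incl)
        then show ?thesis using set_mult_upper(2)[OF g(1) L] by auto
      qed
    qed
    then have "Z \<subseteq> ?H <#> ?L"
      using generate_subgroup_incl[OF _ subgroup_Z_mult(1)[OF g(1) L g(2) LZ]] gen by blast
    then have "card Z \<le> card (?H <#> ?L)"
      using subgroup_Z_mult(2)[OF g(1) L g(2) LZ] finite_Z_sub by (intro card_mono) auto
    moreover have "card ?L \<le> (\<Prod>j\<in>J - {i}. ord (z j))"
      using card_mono[OF finite_Z_sub[OF K(2)] LK] K(4) by simp
    then have "card ?H * card ?L \<le> ord (z i) * (\<Prod>j\<in>J - {i}. ord (z j))" using g(4) by simp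
    then have "card ?H * card ?L \<le> card Z" using card prod.remove[OF fin i, of "\<lambda>j. ord (z j)"] by simp
    ultimately have "?H \<inter> ?L \<subseteq> {\<one>}"
      by (intro disjoint_if_card_set_mult g(1) L finite_Z_sub g(2) LZ) simp
    then have "?H \<inter> ?L = {\<one>}" using subgroup.one_closed[OF g(1)] subgroup.one_closed[OF L] by blast
    then show ?thesis using generate_UN_generate[of "J - {i}" z] zc by simp
  qed
  show ?thesis unfolding internal_direct_product_def
    using subgroup_center norm triv generate_UN_generate[of J z] zc gen by simp
qed

lemma center_triple_of_internal:
  fixes z :: "nat \<Rightarrow> 'a"
  assumes idp: "internal_direct_product G Z {1..r} (\<lambda>i. generate G {z i})" and r: "2 \<le> r"
    and z: "\<And>i. i \<in> {1..r} \<Longrightarrow> z i \<in> carrier G"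
  shows "\<And>i. i \<in> {1..r} \<Longrightarrow> z i \<in> Z"
    and "center_triple (generate G {z 1}) (generate G {z 2}) (generate G (z ` {3..r}))"
proof -
  have gen: "generate G (z ` {1..r}) = Z"
    using idp generate_UN_generate[of "{1..r}" z] z by (simp add: internal_direct_product_def)
  have triv: "generate G {z i} \<inter> generate G (z ` ({1..r} - {i})) = {\<one>}" if "i \<in> {1..r}" for i
  proof -
    have "generate G {z i} \<inter> generate G (\<Union>j\<in>{1..r} - {i}. generate G {z j}) = {\<one>}"
      using idp that unfolding internal_direct_product_def by blast
    moreover have "generate G (\<Union>j\<in>{1..r} - {i}. generate G {z j}) = generate G (z ` ({1..r} - {i}))"
      by (rule generate_UN_generate) (use z in blast)
    ultimately show ?thesis by (simp only:)
  qed
  show zZ: "z i \<in> Z" if "i \<in> {1..r}" for i using gen that generate.incl[of "z i" "z ` {1..r}" G] by blast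
  have z12: "z 1 \<in> Z" "z 2 \<in> Z" using zZ r by auto
  let ?A = "generate G {z 1}" and ?B = "generate G {z 2}" and ?E = "generate G (z ` {3..r})"
  note a = generate_single[OF z12(1)] and b = generate_single[OF z12(2)]
  have E: "subgroup ?E G" using z by (intro generate_is_subgroup) auto
  have EZ: "?E \<subseteq> Z" using zZ by (intro generate_subgroup_incl[OF _ subgroup_center]) auto
  note AB = subgroup_Z_mult[OF a(1) b(1) a(2) b(2)]
  note ABE = subgroup_Z_mult[OF AB(1) E AB(2) EZ]
  have "z ` {1..r} \<subseteq> ?A <#> ?B <#> ?E"
  proof (rule image_subsetI)
    fix i assume i: "i \<in> {1..r}"
    consider "i = 1" | "i = 2" | "i \<in> {3..r}" using i by force
    then show "z i \<in> ?A <#> ?B <#> ?E"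
    proof cases
      case 1
      then show ?thesis using a(3) set_mult_upper(1)[OF a(1) b(1)] set_mult_upper(1)[OF AB(1) E] by blast
    next
      case 2
      then show ?thesis using b(3) set_mult_upper(2)[OF a(1) b(1)] set_mult_upper(1)[OF AB(1) E] by blast
    next
      case 3
      then have "z i \<in> ?E" by (intro generate.incl) simp
      then show ?thesis using set_mult_upper(2)[OF AB(1) E] by blast
    qed
  qed
  then have "?A <#> ?B <#> ?E = Z"
    using generate_subgroup_incl[OF _ ABE(1)] gen ABE(2) by blast
  moreover have "x = \<one> \<and> y = \<one> \<and> e = \<one>"
    if m: "x \<in> ?A" "y \<in> ?B" "e \<in> ?E" "x \<otimes> y \<otimes> e = \<one>" for x y e
  proof -
    note c = subgroup.mem_carrier[OF a(1) m(1)] subgroup.mem_carrier[OF b(1) m(2)] subgroup.mem_carrier[OF E m(3)]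
    let ?R1 = "generate G (z ` ({1..r} - {1}))" and ?R2 = "generate G (z ` ({1..r} - {2}))"
    have R: "subgroup ?R1 G" "subgroup ?R2 G" using z by (auto intro!: generate_is_subgroup)
    have "?B \<subseteq> ?R1" "?E \<subseteq> ?R1" "?E \<subseteq> ?R2" using r by (auto intro!: mono_generate)
    then have mm: "y \<in> ?R1" "e \<in> ?R1" "e \<in> ?R2" using m by auto
    have "x = inv (y \<otimes> e)" using m(4) c by (intro inv_equality[symmetric]) (simp_all add: m_assoc)
    then have "x \<in> ?R1" using subgroup.m_inv_closed[OF R(1) subgroup.m_closed[OF R(1) mm(1,2)]] by simp
    then have x1: "x = \<one>" using triv[of 1] m(1) r by auto
    then have ye: "y \<otimes> e = \<one>" using m(4) c by simp
    have "y = inv e" using ye c by (intro inv_equality[symmetric]) simp_all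
    then have "y \<in> ?R2" using subgroup.m_inv_closed[OF R(2) mm(3)] by simp
    then have "y = \<one>" using triv[of 2] m(2) r by auto
    then show ?thesis using x1 ye c by simp
  qed
  ultimately show "center_triple ?A ?B ?E"
    unfolding center_triple_def using a(1,2) b(1,2) E EZ by simp
qed

lemma card_center_triple:
  assumes "center_triple A B E"
  shows "card Z = card A * card B * card E"
proof -
  note t = center_tripleD[OF assms]
  note AB = subgroup_Z_mult[OF t(1,2,4,5)]
  show ?thesis
    using card_set_mult_disjoint[OF AB(1) t(3) center_triple_int(2)[OF assms]]
      card_set_mult_disjoint[OF t(1,2) center_triple_int(1)[OF assms]] t(7) by simp
qed

lemma iso_elem_abelian_generate:
  assumes z: "\<And>i. i \<in> {3..r} \<Longrightarrow> z i \<in> Z" "\<And>i. i \<in> {3..r} \<Longrightarrow> z i [^] p = \<one>"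
    and card: "card (generate G (z ` {3..r})) = p ^ (r - 2)"
  shows "G\<lparr>carrier := generate G (z ` {3..r})\<rparr> \<cong> elem_abelian p (r - 2)"
    and "\<And>a. a \<in> generate G (z ` {3..r}) \<Longrightarrow> a [^] p = \<one>"
proof -
  let ?E = "generate G (z ` {3..r})"
  have E: "subgroup ?E G" using z Z_closed by (intro generate_is_subgroup) auto
  have EZ: "?E \<subseteq> Z" using z by (intro generate_subgroup_incl[OF _ subgroup_center]) auto
  interpret g: group "G\<lparr>carrier := ?E\<rparr>" using E by (rule subgroup_imp_group)
  interpret e: comm_group "G\<lparr>carrier := ?E\<rparr>"
    using Z_comm EZ Z_closed by (intro g.group_comm_groupI) (auto simp: subset_iff)
  \<comment> \<open>Shift by three between the indices of the factors of order \<open>p\<close> and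
    the coordinates of \<open>elem_abelian\<close>.\<close>
  have im: "(\<lambda>i. z (i + 3)) ` {..<r - 2} = z ` {3..r}"
  proof -
    have "{3..r} = (\<lambda>i. i + 3) ` {..<r - 2}"
    proof (rule equalityI; rule subsetI)
      fix j assume j: "j \<in> {3..r}"
      then show "j \<in> (\<lambda>i. i + 3) ` {..<r - 2}" by (intro image_eqI[of _ _ "j - 3"]) auto
    qed auto
    then show ?thesis by (simp add: image_image)
  qed
  have zE: "z ` {3..r} \<subseteq> ?E" by (auto intro: generate.incl)
  show "G\<lparr>carrier := ?E\<rparr> \<cong> elem_abelian p (r - 2)"
  proof (rule e.iso_elem_abelian[of p "r - 2" "\<lambda>i. z (i + 3)"])
    show "carrier (G\<lparr>carrier := ?E\<rparr>) = generate (G\<lparr>carrier := ?E\<rparr>) ((\<lambda>i. z (i + 3)) ` {..<r - 2})"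
      unfolding im generate_consistent[OF zE E] by simp
    fix i assume i: "i < r - 2"
    then have "i + 3 \<in> {3..r}" by auto
    then show "z (i + 3) \<in> carrier (G\<lparr>carrier := ?E\<rparr>)" using zE by auto
    show "z (i + 3) [^]\<^bsub>G\<lparr>carrier := ?E\<rparr>\<^esub> p = \<one>\<^bsub>G\<lparr>carrier := ?E\<rparr>\<^esub>"
      using z(2)[OF \<open>i + 3 \<in> {3..r}\<close>] by (simp add: nat_pow_consistent[symmetric])
  qed (use p_pos card in auto)
  define P where "P = {a \<in> Z. a [^] p = \<one>}"
  have "subgroup P G"
  proof (rule subgroup_finiteI)
    show "\<one> \<in> P" using subgroup.one_closed[OF subgroup_center] by (simp add: P_def)
    show "x \<otimes> y \<in> P" if "x \<in> P" "y \<in> P" for x y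
      using that subgroup.m_closed[OF subgroup_center] Z_pow_distrib[of y x p] Z_closed
      by (simp add: P_def)
  qed (auto simp: P_def Z_closed)
  moreover have "z ` {3..r} \<subseteq> P" using z by (auto simp: P_def)
  ultimately have "?E \<subseteq> P" using generate_subgroup_incl by blast
  then show "a [^] p = \<one>" if "a \<in> ?E" for a using that by (auto simp: P_def)
qed

section \<open>Decompositions of the center as triples of subgroups\<close>

lemma ord_of_iso_integer_mod_group:
  assumes "x \<in> carrier G" "(G\<lparr>carrier := generate G {x}\<rparr>) \<cong> integer_mod_group q" "q > 0"
  shows "ord x = q"
proof -
  have "card (generate G {x}) = card (carrier (integer_mod_group q))"
    using iso_same_card[OF assms(2)] by simp
  then show ?thesis using generate_pow_card[OF assms(1)] assms(3) by (simp add: carrier_integer_mod_group)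
qed

text \<open>\<open>E\<close> collects the factors of order \<open>p\<close>. Its order is read off
  from the isomorphism type of the whole center by cancelling the two cyclic factors, and it matches
  the number \<open>r - 2\<close> of generators.\<close>

lemma center_decomp_triple:
  assumes "center_decomp G p r e f z"
  defines "E \<equiv> generate G (z ` {3..r})"
  shows "z 1 \<in> Z" "z 2 \<in> Z" "center_triple (generate G {z 1}) (generate G {z 2}) E"
    "ord (z 1) = p ^ e" "ord (z 2) = p ^ f" "\<And>a. a \<in> E \<Longrightarrow> a [^] p = \<one>"
    "Elem p (r - 2) (G\<lparr>carrier := E\<rparr>)"
proof -
  note d = assms(1)[unfolded center_decomp_def]
  have r: "2 \<le> r" and zc: "\<And>i. i \<in> {1..r} \<Longrightarrow> z i \<in> carrier G"
    and idp: "internal_direct_product G Z {1..r} (\<lambda>i. generate G {z i})" using d by auto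
  note t = center_triple_of_internal[OF idp r zc]
  show z12: "z 1 \<in> Z" "z 2 \<in> Z" using t(1) r by auto
  show tr: "center_triple (generate G {z 1}) (generate G {z 2}) E" unfolding E_def by (rule t(2))
  show o1: "ord (z 1) = p ^ e" and o2: "ord (z 2) = p ^ f"
    using d z12 Z_closed p_pos by (auto intro!: ord_of_iso_integer_mod_group)
  have o3: "ord (z i) = p" if "i \<in> {3..r}" for i
    using d that zc[of i] p_pos by (auto intro!: ord_of_iso_integer_mod_group)
  have iso: "G\<lparr>carrier := Z\<rparr> \<cong> integer_mod_group (p ^ e) \<times>\<times> integer_mod_group (p ^ f) \<times>\<times> elem_abelian p (r - 2)"
    using d by blast
  have "p ^ e * p ^ f * card E = card Z"
    using card_center_triple[OF tr] generate_single(4)[OF z12(1)] generate_single(4)[OF z12(2)] o1 o2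
    by simp
  also have "\<dots> = card (carrier (integer_mod_group (p ^ e) \<times>\<times> integer_mod_group (p ^ f) \<times>\<times> elem_abelian p (r - 2)))"
    using iso_same_card[OF iso] by simp
  also have "\<dots> = p ^ e * (p ^ f * p ^ (r - 2))"
    using p_pos by (simp add: card_cartesian_product carrier_integer_mod_group elem_abelian_def card_PiE
        nat_power_eq)
  finally have "p ^ e * p ^ f * card E = p ^ e * p ^ f * p ^ (r - 2)" by (simp only: mult.assoc)
  then have cE: "card E = p ^ (r - 2)" using p_pos by simp
  have z3: "z i \<in> Z" "z i [^] p = \<one>" if "i \<in> {3..r}" for i
    using t(1)[of i] pow_ord_eq_1[of "z i"] o3[OF that] zc[of i] that by auto
  note isoE = iso_elem_abelian_generate[of r z, OF z3 cE[unfolded E_def]]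
  show "Elem p (r - 2) (G\<lparr>carrier := E\<rparr>)" unfolding E_def Elem_def iso_to_def by (rule isoE(1))
  show "a [^] p = \<one>" if "a \<in> E" for a using isoE(2) that by (simp add: E_def)
qed

text \<open>Apart from generation only orders have to be known; directness comes from
  counting.\<close>

lemma center_decompI:
  assumes r: "2 \<le> r" and z: "\<And>i. i \<in> {1..r} \<Longrightarrow> z i \<in> Z"
    and ords: "ord (z 1) = p ^ e" "ord (z 2) = p ^ f" "\<And>i. i \<in> {3..r} \<Longrightarrow> ord (z i) = p"
    and gen: "generate G (z ` {1..r}) = Z" and card: "card Z = p ^ e * p ^ f * p ^ (r - 2)"
  shows "center_decomp G p r e f z"
proof -
  have zc: "z i \<in> carrier G" if "i \<in> {1..r}" for i using z[OF that] Z_closed by blast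
  have split: "{1..r} = insert 1 (insert 2 {3..r})" using r by auto
  have "(\<Prod>j\<in>{1..r}. ord (z j)) = ord (z 1) * (ord (z 2) * (\<Prod>j\<in>{3..r}. ord (z j)))"
    unfolding split by simp
  also have "(\<Prod>j\<in>{3..r}. ord (z j)) = (\<Prod>j\<in>{3..r}. p)" using ords(3) by (intro prod.cong) auto
  also have "\<dots> = p ^ (r - 2)" by simp
  finally have prod: "card Z = (\<Prod>j\<in>{1..r}. ord (z j))" using card ords by simp
  have idp: "internal_direct_product G Z {1..r} (\<lambda>j. generate G {z j})"
    by (rule internal_direct_product_center[OF _ z gen prod]) simp
  have z12: "z 1 \<in> Z" "z 2 \<in> Z" using z r by auto
  have "ord (z i) \<noteq> 0" if "i \<in> {1..r}" for i using ord_ge_1[OF fin zc[OF that]] by simp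
  then have cyc: "G\<lparr>carrier := generate G {z i}\<rparr> \<cong> integer_mod_group (ord (z i))" if "i \<in> {1..r}" for i
    using cyclic_subgroup_iso[OF zc[OF that]] that by blast
  let ?A = "generate G {z 1}" and ?B = "generate G {z 2}" and ?E = "generate G (z ` {3..r})"
  have tr: "center_triple ?A ?B ?E" by (rule center_triple_of_internal(2)[OF idp r zc])
  note t = center_tripleD[OF tr]
  have "p ^ e * p ^ f * card ?E = card Z"
    using card_center_triple[OF tr] generate_single(4)[OF z12(1)] generate_single(4)[OF z12(2)] ords(1,2)
    by simp
  then have "p ^ e * p ^ f * card ?E = p ^ e * p ^ f * p ^ (r - 2)" unfolding card .
  then have cE: "card ?E = p ^ (r - 2)" using p_pos by simp
  have z3: "z i \<in> Z" "z i [^] p = \<one>" if "i \<in> {3..r}" for i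
    using z[of i] pow_ord_eq_1[of "z i"] ords(3)[OF that] zc[of i] that by auto
  have isoE: "G\<lparr>carrier := ?E\<rparr> \<cong> elem_abelian p (r - 2)"
    by (rule iso_elem_abelian_generate(1)[of r z, OF z3 cE])
  note AB = subgroup_Z_mult[OF t(1,2,4,5)]
  have A: "G\<lparr>carrier := ?A\<rparr> \<cong> integer_mod_group (p ^ e)" using cyc[of 1] ords r by simp
  have B: "G\<lparr>carrier := ?B\<rparr> \<cong> integer_mod_group (p ^ f)" using cyc[of 2] ords r by simp
  note BE = subgroup_Z_mult[OF t(2,3,5,6)]
  have "?A \<inter> (?B <#> ?E) \<subseteq> {\<one>}"
  proof
    fix x assume x: "x \<in> ?A \<inter> (?B <#> ?E)"
    then obtain b d where bd: "b \<in> ?B" "d \<in> ?E" "x = b \<otimes> d" by (auto simp: mem_set_mult)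
    have c: "b \<in> carrier G" "d \<in> carrier G" "x \<in> carrier G"
      using subgroup.mem_carrier[OF t(2)] subgroup.mem_carrier[OF t(3)] subgroup.mem_carrier[OF t(1)] bd x by auto
    have "inv x \<otimes> x = \<one>" using c(3) by simp
    then have "inv x \<otimes> b \<otimes> d = \<one>" unfolding bd(3) using c by (simp add: m_assoc)
    then have "b = \<one> \<and> d = \<one>"
      using t(8)[of "inv x" b d] bd x subgroup.m_inv_closed[OF t(1)] by blast
    then show "x \<in> {\<one>}" using bd(3) by simp
  qed
  moreover have "?A <#> (?B <#> ?E) = Z"
    using set_mult_assoc[OF subgroup.subset[OF t(1)] subgroup.subset[OF t(2)] subgroup.subset[OF t(3)]] t(7) by simp
  ultimately have i1: "G\<lparr>carrier := Z\<rparr> \<cong> (G\<lparr>carrier := ?A\<rparr>) \<times>\<times> (G\<lparr>carrier := ?B <#> ?E\<rparr>)"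
    using iso_DirProd_set_mult[OF t(1) BE(1) central_comm[OF BE(2) subgroup.subset[OF t(1)]] _
        finite_Z_sub[OF t(4)] finite_Z_sub[OF BE(2)]] by simp
  have "?B \<inter> ?E \<subseteq> {\<one>}"
    using center_triple_int(2)[OF tr] set_mult_upper(2)[OF t(1,2)] by blast
  then have i2: "G\<lparr>carrier := ?B <#> ?E\<rparr> \<cong> (G\<lparr>carrier := ?B\<rparr>) \<times>\<times> (G\<lparr>carrier := ?E\<rparr>)"
    using iso_DirProd_set_mult[OF t(2,3) central_comm[OF t(6) subgroup.subset[OF t(2)]] _
        finite_Z_sub[OF t(5)] finite_Z_sub[OF t(6)]] by simp
  have gB: "group (G\<lparr>carrier := ?B\<rparr>)" and gA: "group (G\<lparr>carrier := ?A\<rparr>)"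
    by (rule subgroup_imp_group[OF t(2)], rule subgroup_imp_group[OF t(1)])
  have "G\<lparr>carrier := ?B <#> ?E\<rparr> \<cong> integer_mod_group (p ^ f) \<times>\<times> elem_abelian p (r - 2)"
    using iso_trans[OF i2 group.DirProd_iso_trans[OF gB B isoE]] .
  then have "G\<lparr>carrier := Z\<rparr> \<cong> integer_mod_group (p ^ e) \<times>\<times> integer_mod_group (p ^ f) \<times>\<times> elem_abelian p (r - 2)"
    using iso_trans[OF i1 group.DirProd_iso_trans[OF gA A]] by blast
  moreover have "G\<lparr>carrier := generate G {z i}\<rparr> \<cong> integer_mod_group p" if "i \<in> {3..r}" for i
    using cyc[of i] ords(3)[OF that] that by auto
  ultimately show ?thesis
    unfolding center_decomp_def using r zc idp A B by blast
qed

text \<open>Provides the noncyclic abelian factor that is joined in type \<open>A_4\<close>.\<close>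

lemma center_pair_iso:
  assumes "center_decomp G p r e f z"
  shows "iso_to (integer_mod_group (p ^ e) \<times>\<times> integer_mod_group (p ^ f))
    (G\<lparr>carrier := generate G {z 1} <#> generate G {z 2}\<rparr>)"
proof -
  note d = center_decomp_triple[OF assms]
  note t = center_tripleD[OF d(3)]
  let ?A = "generate G {z 1}" and ?B = "generate G {z 2}"
  have i: "G\<lparr>carrier := ?A <#> ?B\<rparr> \<cong> (G\<lparr>carrier := ?A\<rparr>) \<times>\<times> (G\<lparr>carrier := ?B\<rparr>)"
    using iso_DirProd_set_mult[OF t(1,2) central_comm[OF t(5) subgroup.subset[OF t(1)]] center_triple_int(1)[OF d(3)]
        finite_Z_sub[OF t(4)] finite_Z_sub[OF t(5)]] .
  have "G\<lparr>carrier := ?A\<rparr> \<cong> integer_mod_group (p ^ e)" "G\<lparr>carrier := ?B\<rparr> \<cong> integer_mod_group (p ^ f)"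
    using assms by (auto simp: center_decomp_def)
  then show ?thesis unfolding iso_to_def
    using iso_trans[OF i group.DirProd_iso_trans[OF subgroup_imp_group[OF t(1)]]] by blast
qed

section \<open>Constructing a decomposition of the center and counting its generators\<close>

lemma generate_nat_powE':
  assumes "a \<in> generate G {x}" "x \<in> Z"
  obtains n :: nat where "a = x [^] n"
  using generate_nat_powE[OF assms(1) Z_closed[OF assms(2)]] .

lemma generate_order_p_disjoint:
  assumes B: "subgroup B G" and g: "g \<in> Z" "g [^] p = \<one>" "g \<notin> B"
  shows "ord g = p" "B \<inter> generate G {g} \<subseteq> {\<one>}"
proof -
  have gc: "g \<in> carrier G" using g(1) Z_closed by blast
  have "g \<noteq> \<one>" using g(3) subgroup.one_closed[OF B] by blast
  moreover have "ord g dvd p" using g(2) gc by (simp add: pow_eq_id)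
  ultimately show o: "ord g = p" using prime ord_eq_1[OF gc] by (auto simp: prime_nat_iff)
  note gs = generate_single[OF g(1)]
  have I: "subgroup (B \<inter> generate G {g}) G" by (rule subgroups_Inter_pair[OF B gs(1)])
  have "card (B \<inter> generate G {g}) dvd p"
    using subgroup_card_dvd[OF I gs(1)] gs(4) o by simp
  then consider "card (B \<inter> generate G {g}) = 1" | "card (B \<inter> generate G {g}) = card (generate G {g})"
    using prime gs(4) o by (auto simp: prime_nat_iff)
  then show "B \<inter> generate G {g} \<subseteq> {\<one>}"
  proof cases
    case 1
    then obtain a where "B \<inter> generate G {g} = {a}" by (auto simp: card_1_singleton_iff)
    then show ?thesis using subgroup.one_closed[OF I] by auto
  next
    case 2
    then have "B \<inter> generate G {g} = generate G {g}"
      using card_subset_eq[OF finite_Z_sub[OF gs(2)], of "B \<inter> generate G {g}"] by blast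
    then show ?thesis using gs(3) g(3) by blast
  qed
qed

text \<open>An element outside \<open>B\<close> can be divided by an element of \<open>B\<close>
  with the same \<open>p\<close>-th power; the quotient has order \<open>p\<close> and generates a
  subgroup meeting \<open>B\<close> trivially. Repeating this exhausts \<open>Z\<close>. Generation
  is phrased through enclosing subgroups \<open>K\<close>, which suits the induction.\<close>

lemma complement_basis:
  assumes "subgroup B G" "B \<subseteq> Z" "\<And>z. z \<in> Z \<Longrightarrow> \<exists>b\<in>B. z [^] p = b [^] p"
  shows "\<exists>s w. (\<forall>i<s. w i \<in> Z \<and> ord (w i) = p) \<and> card Z = card B * p ^ s \<and>
    (\<forall>K. subgroup K G \<longrightarrow> B \<subseteq> K \<longrightarrow> (\<forall>i<s. w i \<in> K) \<longrightarrow> Z \<subseteq> K)"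
  using assms
proof (induction "card Z - card B" arbitrary: B rule: less_induct)
  case less
  show ?case
  proof (cases "B = Z")
    case True
    then show ?thesis by (intro exI[of _ 0]) simp
  next
    case False
    then obtain z where z: "z \<in> Z" "z \<notin> B" using less.prems(2) by blast
    obtain b where b: "b \<in> B" "z [^] p = b [^] p" using less.prems(3)[OF z(1)] by blast
    have bZ: "b \<in> Z" using b less.prems(2) by blast
    have ib: "inv b \<in> Z" by (rule subgroup.m_inv_closed[OF subgroup_center bZ])
    define g where "g = z \<otimes> inv b"
    have gZ: "g \<in> Z" unfolding g_def by (rule subgroup.m_closed[OF subgroup_center z(1) ib])
    have "g [^] p = z [^] p \<otimes> inv (b [^] p)"
      unfolding g_def using Z_pow_distrib[OF ib Z_closed[OF z(1)]] Z_closed[OF bZ] by (simp add: nat_pow_inv)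
    then have gp: "g [^] p = \<one>" using b Z_closed[OF bZ] by simp
    have gB: "g \<notin> B"
    proof
      assume "g \<in> B"
      then have "g \<otimes> b \<in> B" by (rule subgroup.m_closed[OF less.prems(1) _ b(1)])
      moreover have "g \<otimes> b = z" using Z_closed[OF z(1)] Z_closed[OF bZ] by (simp add: g_def m_assoc)
      ultimately show False using z by simp
    qed
    note go = generate_order_p_disjoint[OF less.prems(1) gZ gp gB]
    note gs = generate_single[OF gZ]
    let ?B = "B <#> generate G {g}"
    note B' = subgroup_Z_mult[OF less.prems(1) gs(1) less.prems(2) gs(2)]
    note up = set_mult_upper[OF less.prems(1) gs(1)]
    have cB: "card ?B = card B * p"
      using card_set_mult_disjoint[OF less.prems(1) gs(1) go(2)] gs(4) go(1) by simp
    have "card B < card ?B" using cB card_subgroup_pos[OF less.prems(1)] p_gt by simp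
    moreover have "card ?B \<le> card Z" by (rule card_mono[OF finite_Z_sub B'(2)]) simp
    ultimately have lt: "card Z - card ?B < card Z - card B" by simp
    have "\<exists>b\<in>?B. z [^] p = b [^] p" if "z \<in> Z" for z using less.prems(3)[OF that] up by blast
    from less.hyps[OF lt B' this] obtain s w where sw: "\<forall>i<s. w i \<in> Z \<and> ord (w i) = p"
      "card Z = card ?B * p ^ s"
      "\<And>K. subgroup K G \<Longrightarrow> ?B \<subseteq> K \<Longrightarrow> (\<forall>i<s. w i \<in> K) \<Longrightarrow> Z \<subseteq> K" by blast
    let ?w = "w(s := g)"
    have "Z \<subseteq> K" if K: "subgroup K G" "B \<subseteq> K" "\<forall>i<Suc s. ?w i \<in> K" for K
    proof (rule sw(3)[OF K(1)])
      have "g \<in> K" using K(3) by auto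
      then have "generate G {g} \<subseteq> K" using generate_subgroup_incl[OF _ K(1)] by simp
      then show "?B \<subseteq> K" using K(2) subgroup.m_closed[OF K(1)] by (auto simp: mem_set_mult subset_iff)
      show "\<forall>i<s. w i \<in> K"
      proof (intro allI impI)
        fix i assume "i < s"
        then show "w i \<in> K" using K(3)[rule_format, of i] by simp
      qed
    qed
    moreover have "\<forall>i<Suc s. ?w i \<in> Z \<and> ord (?w i) = p" using sw(1) gZ go(1) by (simp add: less_Suc_eq)
    moreover have "card Z = card B * p ^ Suc s" using sw(2) cB by simp
    ultimately show ?thesis by (intro exI[of _ "Suc s"] exI[of _ ?w]) blast
  qed
qed

text \<open>Since \<open>H\<close> contains all \<open>p\<close>-th powers, each new generator
  multiplies the order by at most \<open>p\<close>. This yields the lower bound for the number of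
  generators.\<close>

lemma adjoin_bound:
  assumes "finite S" "S \<subseteq> Z" "subgroup H G" "H \<subseteq> Z" "\<And>z. z \<in> Z \<Longrightarrow> z [^] p \<in> H"
  shows "\<exists>K. subgroup K G \<and> K \<subseteq> Z \<and> H \<subseteq> K \<and> S \<subseteq> K \<and> card K \<le> card H * p ^ card S"
  using assms
proof (induction S rule: finite_induct)
  case empty
  then show ?case by (intro exI[of _ H]) simp
next
  case (insert g S)
  then obtain K where K: "subgroup K G" "K \<subseteq> Z" "H \<subseteq> K" "S \<subseteq> K" "card K \<le> card H * p ^ card S" by auto
  have gZ: "g \<in> Z" using insert.prems by simp
  note gs = generate_single[OF gZ] and gc = Z_closed[OF gZ]
  let ?K = "K <#> generate G {g}" and ?P = "(\<lambda>i. g [^] i) ` {..<p}"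
  note up = set_mult_upper[OF K(1) gs(1)]
  have gpK: "g [^] p \<in> K" using insert.prems(4)[OF gZ] K(3) by blast
  have "?K \<subseteq> K <#> ?P"
  proof
    fix x assume "x \<in> ?K"
    then obtain k h where kh: "k \<in> K" "h \<in> generate G {g}" "x = k \<otimes> h" by (auto simp: mem_set_mult)
    obtain n :: nat where n: "h = g [^] n" using generate_nat_powE[OF kh(2) gc] .
    have kc: "k \<in> carrier G" using subgroup.mem_carrier[OF K(1) kh(1)] .
    have "h = g [^] (p * (n div p) + n mod p)" unfolding n by simp
    also have "\<dots> = (g [^] p) [^] (n div p) \<otimes> g [^] (n mod p)"
      using gc by (simp only: nat_pow_pow nat_pow_mult)
    finally have "x = (k \<otimes> (g [^] p) [^] (n div p)) \<otimes> g [^] (n mod p)"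
      using kh(3) kc gc by (simp add: m_assoc)
    moreover have "k \<otimes> (g [^] p) [^] (n div p) \<in> K"
      by (intro subgroup.m_closed[OF K(1)] subgroup_pow_closed[OF K(1)] kh(1) gpK)
    moreover have "g [^] (n mod p) \<in> ?P" using p_pos by simp
    ultimately show "x \<in> K <#> ?P" unfolding mem_set_mult by blast
  qed
  then have "card ?K \<le> card (K <#> ?P)"
    using finite_Z_sub[OF K(2)] by (intro card_mono) (auto simp: set_mult_def)
  also have "\<dots> \<le> card K * card ?P" using card_set_mult_le[OF finite_Z_sub[OF K(2)], of ?P] by simp
  also have "\<dots> \<le> card K * p" using card_image_le[of "{..<p}" "\<lambda>i. g [^] i"] by simp
  also have "\<dots> \<le> card H * p ^ card S * p" using K(5) by simp
  also have "\<dots> = card H * p ^ card (insert g S)" using insert.hyps by simp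
  finally have "card ?K \<le> card H * p ^ card (insert g S)" .
  moreover have "insert g S \<subseteq> ?K" using up gs(3) K(4) by blast
  ultimately show ?case using subgroup_Z_mult[OF K(1) gs(1) K(2) gs(2)] up K(3)
    by (intro exI[of _ ?K]) blast
qed

text \<open>The \<open>p\<close>-th powers lie in a subgroup of order at most
  \<open>p^(e-1) p^(f-1)\<close>, so of index at least \<open>p^(s+2)\<close>; fewer than
  \<open>s + 2\<close> generators cannot reach all of \<open>Z\<close>, and \<open>T\<close> shows
  that \<open>s + 2\<close> are enough.\<close>

lemma min_gens_center:
  assumes xy: "x \<in> Z" "y \<in> Z" and ords: "ord x = p ^ e" "ord y = p ^ f" "e \<ge> 1" "f \<ge> 1"
    and pows: "\<And>z. z \<in> Z \<Longrightarrow> \<exists>(i::nat) j::nat. z [^] p = x [^] (p * i) \<otimes> y [^] (p * j)"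
    and card: "card Z = p ^ e * p ^ f * p ^ s"
    and T: "finite T" "T \<subseteq> Z" "card T \<le> s + 2" "generate G T = Z"
  shows "min_gens (G\<lparr>carrier := Z\<rparr>) = s + 2"
proof -
  define P where "P d \<longleftrightarrow> (\<exists>S. S \<subseteq> carrier (G\<lparr>carrier := Z\<rparr>) \<and> finite S \<and> card S = d \<and>
    generate (G\<lparr>carrier := Z\<rparr>) S = carrier (G\<lparr>carrier := Z\<rparr>))" for d
  have gc: "generate (G\<lparr>carrier := Z\<rparr>) S = generate G S" if "S \<subseteq> Z" for S
    by (rule generate_consistent[OF that subgroup_center])
  have low: "s + 2 \<le> d" if Pd: "P d" for d
  proof -
    obtain S where S: "S \<subseteq> Z" "finite S" "card S = d" "generate G S = Z"
      using Pd gc unfolding P_def by auto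
    have c: "x \<in> carrier G" "y \<in> carrier G" using xy Z_closed by auto
    have pZ: "x [^] p \<in> Z" "y [^] p \<in> Z" using xy Z_pow_closed by auto
    note gx = generate_single[OF pZ(1)] and gy = generate_single[OF pZ(2)]
    let ?H = "generate G {x [^] p} <#> generate G {y [^] p}"
    note H = subgroup_Z_mult[OF gx(1) gy(1) gx(2) gy(2)]
    have zH: "z [^] p \<in> ?H" if z: "z \<in> Z" for z
    proof -
      obtain i j :: nat where ij: "z [^] p = x [^] (p * i) \<otimes> y [^] (p * j)" using pows[OF z] by blast
      have "x [^] (p * i) \<in> generate G {x [^] p}" "y [^] (p * j) \<in> generate G {y [^] p}"
        using generate_pow_mem[of "x [^] p" i] generate_pow_mem[of "y [^] p" j] c by (simp_all add: nat_pow_pow)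
      then show ?thesis unfolding ij mem_set_mult by blast
    qed
    have op: "ord (x [^] p) = p ^ (e - 1)" "ord (y [^] p) = p ^ (f - 1)"
      using ord_pow[OF c(1), of p] ord_pow[OF c(2), of p] ords p_pos
      by (cases e; cases f; simp)+
    have "card ?H \<le> p ^ (e - 1) * p ^ (f - 1)"
      using card_set_mult_le[OF finite_Z_sub[OF gx(2)] finite_Z_sub[OF gy(2)]] gx(4) gy(4) op by simp
    obtain K where K: "subgroup K G" "K \<subseteq> Z" "S \<subseteq> K" "card K \<le> card ?H * p ^ d"
      using adjoin_bound[OF S(2,1) H zH] S(3) by auto
    have "Z \<subseteq> K" using generate_subgroup_incl[OF K(3,1)] S(4) by simp
    then have "card Z \<le> card K" by (rule card_mono[OF finite_Z_sub[OF K(2)]])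
    also have "\<dots> \<le> p ^ (e - 1) * p ^ (f - 1) * p ^ d"
      using K(4) mult_le_mono1[OF \<open>card ?H \<le> p ^ (e - 1) * p ^ (f - 1)\<close>, of "p ^ d"] by linarith
    finally have le: "p ^ (e + f + s) \<le> p ^ (e - 1 + (f - 1) + d)" unfolding card by (simp only: power_add)
    have "1 < p" using p_gt by simp
    from power_le_imp_le_exp[OF this le] show ?thesis using ords by linarith
  qed
  have PT: "P (card T)" unfolding P_def using T gc[OF T(2)] by auto
  then have "card T = s + 2" using low T(3) by fastforce
  then have "P (s + 2)" using PT by simp
  then have "(LEAST d. P d) = s + 2" using low by (rule Least_equality)
  then show ?thesis by (simp add: min_gens_def P_def)
qed

lemma indep_generate_int:
  assumes "x \<in> Z" "y \<in> Z" "indep x y"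
  shows "generate G {x} \<inter> generate G {y} \<subseteq> {\<one>}"
proof
  fix a assume a: "a \<in> generate G {x} \<inter> generate G {y}"
  note gx = generate_single[OF assms(1)] and gy = generate_single[OF assms(2)]
  have "inv a \<in> generate G {y}" using a subgroup.m_inv_closed[OF gy(1)] by blast
  then obtain n :: nat where n: "inv a = y [^] n" using generate_nat_powE'[OF _ assms(2)] by blast
  obtain m :: nat where m: "a = x [^] m" using a generate_nat_powE'[OF _ assms(1)] by blast
  have "a \<otimes> inv a = \<one>" using a subgroup.mem_carrier[OF gx(1)] by simp
  then have "x [^] m \<otimes> y [^] n = \<one>" using m n by simp
  then show "a \<in> {\<one>}" using indepD[OF assms(3)] m by simp
qed

text \<open>Every \<open>p\<close>-th power of a central element has a root in
  \<open><x> <y>\<close>, which therefore has an elementary abelian complement, spanned by the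
  \<open>w i\<close>. The generator count identifies \<open>r\<close> as
  \<open>s + 2\<close>.\<close>

lemma center_decomp_exists:
  assumes xy: "x \<in> Z" "y \<in> Z" and ords: "ord x = p ^ e" "ord y = p ^ f" "e \<ge> 1" "f \<ge> 1"
    and ind: "indep x y"
    and pows: "\<And>z. z \<in> Z \<Longrightarrow> \<exists>(i::nat) j::nat. z [^] p = x [^] (p * i) \<otimes> y [^] (p * j)"
  shows "\<exists>z. center_decomp G p (min_gens (G\<lparr>carrier := Z\<rparr>)) e f z \<and> z 1 = x \<and> z 2 = y"
proof -
  note gx = generate_single[OF xy(1)] and gy = generate_single[OF xy(2)]
  let ?B = "generate G {x} <#> generate G {y}"
  note B = subgroup_Z_mult[OF gx(1) gy(1) gx(2) gy(2)]
  note int = indep_generate_int[OF xy ind]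
  have cB: "card ?B = p ^ e * p ^ f"
    using card_set_mult_disjoint[OF gx(1) gy(1) int] gx(4) gy(4) ords by simp
  have "\<exists>b\<in>?B. z [^] p = b [^] p" if z: "z \<in> Z" for z
  proof -
    obtain i j :: nat where ij: "z [^] p = x [^] (p * i) \<otimes> y [^] (p * j)" using pows[OF z] by blast
    have "x [^] i \<otimes> y [^] j \<in> ?B"
      unfolding mem_set_mult using generate_pow_mem Z_closed[OF xy(1)] Z_closed[OF xy(2)] by blast
    moreover have "(x [^] i \<otimes> y [^] j) [^] p = z [^] p"
      unfolding ij Z_pair_pow[OF xy] by (simp only: mult.commute)
    ultimately show ?thesis by metis
  qed
  from complement_basis[OF B this] obtain s w where sw: "\<forall>i<s. w i \<in> Z \<and> ord (w i) = p"
    "card Z = card ?B * p ^ s"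
    "\<And>K. subgroup K G \<Longrightarrow> ?B \<subseteq> K \<Longrightarrow> (\<forall>i<s. w i \<in> K) \<Longrightarrow> Z \<subseteq> K" by blast
  \<comment> \<open>The \<open>w i\<close> are numbered from 0, the factors of order
    \<open>p\<close> from 3.\<close>
  define z where "z i = (if i = 1 then x else if i = 2 then y else w (i - 3))" for i :: nat
  have z12: "z 1 = x" "z 2 = y" by (simp_all add: z_def)
  have z3: "z i \<in> Z \<and> ord (z i) = p" if "i \<in> {3..s + 2}" for i
    using that sw(1)[rule_format, of "i - 3"] by (auto simp: z_def)
  have zZ: "z i \<in> Z" if i: "i \<in> {1..s + 2}" for i
  proof -
    consider "i = 1" | "i = 2" | "i \<in> {3..s + 2}" using i by force
    then show ?thesis using z12 xy z3 by cases auto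
  qed
  have gz: "subgroup (generate G (z ` {1..s + 2})) G"
    using zZ Z_closed by (intro generate_is_subgroup) auto
  have gen: "generate G (z ` {1..s + 2}) = Z"
  proof (rule equalityI)
    show "generate G (z ` {1..s + 2}) \<subseteq> Z"
      using zZ by (intro generate_subgroup_incl[OF _ subgroup_center]) auto
    have mem: "z i \<in> generate G (z ` {1..s + 2})" if "i \<in> {1..s + 2}" for i
      using that by (intro generate.incl) simp
    have "x \<in> generate G (z ` {1..s + 2})" "y \<in> generate G (z ` {1..s + 2})"
      using mem[of 1] mem[of 2] z12 by simp_all
    then have "generate G {x} \<subseteq> generate G (z ` {1..s + 2})" "generate G {y} \<subseteq> generate G (z ` {1..s + 2})"
      using generate_subgroup_incl[OF _ gz] by simp_all
    then have "?B \<subseteq> generate G (z ` {1..s + 2})"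
      using subgroup.m_closed[OF gz] by (auto simp: mem_set_mult subset_iff)
    moreover have "w i \<in> generate G (z ` {1..s + 2})" if "i < s" for i
      using mem[of "i + 3"] that by (simp add: z_def)
    ultimately show "Z \<subseteq> generate G (z ` {1..s + 2})" by (intro sw(3)[OF gz]) auto
  qed
  have card: "card Z = p ^ e * p ^ f * p ^ s" using sw(2) cB by simp
  have T: "finite (z ` {1..s + 2})" "z ` {1..s + 2} \<subseteq> Z" "card (z ` {1..s + 2}) \<le> s + 2"
    using zZ card_image_le[of "{1..s + 2}" z] by auto
  have mg: "min_gens (G\<lparr>carrier := Z\<rparr>) = s + 2"
    by (rule min_gens_center[OF xy ords pows card T gen])
  have "center_decomp G p (s + 2) e f z"
    by (rule center_decompI) (use zZ z12 ords z3 gen card in auto)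
  then show ?thesis using mg z12 by auto
qed

section \<open>Central roots and the four types\<close>

lemma indep_root:
  assumes X: "S \<in> Z" "y \<in> Z" "S [^] p = x" and ind: "indep x y" and pd: "p dvd ord x"
  shows "indep S y"
  unfolding indep_def
proof (intro allI impI)
  fix i j :: nat
  note c = Z_closed[OF X(1)] Z_closed[OF X(2)]
  have xn: "x [^] n = S [^] (p * n)" for n :: nat using X(3) c(1) by (simp flip: nat_pow_pow)
  assume eq: "S [^] i \<otimes> y [^] j = \<one>"
  \<comment> \<open>Passing to \<open>p\<close>-th powers gives a relation between \<open>x\<close>
    and \<open>y\<close>, from which \<open>p dvd i\<close>; after that the original relation is
    itself one between \<open>x\<close> and \<open>y\<close>.\<close>
  have "(S [^] i \<otimes> y [^] j) [^] p = x [^] i \<otimes> y [^] (j * p)"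
    unfolding Z_pair_pow[OF X(1,2)] xn by (simp only: mult.commute)
  then have "x [^] i \<otimes> y [^] (j * p) = \<one>" using eq by simp
  then have "x [^] i = \<one>" using indepD[OF ind] by blast
  moreover have "x \<in> carrier G" using X(3) c by auto
  ultimately have "p dvd i" using pow_eq_id[of x i] pd dvd_trans by blast
  then obtain i' where i': "i = p * i'" by auto
  then have "x [^] i' \<otimes> y [^] j = \<one>" using eq by (simp add: xn)
  then show "S [^] i = \<one> \<and> y [^] j = \<one>" using indepD[OF ind] unfolding i' xn by blast
qed

lemma is_direct_product_center:
  assumes "subgroup A G" "subgroup B G" "A \<subseteq> Z" "B \<subseteq> Z" "A \<inter> B \<subseteq> {\<one>}"
  shows "is_direct_product G (A <#> B) A B"
proof -
  have "A \<inter> B = {\<one>}" using assms(5) subgroup.one_closed[OF assms(1)] subgroup.one_closed[OF assms(2)] by blast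
  then show ?thesis unfolding is_direct_product_def
    using subgroup_Z_mult(1)[OF assms(1-4)]
      factors_normal[OF assms(1,2) central_comm[OF assms(4) subgroup.subset[OF assms(1)]]] by simp
qed

text \<open>Decides between the exponents \<open>n\<close> and \<open>n + 1\<close>: the generator
  is \<open>u\<close> itself if \<open>u\<close> has no central \<open>p\<close>-th root, and such a
  root otherwise.\<close>

lemma root_cases:
  assumes u: "u \<in> Z" "ord u = p ^ n" "n \<ge> 1" and v: "v \<in> Z" "indep u v"
  obtains x e where "x \<in> Z" "ord x = p ^ e" "e \<ge> 1" "indep x v"
    "e = n \<and> x = u \<and> (\<forall>z\<in>Z. z [^] p \<noteq> u) \<or> e = n + 1 \<and> x [^] p = u"
proof (cases "\<exists>z\<in>Z. z [^] p = u")
  case True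
  then obtain x where x: "x \<in> Z" "x [^] p = u" by blast
  have "p dvd ord u" using u(2,3) by simp
  then have i: "indep x v" using indep_root[OF x(1) v(1) x(2) v(2)] by simp
  have "u \<noteq> \<one>" using \<open>p dvd ord u\<close> p_gt by auto
  then have "x \<noteq> \<one>" using x(2) by auto
  then have "ord x = p ^ (n + 1)" using ord_from_pow[OF Z_closed[OF x(1)]] x(2) u(2) by blast
  then show ?thesis using that[of x "n + 1"] x i by simp
next
  case False
  then show ?thesis using that[of u n] u v(2) by blast
qed

text \<open>The assumption \<open>star\<close> can be achieved by replacing \<open>u\<close> with some \<open>u^s v^t\<close>. It makes \<open>p\<close>-th roots of \<open>u\<close> and
  of \<open>v\<close>, where they exist, sufficient to describe all \<open>p\<close>-th powers of central elements.\<close>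

lemma types_exist_aux:
  assumes u: "u \<in> Z" "ord u = p ^ n" "n \<ge> 1" and v: "v \<in> Z" "ord v = p ^ m" "m \<ge> 1"
    and ind: "indep u v" and N: "N = generate G {u} <#> generate G {v}"
    and pN: "\<And>z. z \<in> Z \<Longrightarrow> z [^] p \<in> N"
    and star: "\<And>(s::nat) (t::nat) z. \<not> p dvd s \<Longrightarrow> z \<in> Z \<Longrightarrow> z [^] p = u [^] s \<otimes> v [^] t \<Longrightarrow> \<exists>z\<in>Z. z [^] p = u"
    and r: "r = min_gens (G\<lparr>carrier := Z\<rparr>)"
  shows "\<exists>z. type_A1 G N p n m r z \<or> type_A2 G N p n m r z \<or> type_A3 G N p n m r z \<or> type_A4 G N p n m r z"
proof -
  note uc = Z_closed[OF u(1)] and vc = Z_closed[OF v(1)]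
  obtain x e where x: "x \<in> Z" "ord x = p ^ e" "e \<ge> 1" "indep x v"
    and xu: "e = n \<and> x = u \<and> (\<forall>z\<in>Z. z [^] p \<noteq> u) \<or> e = n + 1 \<and> x [^] p = u"
    using root_cases[OF u v(1) ind] .
  \<comment> \<open>The root of \<open>v\<close> is taken relative to the factor \<open>x\<close>
    already enlarged, so that both choices together stay independent.\<close>
  obtain y f where y: "y \<in> Z" "ord y = p ^ f" "f \<ge> 1" "indep y x"
    and yv: "f = m \<and> y = v \<and> (\<forall>z\<in>Z. z [^] p \<noteq> v) \<or> f = m + 1 \<and> y [^] p = v"
    using root_cases[OF v x(1) indep_sym[OF x(1) v(1) x(4)]] .
  note xc = Z_closed[OF x(1)] and yc = Z_closed[OF y(1)]
  have px: "\<exists>k::nat. u [^] i = x [^] (p * k)" if "(\<exists>z\<in>Z. z [^] p = u) \<or> p dvd i" for i :: nat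
    using xu
  proof
    assume "e = n \<and> x = u \<and> (\<forall>z\<in>Z. z [^] p \<noteq> u)"
    then have "p dvd i" "x = u" using that by auto
    then show ?thesis by (auto elim!: dvdE)
  next
    assume "e = n + 1 \<and> x [^] p = u"
    then have "u [^] i = x [^] (p * i)" using xc by (simp flip: nat_pow_pow)
    then show ?thesis by blast
  qed
  have py: "\<exists>k::nat. v [^] i = y [^] (p * k)" if "(\<exists>z\<in>Z. z [^] p = v) \<or> p dvd i" for i :: nat
    using yv
  proof
    assume "f = m \<and> y = v \<and> (\<forall>z\<in>Z. z [^] p \<noteq> v)"
    then have "p dvd i" "y = v" using that by auto
    then show ?thesis by (auto elim!: dvdE)
  next
    assume "f = m + 1 \<and> y [^] p = v"
    then have "v [^] i = y [^] (p * i)" using yc by (simp flip: nat_pow_pow)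
    then show ?thesis by blast
  qed
  have pows: "\<exists>(i::nat) j::nat. z [^] p = x [^] (p * i) \<otimes> y [^] (p * j)" if z: "z \<in> Z" for z
  proof -
    obtain a b where ab: "a \<in> generate G {u}" "b \<in> generate G {v}" "z [^] p = a \<otimes> b"
      using pN[OF z] unfolding N mem_set_mult by blast
    obtain i :: nat where i: "a = u [^] i" using generate_nat_powE'[OF ab(1) u(1)] .
    obtain j :: nat where j: "b = v [^] j" using generate_nat_powE'[OF ab(2) v(1)] .
    have zp: "z [^] p = u [^] i \<otimes> v [^] j" using ab(3) i j by simp
    have "(\<exists>z\<in>Z. z [^] p = u) \<or> p dvd i" using star[OF _ z zp] by blast
    from px[OF this] obtain k :: nat where k: "u [^] i = x [^] (p * k)" by blast
    have "(\<exists>z\<in>Z. z [^] p = v) \<or> p dvd j"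
    proof (rule disjCI)
      assume pj: "\<not> p dvd j"
      \<comment> \<open>Removing the \<open>u\<close>-part of \<open>z^p\<close> by a central
        element leaves \<open>h^p = v^j\<close> with \<open>j\<close> prime to \<open>p\<close>; a
        suitable power of \<open>h\<close> is then a root of \<open>v\<close>.\<close>
      define h where "h = z \<otimes> inv (x [^] k)"
      have xk: "x [^] k \<in> Z" using Z_pow_closed[OF x(1)] .
      have ixk: "inv (x [^] k) \<in> Z" by (rule subgroup.m_inv_closed[OF subgroup_center xk])
      have hZ: "h \<in> Z" unfolding h_def by (rule subgroup.m_closed[OF subgroup_center z ixk])
      have "h [^] p = z [^] p \<otimes> inv (x [^] (p * k))"
        unfolding h_def using Z_pow_distrib[OF ixk Z_closed[OF z]] xc
        by (simp add: nat_pow_inv nat_pow_pow mult.commute)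
      also have "z [^] p = v [^] j \<otimes> x [^] (p * k)"
        unfolding zp k by (rule Z_comm[OF Z_pow_closed[OF x(1)]]) (use vc in simp)
      finally have hv: "h [^] p = v [^] j" using xc vc by (simp add: m_assoc)
      have "v \<in> generate G {v [^] j}"
        using generate_pow_coprime(1)[OF vc v(2) pj] by (auto intro: generate.incl)
      then obtain q :: nat where q: "v = (v [^] j) [^] q"
        using generate_nat_powE'[OF _ Z_pow_closed[OF v(1)]] by blast
      have "(h [^] q) [^] p = (h [^] p) [^] q" using Z_closed[OF hZ] by (simp add: nat_pow_pow mult.commute)
      also have "\<dots> = v" using q hv by simp
      finally show "\<exists>z\<in>Z. z [^] p = v" using Z_pow_closed[OF hZ] by blast
    qed
    from py[OF this] obtain l :: nat where "v [^] j = y [^] (p * l)" by blast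
    then show ?thesis using zp k by auto
  qed
  obtain z where z: "center_decomp G p r e f z" "z 1 = x" "z 2 = y"
    using center_decomp_exists[OF x(1) y(1) x(2) y(2) x(3) y(3) indep_sym[OF y(1) x(1) y(4)] pows] r by blast
  have dp: "is_direct_product G N (generate G {u}) (generate G {v})"
    unfolding N using generate_single[OF u(1)] generate_single[OF v(1)] indep_generate_int[OF u(1) v(1) ind]
    by (intro is_direct_product_center) auto
  show ?thesis
    using xu yv
  proof (elim disjE)
    assume "e = n \<and> x = u \<and> (\<forall>z\<in>Z. z [^] p \<noteq> u)" "f = m \<and> y = v \<and> (\<forall>z\<in>Z. z [^] p \<noteq> v)"
    then have "type_A1 G N p n m r z" using z dp by (simp add: type_A1_def)
    then show ?thesis by blast
  next
    assume "e = n + 1 \<and> x [^] p = u" "f = m \<and> y = v \<and> (\<forall>z\<in>Z. z [^] p \<noteq> v)"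
    then have "type_A2 G N p n m r z" using z dp by (simp add: type_A2_def)
    then show ?thesis by blast
  next
    assume "e = n \<and> x = u \<and> (\<forall>z\<in>Z. z [^] p \<noteq> u)" "f = m + 1 \<and> y [^] p = v"
    then have "type_A3 G N p n m r z" using z dp by (simp add: type_A3_def)
    then show ?thesis by blast
  next
    assume "e = n + 1 \<and> x [^] p = u" "f = m + 1 \<and> y [^] p = v"
    then have "type_A4 G N p n m r z" using z dp by (simp add: type_A4_def)
    then show ?thesis by blast
  qed
qed

text \<open>If a central \<open>p\<close>-th power has \<open>u\<close>-exponent prime to
  \<open>p\<close>, it replaces \<open>u\<close>: by \<open>m \<le> n\<close> its order is again
  \<open>p^n\<close>, and together with \<open>v\<close> it still generates \<open>N\<close>. If
  there is none, the condition on \<open>u\<close> holds vacuously.\<close>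

lemma types_exist:
  assumes u: "u \<in> Z" "ord u = p ^ n" "n \<ge> 1" and v: "v \<in> Z" "ord v = p ^ m" "m \<ge> 1"
    and ind: "indep u v" and N: "N = generate G {u} <#> generate G {v}" and mn: "m \<le> n"
    and pN: "\<And>z. z \<in> Z \<Longrightarrow> z [^] p \<in> N"
    and r: "r = min_gens (G\<lparr>carrier := Z\<rparr>)"
  shows "\<exists>z. type_A1 G N p n m r z \<or> type_A2 G N p n m r z \<or> type_A3 G N p n m r z \<or> type_A4 G N p n m r z"
proof (cases "\<exists>(s::nat) (t::nat) z. \<not> p dvd s \<and> z \<in> Z \<and> z [^] p = u [^] s \<otimes> v [^] t")
  case True
  then obtain s t :: nat and z where st: "\<not> p dvd s" "z \<in> Z" "z [^] p = u [^] s \<otimes> v [^] t" by blast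
  note ic = indep_change[OF u(1) v(1) u(2) v(2) mn st(1) ind, of t]
  show ?thesis
    by (rule types_exist_aux[OF ic(1,2) u(3) v ic(3) _ pN _ r]) (use ic(4) N st in auto)
next
  case False
  have "\<exists>z\<in>Z. z [^] p = u" if h: "\<not> p dvd s" "z \<in> Z" "z [^] p = u [^] s \<otimes> v [^] t" for s t :: nat and z
    using False h(1) h(2) h(3) by metis
  from types_exist_aux[OF u v ind N pN this r] show ?thesis .
qed

section \<open>From the four types to the case analysis\<close>

lemma pow_basis_of_decomp:
  assumes d: "center_decomp G p r e f z" and ef: "e \<ge> 1" "f \<ge> 1"
    and pw: "\<And>g. g \<in> carrier G \<Longrightarrow> \<exists>(i::nat) j::nat. g [^] p = z 1 [^] i \<otimes> z 2 [^] j"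
  shows "pow_basis (z 1) (z 2) e f (generate G (z ` {3..r}))"
  unfolding pow_basis_def using center_decomp_triple[OF d] ef pw by blast

lemma direct_product_mem:
  assumes "is_direct_product G N (generate G {a}) (generate G {b})" "a \<in> carrier G" "b \<in> carrier G" "x \<in> N"
  shows "\<exists>(i::nat) j::nat. x = a [^] i \<otimes> b [^] j"
proof -
  have "x \<in> generate G {a} <#> generate G {b}" using assms(1,4) by (simp add: is_direct_product_def)
  then obtain y w where yw: "y \<in> generate G {a}" "w \<in> generate G {b}" "x = y \<otimes> w" by (auto simp: mem_set_mult)
  obtain i :: nat where "y = a [^] i" using generate_nat_powE[OF yw(1) assms(2)] .
  moreover obtain j :: nat where "w = b [^] j" using generate_nat_powE[OF yw(2) assms(3)] .
  ultimately show ?thesis using yw(3) by blast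
qed

lemma C_subI: "c \<in> generate G {x} \<Longrightarrow> x \<in> carrier G \<Longrightarrow> C \<subseteq> generate G {x}"
  by (intro generate_subgroup_incl generate_is_subgroup) auto

lemma pow_kernel_eq_carrier:
  "(\<And>g. g \<in> carrier G \<Longrightarrow> \<exists>(i::nat) j::nat. g [^] p = x [^] (p * i) \<otimes> y [^] j) \<Longrightarrow> pow_kernel x y = carrier G"
  by (auto simp: pow_kernel_def)

context
  fixes N and n m k r :: nat
  assumes nm: "n \<ge> 1" "m \<ge> 1" and pN_all: "\<forall>g\<in>carrier G. g [^] p \<in> N"
    and card: "card (carrier G) = card Z * p ^ (2 * k)"
begin

lemma pN: "g \<in> carrier G \<Longrightarrow> g [^] p \<in> N"
  using pN_all by blast

lemma type_A1_basis:
  assumes "type_A1 G N p n m r z"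
  shows "pow_basis (z 1) (z 2) n m (generate G (z ` {3..r}))" "Elem p (r - 2) (G\<lparr>carrier := generate G (z ` {3..r})\<rparr>)"
    "z 1 \<in> carrier G" "z 2 \<in> carrier G"
proof -
  have d: "center_decomp G p r n m z" "is_direct_product G N (generate G {z 1}) (generate G {z 2})"
    using assms by (auto simp: type_A1_def)
  note t = center_decomp_triple[OF d(1)]
  show zc: "z 1 \<in> carrier G" "z 2 \<in> carrier G" using t(1,2) Z_closed by auto
  show "pow_basis (z 1) (z 2) n m (generate G (z ` {3..r}))"
    by (rule pow_basis_of_decomp[OF d(1) nm direct_product_mem[OF d(2) zc pN]])
  show "Elem p (r - 2) (G\<lparr>carrier := generate G (z ` {3..r})\<rparr>)" by (rule t(7))
qed

text \<open>In the first coordinate \<open>N\<close> contains only powers of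
  \<open>z 1 [^] p\<close>, so the first functional vanishes. Type \<open>A_3\<close> kills the
  second one in the same way.\<close>

lemma type_A2_basis:
  assumes "type_A2 G N p n m r z"
  shows "pow_basis (z 1) (z 2) (n + 1) m (generate G (z ` {3..r}))"
    "Elem p (r - 2) (G\<lparr>carrier := generate G (z ` {3..r})\<rparr>)"
    "z 1 \<in> carrier G" "z 2 \<in> carrier G" "pow_kernel (z 1) (z 2) = carrier G"
proof -
  have d: "center_decomp G p r (n + 1) m z" "is_direct_product G N (generate G {z 1 [^] p}) (generate G {z 2})"
    using assms by (auto simp: type_A2_def)
  note t = center_decomp_triple[OF d(1)]
  show zc: "z 1 \<in> carrier G" "z 2 \<in> carrier G" using t(1,2) Z_closed by auto
  have pw: "\<exists>(i::nat) j::nat. g [^] p = z 1 [^] (p * i) \<otimes> z 2 [^] j" if "g \<in> carrier G" for g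
    using direct_product_mem[OF d(2) _ zc(2) pN[OF that]] zc by (simp add: nat_pow_pow)
  then show "pow_kernel (z 1) (z 2) = carrier G" by (rule pow_kernel_eq_carrier)
  have "\<exists>(i::nat) j::nat. g [^] p = z 1 [^] i \<otimes> z 2 [^] j" if "g \<in> carrier G" for g
    using pw[OF that] by blast
  from pow_basis_of_decomp[OF d(1) _ nm(2) this]
  show "pow_basis (z 1) (z 2) (n + 1) m (generate G (z ` {3..r}))" by simp
  show "Elem p (r - 2) (G\<lparr>carrier := generate G (z ` {3..r})\<rparr>)" by (rule t(7))
qed

lemma type_A3_basis:
  assumes "type_A3 G N p n m r z"
  shows "pow_basis (z 1) (z 2) n (m + 1) (generate G (z ` {3..r}))"
    "Elem p (r - 2) (G\<lparr>carrier := generate G (z ` {3..r})\<rparr>)"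
    "z 1 \<in> carrier G" "z 2 \<in> carrier G" "pow_kernel (z 2) (z 1) = carrier G"
proof -
  have d: "center_decomp G p r n (m + 1) z" "is_direct_product G N (generate G {z 1}) (generate G {z 2 [^] p})"
    using assms by (auto simp: type_A3_def)
  note t = center_decomp_triple[OF d(1)]
  show zc: "z 1 \<in> carrier G" "z 2 \<in> carrier G" using t(1,2) Z_closed by auto
  have pw: "\<exists>(i::nat) j::nat. g [^] p = z 1 [^] i \<otimes> z 2 [^] (p * j)" if "g \<in> carrier G" for g
    using direct_product_mem[OF d(2) zc(1) _ pN[OF that]] zc by (simp add: nat_pow_pow)
  have "\<exists>(i::nat) j::nat. g [^] p = z 2 [^] (p * i) \<otimes> z 1 [^] j" if g: "g \<in> carrier G" for g
  proof -
    obtain i j :: nat where "g [^] p = z 1 [^] i \<otimes> z 2 [^] (p * j)" using pw[OF g] by blast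
    then have "g [^] p = z 2 [^] (p * j) \<otimes> z 1 [^] i" using Z_pair_comm[OF t(1,2)] by simp
    then show ?thesis by blast
  qed
  then show "pow_kernel (z 2) (z 1) = carrier G" by (rule pow_kernel_eq_carrier)
  have "\<exists>(i::nat) j::nat. g [^] p = z 1 [^] i \<otimes> z 2 [^] j" if "g \<in> carrier G" for g
    using pw[OF that] by blast
  from pow_basis_of_decomp[OF d(1) nm(1) _ this]
  show "pow_basis (z 1) (z 2) n (m + 1) (generate G (z ` {3..r}))" by simp
  show "Elem p (r - 2) (G\<lparr>carrier := generate G (z ` {3..r})\<rparr>)" by (rule t(7))
qed

text \<open>All of \<open>N\<close> consists of \<open>p\<close>-th powers of central elements, so
  every element can be adjusted and both functionals vanish. The element \<open>c\<close> of
  \<open>N\<close> may involve both cyclic factors, so they are joined together.\<close>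

lemma type_A4_classification:
  assumes "type_A4 G N p n m r z" and cN: "c \<in> N"
  shows "direct_products [central_products p (replicate k (Mp3 p 1 1) @
    [iso_to (integer_mod_group (p ^ (n + 1)) \<times>\<times> integer_mod_group (p ^ (m + 1)))]), Elem p (r - 2)] G"
proof -
  have d: "center_decomp G p r (n + 1) (m + 1) z"
    "is_direct_product G N (generate G {z 1 [^] p}) (generate G {z 2 [^] p})"
    using assms by (auto simp: type_A4_def)
  note t = center_decomp_triple[OF d(1)]
  have zc: "z 1 \<in> carrier G" "z 2 \<in> carrier G" using t(1,2) Z_closed by auto
  have mem: "\<exists>(i::nat) j::nat. x = z 1 [^] (p * i) \<otimes> z 2 [^] (p * j)" if "x \<in> N" for x
    using direct_product_mem[OF d(2) _ _ that] zc by (simp add: nat_pow_pow)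
  have "\<exists>w\<in>Z. (g \<otimes> w) [^] p = \<one>" if g: "g \<in> carrier G" for g
  proof -
    obtain i j :: nat where ij: "g [^] p = z 1 [^] (p * i) \<otimes> z 2 [^] (p * j)" using mem[OF pN[OF g]] by blast
    define v where "v = z 1 [^] i \<otimes> z 2 [^] j"
    have v: "v \<in> Z" unfolding v_def by (intro subgroup.m_closed[OF subgroup_center] Z_pow_closed t)
    have vp: "v [^] p = g [^] p" unfolding v_def ij Z_pair_pow[OF t(1,2)] by (simp only: mult.commute)
    have w: "inv v \<in> Z" by (rule subgroup.m_inv_closed[OF subgroup_center v])
    have "(g \<otimes> inv v) [^] p = g [^] p \<otimes> inv (g [^] p)"
      by (simp add: Z_pow_distrib[OF w g] nat_pow_inv[OF Z_closed[OF v]] vp)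
    then show ?thesis using w g by (intro bexI[of _ "inv v"]) simp_all
  qed
  then have ex: "exp_adjustable (carrier G)" by (simp add: exp_adjustable_def)
  let ?A = "generate G {z 1}" and ?B = "generate G {z 2}"
  note tt = center_tripleD[OF t(3)]
  obtain i j :: nat where "c = z 1 [^] (p * i) \<otimes> z 2 [^] (p * j)" using mem[OF cN] by blast
  then have "c \<in> ?A <#> ?B" unfolding mem_set_mult using generate_pow_mem zc by blast
  then have "C \<subseteq> ?A <#> ?B"
    using generate_subgroup_incl[OF _ subgroup_Z_mult(1)[OF tt(1,2,4,5)]] by simp
  from type_M3_power_pair[where Q = "Elem p (r - 2)" and
      P = "iso_to (integer_mod_group (p ^ (n + 1)) \<times>\<times> integer_mod_group (p ^ (m + 1)))", OF t(3) this ex card center_pair_iso[OF d(1)] t(7)]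
  show ?thesis .
qed

end

end

section \<open>Making the hypotheses on \<open>N\<close> and on the quotients usable\<close>

lemma (in group) normal_center_subgroup:
  assumes "subgroup N G" "N \<subseteq> center G"
  shows "N \<lhd> G"
  unfolding normal_inv_iff
proof (intro conjI ballI assms(1))
  fix x h assume x: "x \<in> carrier G" and h: "h \<in> N"
  have hc: "h \<in> center G" "h \<in> carrier G" using h assms(2) center_closed by auto
  have "x \<otimes> h \<otimes> inv x = h \<otimes> x \<otimes> inv x" by (simp only: center_comm[OF hc(1) x])
  also have "\<dots> = h" using x hc by (simp add: m_assoc)
  finally show "x \<otimes> h \<otimes> inv x \<in> N" using h by simp
qed

lemma elem_abelian_mult:
  "x \<otimes>\<^bsub>elem_abelian p s\<^esub> y = (\<lambda>i\<in>{..<s}. (x i + y i) mod int p)"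
  by (simp add: elem_abelian_def)

lemma comm_group_elem_abelian: "comm_group (elem_abelian p s)"
proof -
  have "group (elem_abelian p s)" unfolding elem_abelian_def by (rule product_group) auto
  then show ?thesis by (rule group.group_comm_groupI) (simp add: elem_abelian_mult add.commute)
qed

lemma elem_abelian_pow:
  assumes "x \<in> carrier (elem_abelian p s)" "p > 0"
  shows "x [^]\<^bsub>elem_abelian p s\<^esub> p = \<one>\<^bsub>elem_abelian p s\<^esub>"
proof -
  have "x [^]\<^bsub>elem_abelian p s\<^esub> (k::nat) = (\<lambda>i\<in>{..<s}. (int k * x i) mod int p)" for k
  proof (induction k)
    case 0
    then show ?case by (simp add: elem_abelian_def)
  next
    case (Suc k)
    then show ?case
      by (auto simp: elem_abelian_mult restrict_def fun_eq_iff mod_add_left_eq mod_add_right_eq algebra_simps)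
  qed
  then show ?thesis by (simp add: elem_abelian_def)
qed

lemma (in group) quotient_elem_abelian:
  assumes N: "N \<lhd> G" and iso: "(G Mod N) \<cong> elem_abelian p s" and p: "p > 0"
  shows "\<And>g. g \<in> carrier G \<Longrightarrow> g [^] p \<in> N" "derived G (carrier G) \<subseteq> N"
proof -
  interpret N: normal N G by (rule N)
  interpret Q: group "G Mod N" by (rule N.factorgroup_is_group)
  interpret E: comm_group "elem_abelian p s" by (rule comm_group_elem_abelian)
  have sub: "subgroup N G" by (rule normal_imp_subgroup[OF N])
  have carN: "N #> g \<in> carrier (G Mod N)" if "g \<in> carrier G" for g using that by (auto simp: carrier_FactGroup)
  obtain h where h: "h \<in> iso (G Mod N) (elem_abelian p s)" using iso by (auto simp: is_iso_def)
  interpret h: group_hom "G Mod N" "elem_abelian p s" h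
    using h by unfold_locales (simp add: iso_def)
  have inj: "inj_on h (carrier (G Mod N))" using h by (simp add: iso_def bij_betw_def)
  have NG: "N \<subseteq> carrier G" by (rule subgroup.subset[OF sub])
  show "g [^] p \<in> N" if g: "g \<in> carrier G" for g
  proof -
    have "h ((N #> g) [^]\<^bsub>G Mod N\<^esub> p) = h \<one>\<^bsub>G Mod N\<^esub>"
      by (simp only: h.hom_nat_pow[OF carN[OF g]] elem_abelian_pow[OF h.hom_closed[OF carN[OF g]] p] h.hom_one)
    then have "(N #> g) [^]\<^bsub>G Mod N\<^esub> p = \<one>\<^bsub>G Mod N\<^esub>"
      using inj_onD[OF inj] Q.nat_pow_closed[OF carN[OF g]] Q.one_closed by blast
    then have "N #> g [^] p = N" using N.FactGroup_pow[OF g] by simp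
    then show ?thesis using coset_join1[OF _ _ sub] g by blast
  qed
  have "x \<otimes> y \<otimes> inv x \<otimes> inv y \<in> N" if xy: "x \<in> carrier G" "y \<in> carrier G" for x y
  proof -
    have "h ((N #> x) \<otimes>\<^bsub>G Mod N\<^esub> (N #> y)) = h ((N #> y) \<otimes>\<^bsub>G Mod N\<^esub> (N #> x))"
      using carN xy E.m_comm by (simp only: h.hom_mult h.hom_closed carN xy E.m_comm)
    then have "(N #> x) \<otimes>\<^bsub>G Mod N\<^esub> (N #> y) = (N #> y) \<otimes>\<^bsub>G Mod N\<^esub> (N #> x)"
      using inj_onD[OF inj] Q.m_closed carN xy by blast
    then have "N #> (x \<otimes> y) = N #> (y \<otimes> x)" using N.rcos_sum xy by simp
    then have "x \<otimes> y \<in> N #> (y \<otimes> x)" using rcos_self[OF _ sub, of "x \<otimes> y"] xy by simp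
    then obtain d where d: "d \<in> N" "x \<otimes> y = d \<otimes> (y \<otimes> x)" by (auto simp: r_coset_def)
    have dc: "d \<in> carrier G" using d NG by blast
    have "x \<otimes> y \<otimes> inv x \<otimes> inv y = d"
      using xy dc by (simp add: d(2) m_assoc mult_inv_cancel)
    then show ?thesis using d by simp
  qed
  then have "derived_set G (carrier G) \<subseteq> N" by auto
  then show "derived G (carrier G) \<subseteq> N" unfolding derived_def by (rule generate_subgroup_incl[OF _ sub])
qed

text \<open>\<open>u\<close> and \<open>v\<close> are the images of the unit vectors, which are
  residues because \<open>q\<close> and \<open>q'\<close> exceed 1. Each \<open>u^i v^j\<close> is
  the image of the pair of reduced exponents, so all claims become divisibility.\<close>

lemma (in group) two_cyclic_factors:
  assumes N: "subgroup N G" and iso: "(G\<lparr>carrier := N\<rparr>) \<cong> integer_mod_group q \<times>\<times> integer_mod_group q'"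
    and q: "q > 1" "q' > 1"
  obtains u v where "u \<in> N" "v \<in> N" "ord u = q" "ord v = q'"
    "\<And>(i::nat) j::nat. u [^] i \<otimes> v [^] j = \<one> \<Longrightarrow> u [^] i = \<one> \<and> v [^] j = \<one>"
    "N = generate G {u} <#> generate G {v}"
proof -
  let ?D = "integer_mod_group q \<times>\<times> integer_mod_group q'"
  interpret Ng: group "G\<lparr>carrier := N\<rparr>" using N by (rule subgroup_imp_group)
  have D: "group ?D" by (intro DirProd_group) simp_all
  obtain h where h: "h \<in> iso ?D (G\<lparr>carrier := N\<rparr>)" using Ng.iso_sym[OF iso] by (auto simp: is_iso_def)
  interpret h: group_hom ?D "G\<lparr>carrier := N\<rparr>" h
    using h D by (intro group_hom.intro group_hom_axioms.intro Ng.is_group) (auto simp: iso_def)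
  have car: "carrier ?D = {0..<int q} \<times> {0..<int q'}" using q by (simp add: carrier_integer_mod_group)
  have bij: "bij_betw h ({0..<int q} \<times> {0..<int q'}) N" using h unfolding iso_def car by simp
  note inj = bij_betw_imp_inj_on[OF bij] and surj = bij_betw_imp_surj_on[OF bij]
  have hm: "h (a, b) \<otimes> h (a', b') = h ((a + a') mod int q, (b + b') mod int q')"
    if "a \<in> {0..<int q}" "a' \<in> {0..<int q}" "b \<in> {0..<int q'}" "b' \<in> {0..<int q'}" for a b a' b'
  proof -
    have "(a, b) \<in> carrier ?D" "(a', b') \<in> carrier ?D" unfolding car using that by auto
    from h.hom_mult[OF this] show ?thesis by simp
  qed
  have h1: "h (0, 0) = \<one>" using h.hom_one by simp
  define u where "u = h (1, 0)"
  define v where "v = h (0, 1)"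
  have uN: "u \<in> N" and vN: "v \<in> N" using surj q by (auto simp: u_def v_def)
  have uc: "u \<in> carrier G" and vc: "v \<in> carrier G" using uN vN subgroup.mem_carrier[OF N] by auto
  have pu: "u [^] (i::nat) = h (int i mod int q, 0)" for i
  proof (induction i)
    case (Suc i)
    have "u [^] Suc i = h (int i mod int q, 0) \<otimes> h (1, 0)" using Suc by (simp add: u_def)
    also have "\<dots> = h ((int i mod int q + 1) mod int q, (0 + 0) mod int q')" using q by (intro hm) auto
    also have "\<dots> = h (int (Suc i) mod int q, 0)" by (simp add: mod_add_left_eq mod_add_right_eq add.commute)
    finally show ?case .
  qed (simp add: h1)
  have pv: "v [^] (i::nat) = h (0, int i mod int q')" for i
  proof (induction i)
    case (Suc i)
    have "v [^] Suc i = h (0, int i mod int q') \<otimes> h (0, 1)" using Suc by (simp add: v_def)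
    also have "\<dots> = h ((0 + 0) mod int q, (int i mod int q' + 1) mod int q')" using q by (intro hm) auto
    also have "\<dots> = h (0, int (Suc i) mod int q')" by (simp add: mod_add_left_eq mod_add_right_eq add.commute)
    finally show ?case .
  qed (simp add: h1)
  have puv: "u [^] (i::nat) \<otimes> v [^] (j::nat) = h (int i mod int q, int j mod int q')" for i j
  proof -
    have "h (int i mod int q, 0) \<otimes> h (0, int j mod int q') =
        h ((int i mod int q + 0) mod int q, (0 + int j mod int q') mod int q')" using q by (intro hm) auto
    then show ?thesis unfolding pu pv by simp
  qed
  have one: "u [^] (i::nat) \<otimes> v [^] (j::nat) = \<one> \<longleftrightarrow> q dvd i \<and> q' dvd j" for i j
  proof -
    have "h (int i mod int q, int j mod int q') = h (0, 0) \<longleftrightarrow> (int i mod int q, int j mod int q') = (0, 0)"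
      using q by (intro inj_on_eq_iff[OF inj]) auto
    then show ?thesis unfolding puv h1 by (auto simp flip: of_nat_mod dvd_eq_mod_eq_0)
  qed
  have ou: "u [^] (i::nat) = \<one> \<longleftrightarrow> q dvd i" for i using one[of i 0] uc by simp
  have ov: "v [^] (i::nat) = \<one> \<longleftrightarrow> q' dvd i" for i using one[of 0 i] vc by simp
  have "N = generate G {u} <#> generate G {v}"
  proof (rule equalityI; rule subsetI)
    fix x assume "x \<in> N"
    then obtain a b where ab: "a \<in> {0..<int q}" "b \<in> {0..<int q'}" "x = h (a, b)" using surj by force
    have "x = u [^] nat a \<otimes> v [^] nat b" unfolding puv using ab by simp
    moreover have "u [^] nat a \<in> generate G {u}" "v [^] nat b \<in> generate G {v}"
      by (rule generate_pow_mem[OF uc], rule generate_pow_mem[OF vc])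
    ultimately show "x \<in> generate G {u} <#> generate G {v}" unfolding mem_set_mult by blast
  next
    fix x assume "x \<in> generate G {u} <#> generate G {v}"
    then show "x \<in> N"
      using generate_subgroup_incl[OF _ N, of "{u}"] generate_subgroup_incl[OF _ N, of "{v}"] uN vN
        subgroup.m_closed[OF N] by (auto simp: mem_set_mult subset_iff)
  qed
  then show ?thesis using that[of u v] uN vN ou ov one ord_unique[OF uc, of q] ord_unique[OF vc, of q'] by blast
qed

theorem theorem1p1:
  fixes G :: "('a, 'b) monoid_scheme" and N :: "'a set" and c :: 'a
    and p n m k r :: nat
  assumes "Factorial_Ring.prime p" and "p > 2" and "n \<ge> m" and "m \<ge> 1"
    and "group G" and "finite (carrier G)" and "\<exists>e. order G = p ^ e"
    and "subgroup N G" and "N \<subseteq> center G"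
    and "(G\<lparr>carrier := N\<rparr>) \<cong> integer_mod_group (p ^ n) \<times>\<times> integer_mod_group (p ^ m)"
    and "\<exists>s. (G Mod N) \<cong> elem_abelian p s"
    and "c \<in> carrier G" and "derived G (carrier G) = generate G {c}"
    and "(G\<lparr>carrier := generate G {c}\<rparr>) \<cong> integer_mod_group p"
    and "order (G Mod center G) = p ^ (2 * k)"
    and "min_gens (G\<lparr>carrier := center G\<rparr>) = r"
  shows
    "(\<exists>z. type_A1 G N p n m r z \<or> type_A2 G N p n m r z \<or>
          type_A3 G N p n m r z \<or> type_A4 G N p n m r z) \<and>
     (\<forall>z. type_A1 G N p n m r z \<and> c \<in> generate G {z 1} \<longrightarrow>
        direct_products [central_products p (Mp2 p (n + 1) (m + 1) # replicate (k - 1) (Mp3 p 1 1)),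
          Elem p (r - 2)] G \<or>
        (k \<ge> 2 \<and> direct_products [central_products p
            (Mp2 p (n + 1) 1 # Mp3 p (m + 1) 1 # replicate (k - 2) (Mp3 p 1 1)),
          Elem p (r - 2)] G) \<or>
        direct_products [central_products p (Mp2 p (n + 1) 1 # replicate (k - 1) (Mp3 p 1 1)),
          Cyc (p ^ m), Elem p (r - 2)] G \<or>
        direct_products [central_products p
            (Mp3 p (m + 1) 1 # replicate (k - 1) (Mp3 p 1 1) @ [Cyc (p ^ n)]),
          Elem p (r - 2)] G \<or>
        direct_products [central_products p (replicate k (Mp3 p 1 1) @ [Cyc (p ^ n)]),
          Cyc (p ^ m), Elem p (r - 2)] G) \<and>
     (\<forall>z. type_A1 G N p n m r z \<and> c \<in> generate G {z 2} \<longrightarrow>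
        direct_products [central_products p (Mp2 p (m + 1) (n + 1) # replicate (k - 1) (Mp3 p 1 1)),
          Elem p (r - 2)] G \<or>
        (k \<ge> 2 \<and> direct_products [central_products p
            (Mp2 p (m + 1) 1 # Mp3 p (n + 1) 1 # replicate (k - 2) (Mp3 p 1 1)),
          Elem p (r - 2)] G) \<or>
        direct_products [central_products p (Mp2 p (m + 1) 1 # replicate (k - 1) (Mp3 p 1 1)),
          Cyc (p ^ n), Elem p (r - 2)] G \<or>
        direct_products [central_products p
            (Mp3 p (n + 1) 1 # replicate (k - 1) (Mp3 p 1 1) @ [Cyc (p ^ m)]),
          Elem p (r - 2)] G \<or>
        direct_products [central_products p (replicate k (Mp3 p 1 1) @ [Cyc (p ^ m)]),
          Cyc (p ^ n), Elem p (r - 2)] G) \<and>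
     (\<forall>z. type_A2 G N p n m r z \<and> c \<in> generate G {z 1} \<longrightarrow>
        direct_products [central_products p
            (Mp3 p (m + 1) 1 # replicate (k - 1) (Mp3 p 1 1) @ [Cyc (p ^ (n + 1))]),
          Elem p (r - 2)] G \<or>
        direct_products [central_products p (replicate k (Mp3 p 1 1) @ [Cyc (p ^ (n + 1))]),
          Cyc (p ^ m), Elem p (r - 2)] G) \<and>
     (\<forall>z. type_A2 G N p n m r z \<and> c \<in> generate G {z 2} \<longrightarrow>
        direct_products [central_products p (Mp2 p (m + 1) 1 # replicate (k - 1) (Mp3 p 1 1)),
          Cyc (p ^ (n + 1)), Elem p (r - 2)] G \<or>
        direct_products [central_products p (replicate k (Mp3 p 1 1) @ [Cyc (p ^ m)]),
          Cyc (p ^ (n + 1)), Elem p (r - 2)] G) \<and>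
     (\<forall>z. type_A3 G N p n m r z \<and> c \<in> generate G {z 1} \<longrightarrow>
        direct_products [central_products p (Mp2 p (n + 1) 1 # replicate (k - 1) (Mp3 p 1 1)),
          Cyc (p ^ (m + 1)), Elem p (r - 2)] G \<or>
        direct_products [central_products p (replicate k (Mp3 p 1 1) @ [Cyc (p ^ n)]),
          Cyc (p ^ (m + 1)), Elem p (r - 2)] G) \<and>
     (\<forall>z. type_A3 G N p n m r z \<and> c \<in> generate G {z 2} \<longrightarrow>
        direct_products [central_products p
            (Mp3 p (n + 1) 1 # replicate (k - 1) (Mp3 p 1 1) @ [Cyc (p ^ (m + 1))]),
          Elem p (r - 2)] G \<or>
        direct_products [central_products p (replicate k (Mp3 p 1 1) @ [Cyc (p ^ (m + 1))]),
          Cyc (p ^ n), Elem p (r - 2)] G) \<and>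
     (\<forall>z. type_A4 G N p n m r z \<longrightarrow>
        direct_products [central_products p (replicate k (Mp3 p 1 1) @
            [iso_to (integer_mod_group (p ^ (n + 1)) \<times>\<times> integer_mod_group (p ^ (m + 1)))]),
          Elem p (r - 2)] G)"
proof -
  note prime = assms(1) and nm = assms(3,4)
  interpret group G by (rule assms(5))
  obtain s where s: "(G Mod N) \<cong> elem_abelian p s" using assms(11) by blast
  have N: "N \<lhd> G" by (rule normal_center_subgroup[OF assms(8,9)])
  have p0: "p > 0" using assms(2) by simp
  note quot = quotient_elem_abelian[OF N s p0]
  have "c \<in> generate G {c}" by (intro generate.incl) simp
  \<comment> \<open>The quotient by \<open>N\<close> is abelian, so \<open>c\<close> lies in
    \<open>N\<close>, which makes it central.\<close>
  then have cN: "c \<in> N" using quot(2) assms(13) by blast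
  have "card (generate G {c}) = p"
    using iso_same_card[OF assms(14)] p0 by (simp add: carrier_integer_mod_group)
  then interpret derived_prime_group G p c
    by unfold_locales (use assms cN in auto)
  have "card (rcosets\<^bsub>G\<^esub> Z) * card Z = order G" by (rule lagrange[OF subgroup_center])
  then have card: "card (carrier G) = card Z * p ^ (2 * k)"
    using assms(15) by (simp add: order_def FactGroup_def mult.commute)
  have n1: "n \<ge> 1" using nm by simp
  have pw: "\<forall>g\<in>carrier G. g [^]\<^bsub>G\<^esub> p \<in> N" using quot(1) by blast
  note A1 = type_A1_basis[OF n1 nm(2) pw card] and A2 = type_A2_basis[OF n1 nm(2) pw card]
    and A3 = type_A3_basis[OF n1 nm(2) pw card]
  have q: "p ^ n > 1" "p ^ m > 1" using one_less_power[of p n] one_less_power[of p m] nm n1 p_gt by simp_all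
  obtain u v where uv: "u \<in> N" "v \<in> N" "ord u = p ^ n" "ord v = p ^ m"
    "\<And>(i::nat) j::nat. u [^]\<^bsub>G\<^esub> i \<otimes>\<^bsub>G\<^esub> v [^]\<^bsub>G\<^esub> j = \<one>\<^bsub>G\<^esub> \<Longrightarrow>
      u [^]\<^bsub>G\<^esub> i = \<one>\<^bsub>G\<^esub> \<and> v [^]\<^bsub>G\<^esub> j = \<one>\<^bsub>G\<^esub>"
    "N = generate G {u} <#>\<^bsub>G\<^esub> generate G {v}"
    using two_cyclic_factors[OF assms(8,10) q] by blast
  have uvZ: "u \<in> Z" "v \<in> Z" using uv(1,2) assms(9) by auto
  have ind: "indep u v" unfolding indep_def using uv(5) by blast
  have pZ: "z [^]\<^bsub>G\<^esub> p \<in> N" if "z \<in> Z" for z using pw Z_closed[OF that] by blast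
  note ex = types_exist[OF uvZ(1) uv(3) n1 uvZ(2) uv(4) nm(2) ind uv(6) nm(1) pZ assms(16)[symmetric]]
  \<comment> \<open>\<open>diff_zero\<close> rewrites the \<open>k - 0\<close> copies of the general
    statement to \<open>k\<close>.\<close>
  note cl = classification[where k = k and Q = "Elem p (r - 2)", OF _ _ card, unfolded diff_zero]
  show ?thesis
  proof (intro conjI allI impI, goal_cases)
    case 1
    show ?case by (rule ex)
  next
    case (2 z)
    note b = A1[OF conjunct1[OF 2]]
    from cl[OF b(1) C_subI[OF conjunct2[OF 2] b(3)] b(2), THEN conjunct1] show ?case .
  next
    case (3 z)
    note b = A1[OF conjunct1[OF 3]]
    \<comment> \<open>With \<open>c\<close> in \<open><z 2>\<close> the two factors exchange roles;
      in types \<open>A_2\<close> and \<open>A_3\<close> the position of the vanishing functional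
      changes accordingly.\<close>
    from cl[OF pow_basis_swap[OF b(1)] C_subI[OF conjunct2[OF 3] b(4)] b(2), THEN conjunct1]
    show ?case .
  next
    case (4 z)
    note b = A2[OF conjunct1[OF 4]]
    from cl[OF b(1) C_subI[OF conjunct2[OF 4] b(3)] b(2), THEN conjunct2, THEN conjunct1,
        THEN mp, OF b(5)]
    show ?case .
  next
    case (5 z)
    note b = A2[OF conjunct1[OF 5]]
    from cl[OF pow_basis_swap[OF b(1)] C_subI[OF conjunct2[OF 5] b(4)] b(2), THEN conjunct2,
        THEN conjunct2, THEN mp, OF b(5)]
    show ?case .
  next
    case (6 z)
    note b = A3[OF conjunct1[OF 6]]
    from cl[OF b(1) C_subI[OF conjunct2[OF 6] b(3)] b(2), THEN conjunct2, THEN conjunct2,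
        THEN mp, OF b(5)]
    show ?case .
  next
    case (7 z)
    note b = A3[OF conjunct1[OF 7]]
    from cl[OF pow_basis_swap[OF b(1)] C_subI[OF conjunct2[OF 7] b(4)] b(2), THEN conjunct2,
        THEN conjunct1, THEN mp, OF b(5)]
    show ?case .
  next
    case (8 z)
    show ?case by (rule type_A4_classification[OF n1 nm(2) pw card 8 cN])
  qed
qed

end
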